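(* The map from matroids to $\mathbb{Z}[x]$ assigning to each loopless matroid $\mathsf{M}$ the Hilbert–Poincaré series of its Chow ring $\underline{\mathrm{CH}}(\mathsf{M})$, and to each matroid with loops the zero polynomial, is a valuative invariant.
   Context: All matroids have finite ground sets contained in the positive integers. For a loopless matroid $\mathsf{M}$ on $E$ let $\widehat{\mathcal{L}}(\mathsf{M})$ be the set of flats of $\mathsf{M}$ other than $\varnothing$ and $E$. The Chow ring of $\mathsf{M}$ is the graded ring $\underline{\mathrm{CH}}(\mathsf{M})=\mathbb{Q}[x_F: F\in\widehat{\mathcal{L}}(\mathsf{M})]/(I+J)$, where $I=\langle x_{F_1}x_{F_2}: F_1,F_2\in\widehat{\mathcal{L}}(\mathsf{M})\text{ incomparable}\rangle$ and $J=\langle\sum_{F\ni i}x_F-\sum_{F\ni j}x_F : i,j\in E\rangle$, graded by $\deg x_F=1$. Its Hilbert–Poincaré series is $\sum_{j\ge0}\dim_{\mathbb{Q}}(\underline{\mathrm{CH}}^j(\mathsf{M}))\,x^j$, which is a polynomial since $\underline{\mathrm{CH}}(\mathsf{M})$ is finite-dimensional. The base polytope of a matroid $\mathsf{M}$ on $E$ with bases $\mathscr{B}$ is $\mathscr{P}(\mathsf{M})=\operatorname{conv}\{\sum_{i\in B}e_i : B\in\mathscr{B}\}\subseteq\mathbb{R}^E$, with indicator function $\mathbf{1}_{\mathscr{P}(\mathsf{M})}:\mathbb{R}^E\to\mathbb{Z}$. A map $f$ from matroids to an abelian group is a valuation if $\sum_{i}a_if(\mathsf{M}_i)=0$ whenever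 $\mathsf{M}_1,\dots,\mathsf{M}_s$ are matroids on a common ground set and $a_i\in\mathbb{Z}$ satisfy $\sum_i a_i\mathbf{1}_{\mathscr{P}(\mathsf{M}_i)}=0$. (This is known to be equivalent to the inclusion–exclusion property under matroid subdivisions.) A valuative invariant is a valuation with $f(\mathsf{M})=f(\mathsf{N})$ whenever $\mathsf{M}\cong\mathsf{N}$. *)

theory Defs
  imports
    "HOL-Library.Indicator_Function"
    "HOL-Library.Poly_Mapping"
    "HOL-Computational_Algebra.Polynomial_FPS"
    "HOL-Algebra.Embedded_Algebras"
    "HOL-Algebra.QuotRing"
begin

section \<open>Matroids\<close>

text \<open>The datatype only carries the data; the axioms (finite ground set of positive integers,
  bases, basis exchange) are imposed by \<open>is_matroid\<close>.\<close>

datatype matroid = Matroid (ground: "nat set") (bases: "nat set set")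

definition is_matroid :: "matroid \<Rightarrow> bool" where
  "is_matroid M \<longleftrightarrow>
     finite (ground M) \<and> (\<forall>i\<in>ground M. 0 < i) \<and>
     bases M \<noteq> {} \<and> (\<forall>B\<in>bases M. B \<subseteq> ground M) \<and>
     (\<forall>A\<in>bases M. \<forall>B\<in>bases M. \<forall>a\<in>A - B. \<exists>b\<in>B - A. insert b (A - {a}) \<in> bases M)"

definition loopless :: "matroid \<Rightarrow> bool" where
  "loopless M \<longleftrightarrow> (\<forall>i\<in>ground M. \<exists>B\<in>bases M. i \<in> B)"

definition matroid_rank :: "matroid \<Rightarrow> nat set \<Rightarrow> nat" where
  "matroid_rank M A = Max ((\<lambda>B. card (A \<inter> B)) ` bases M)"

definition flats :: "matroid \<Rightarrow> nat set set" where
  "flats M = {F. F \<subseteq> ground M \<and> (\<forall>i\<in>ground M - F. matroid_rank M F < matroid_rank M (insert i F))}"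

definition proper_flats :: "matroid \<Rightarrow> nat set set" where
  "proper_flats M = flats M - {{}, ground M}"

definition matroid_iso :: "matroid \<Rightarrow> matroid \<Rightarrow> bool" where
  "matroid_iso M N \<longleftrightarrow>
     (\<exists>\<phi>. bij_betw \<phi> (ground M) (ground N) \<and> (\<lambda>B. \<phi> ` B) ` bases M = bases N)"


section \<open>Base polytopes and valuations\<close>

text \<open>\<open>\<real>\<^sup>E\<close> is the set of real functions on the natural numbers that vanish outside \<open>E\<close>.
  The vertex \<open>\<Sum>i\<in>B. e\<^sub>i\<close> is the indicator function of \<open>B\<close>, and the convex hull of the (finitely
  many) vertices is written out as the set of their convex combinations, since function spaces
  are not instances of the class of real vector spaces.\<close>

definition coord_space :: "nat set \<Rightarrow> (nat \<Rightarrow> real) set" where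
  "coord_space E = {x. \<forall>i. i \<notin> E \<longrightarrow> x i = 0}"

definition base_polytope :: "matroid \<Rightarrow> (nat \<Rightarrow> real) set" where
  "base_polytope M =
     {x. \<exists>c. (\<forall>B\<in>bases M. 0 \<le> c B) \<and> (\<Sum>B\<in>bases M. c B) = 1 \<and>
             x = (\<lambda>i. \<Sum>B\<in>bases M. c B * indicator B i)}"

definition int_scale :: "int \<Rightarrow> 'a::ab_group_add \<Rightarrow> 'a" where
  "int_scale k x = (\<Sum>i<nat k. x) - (\<Sum>i<nat (- k). x)"

lemma int_scale_eq_of_int_mult: "int_scale k x = of_int k * (x :: 'a :: ring_1)"
proof (cases "0 \<le> k")
  case True
  then show ?thesis by (simp add: int_scale_def of_nat_nat)
next
  case False
  then have "of_nat (nat (- k)) = (- of_int k :: 'a)"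
    by (subst of_nat_nat) auto
  with False show ?thesis by (simp add: int_scale_def)
qed

definition valuation :: "(matroid \<Rightarrow> 'a::ab_group_add) \<Rightarrow> bool" where
  "valuation f \<longleftrightarrow>
     (\<forall>E (s :: nat) (M :: nat \<Rightarrow> matroid) (a :: nat \<Rightarrow> int).
        (\<forall>i<s. is_matroid (M i) \<and> ground (M i) = E) \<and>
        (\<forall>x\<in>coord_space E. (\<Sum>i<s. a i * indicator (base_polytope (M i)) x) = 0)
        \<longrightarrow> (\<Sum>i<s. int_scale (a i) (f (M i))) = 0)"

definition valuative_invariant :: "(matroid \<Rightarrow> 'a::ab_group_add) \<Rightarrow> bool" where
  "valuative_invariant f \<longleftrightarrow>
     valuation f \<and>
     (\<forall>M N. is_matroid M \<and> is_matroid N \<and> matroid_iso M N \<longrightarrow> f M = f N)"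


section \<open>The Chow ring\<close>

text \<open>A polynomial over the rationals in variables indexed by sets of natural numbers is a finitely
  supported function from monomials to coefficients; a monomial is a finitely supported
  exponent function, and the monomial \<open>1\<close> is \<open>0\<close>.\<close>

type_synonym monomial = "nat set \<Rightarrow>\<^sub>0 nat"
type_synonym mpoly = "monomial \<Rightarrow>\<^sub>0 rat"

definition mpoly_const :: "rat \<Rightarrow> mpoly" where
  "mpoly_const c = Poly_Mapping.single 0 c"

definition mpoly_var :: "nat set \<Rightarrow> mpoly" where
  "mpoly_var F = Poly_Mapping.single (Poly_Mapping.single F 1) 1"

definition mpoly_ring :: "nat set set \<Rightarrow> mpoly ring" where
  "mpoly_ring V =
     \<lparr>carrier = {p. \<forall>m\<in>Poly_Mapping.keys p. Poly_Mapping.keys m \<subseteq> V},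
      mult = (*), one = 1, zero = 0, add = (+)\<rparr>"

definition total_degree :: "monomial \<Rightarrow> nat" where
  "total_degree m = (\<Sum>F\<in>Poly_Mapping.keys m. Poly_Mapping.lookup m F)"

definition homogeneous :: "nat \<Rightarrow> mpoly \<Rightarrow> bool" where
  "homogeneous j p \<longleftrightarrow> (\<forall>m\<in>Poly_Mapping.keys p. total_degree m = j)"

abbreviation flat_poly_ring :: "matroid \<Rightarrow> mpoly ring" where
  "flat_poly_ring M \<equiv> mpoly_ring (proper_flats M)"

definition chow_I :: "matroid \<Rightarrow> mpoly set" where
  "chow_I M = genideal (flat_poly_ring M)
     {mpoly_var F * mpoly_var G | F G. F \<in> proper_flats M \<and> G \<in> proper_flats M \<and> \<not> F \<subseteq> G \<and> \<not> G \<subseteq> F}"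

definition chow_J :: "matroid \<Rightarrow> mpoly set" where
  "chow_J M = genideal (flat_poly_ring M)
     {(\<Sum>F\<in>{F\<in>proper_flats M. i \<in> F}. mpoly_var F) - (\<Sum>F\<in>{F\<in>proper_flats M. j \<in> F}. mpoly_var F) | i j.
        i \<in> ground M \<and> j \<in> ground M}"

definition chow_ideal :: "matroid \<Rightarrow> mpoly set" where
  "chow_ideal M = chow_I M <+>\<^bsub>flat_poly_ring M\<^esub> chow_J M"

definition chow_ring :: "matroid \<Rightarrow> mpoly set ring" where
  "chow_ring M = flat_poly_ring M Quot chow_ideal M"

definition chow_class :: "matroid \<Rightarrow> mpoly \<Rightarrow> mpoly set" where
  "chow_class M p = chow_ideal M +>\<^bsub>flat_poly_ring M\<^esub> p"

definition chow_scalars :: "matroid \<Rightarrow> mpoly set set" where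
  "chow_scalars M = chow_class M ` mpoly_const ` UNIV"

definition chow_graded :: "matroid \<Rightarrow> nat \<Rightarrow> mpoly set set" where
  "chow_graded M j = chow_class M ` {p \<in> carrier (flat_poly_ring M). homogeneous j p}"

lemma carrier_mpoly_ring:
  "p \<in> carrier (mpoly_ring V) \<longleftrightarrow> (\<forall>m\<in>Poly_Mapping.keys p. Poly_Mapping.keys m \<subseteq> V)"
  by (simp add: mpoly_ring_def)

lemma mpoly_ring_simps [simp]:
  "p \<otimes>\<^bsub>mpoly_ring V\<^esub> q = p * q" "p \<oplus>\<^bsub>mpoly_ring V\<^esub> q = p + q"
  "\<one>\<^bsub>mpoly_ring V\<^esub> = 1" "\<zero>\<^bsub>mpoly_ring V\<^esub> = 0"
  by (simp_all add: mpoly_ring_def)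

lemma mpoly_const_in_carrier [simp]: "mpoly_const c \<in> carrier (mpoly_ring V)"
  by (auto simp: carrier_mpoly_ring mpoly_const_def)

lemma mpoly_var_in_carrier: "F \<in> V \<Longrightarrow> mpoly_var F \<in> carrier (mpoly_ring V)"
  by (auto simp: carrier_mpoly_ring mpoly_var_def)

lemma mpoly_ring_closed:
  assumes "p \<in> carrier (mpoly_ring V)" "q \<in> carrier (mpoly_ring V)"
  shows "p + q \<in> carrier (mpoly_ring V)" "p * q \<in> carrier (mpoly_ring V)"
    "- p \<in> carrier (mpoly_ring V)"
proof -
  show "p + q \<in> carrier (mpoly_ring V)"
    using assms Poly_Mapping.keys_add[of p q] unfolding carrier_mpoly_ring by blast
  show "- p \<in> carrier (mpoly_ring V)"
    using assms unfolding carrier_mpoly_ring by simp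
  show "p * q \<in> carrier (mpoly_ring V)"
    unfolding carrier_mpoly_ring
  proof
    fix m assume "m \<in> Poly_Mapping.keys (p * q)"
    then obtain a b where "m = a + b" "a \<in> Poly_Mapping.keys p" "b \<in> Poly_Mapping.keys q"
      using Poly_Mapping.keys_mult[of p q] by blast
    with assms Poly_Mapping.keys_add[of a b] show "Poly_Mapping.keys m \<subseteq> V"
      unfolding carrier_mpoly_ring by blast
  qed
qed

lemma mpoly_ring_cring: "cring (mpoly_ring V)"
proof (rule cringI)
  show "abelian_group (mpoly_ring V)"
  proof (rule abelian_groupI)
    fix p assume p: "p \<in> carrier (mpoly_ring V)"
    then show "\<exists>q\<in>carrier (mpoly_ring V). q \<oplus>\<^bsub>mpoly_ring V\<^esub> p = \<zero>\<^bsub>mpoly_ring V\<^esub>"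
      using mpoly_ring_closed(3)[OF p p] by (intro bexI[of _ "- p"]) auto
  qed (auto simp: mpoly_ring_closed algebra_simps, simp add: carrier_mpoly_ring)
  show "comm_monoid (mpoly_ring V)"
    by (rule comm_monoidI)
       (auto simp: mpoly_ring_closed algebra_simps, simp add: carrier_mpoly_ring)
qed (auto simp: algebra_simps)

lemma chow_generators_in_carrier:
  "{mpoly_var F * mpoly_var G | F G. F \<in> V \<and> G \<in> V \<and> \<not> F \<subseteq> G \<and> \<not> G \<subseteq> F} \<subseteq> carrier (mpoly_ring V)"
  "{(\<Sum>F\<in>{F\<in>V. i \<in> F}. mpoly_var F) - (\<Sum>F\<in>{F\<in>V. j \<in> F}. mpoly_var F) | i j.
     i \<in> E \<and> j \<in> E} \<subseteq> carrier (mpoly_ring V)"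
proof -
  have sum: "(\<Sum>F\<in>A. mpoly_var F) \<in> carrier (mpoly_ring V)" if "A \<subseteq> V" for A
    using that
    by (induction A rule: infinite_finite_induct)
       (auto simp: mpoly_ring_closed mpoly_var_in_carrier, simp_all add: carrier_mpoly_ring)
  show "{(\<Sum>F\<in>{F\<in>V. i \<in> F}. mpoly_var F) - (\<Sum>F\<in>{F\<in>V. j \<in> F}. mpoly_var F) | i j.
     i \<in> E \<and> j \<in> E} \<subseteq> carrier (mpoly_ring V)"
  proof safe
    fix i j
    show "(\<Sum>F\<in>{F\<in>V. i \<in> F}. mpoly_var F) - (\<Sum>F\<in>{F\<in>V. j \<in> F}. mpoly_var F) \<in> carrier (mpoly_ring V)"
      unfolding diff_conv_add_uminus
      by (intro mpoly_ring_closed(1) mpoly_ring_closed(3)[OF _ sum] sum) auto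
  qed
qed (auto simp: mpoly_ring_closed mpoly_var_in_carrier)

lemma chow_ideal_ideal: "ideal (chow_ideal M) (flat_poly_ring M)"
proof -
  interpret cring "flat_poly_ring M" by (rule mpoly_ring_cring)
  show ?thesis
    unfolding chow_ideal_def chow_I_def chow_J_def
    by (intro add_ideals genideal_ideal chow_generators_in_carrier)
qed

lemma chow_ring_cring: "cring (chow_ring M)"
  unfolding chow_ring_def
  by (rule ideal.quotient_is_cring[OF chow_ideal_ideal mpoly_ring_cring])

lemma lookup_times_0:
  fixes p q :: mpoly
  shows "Poly_Mapping.lookup (p * q) 0 = Poly_Mapping.lookup p 0 * Poly_Mapping.lookup q 0"
proof -
  have zero: "a + b = 0 \<longleftrightarrow> a = 0 \<and> b = 0" for a b :: monomial
    by (auto simp: poly_mapping_eq_iff lookup_add fun_eq_iff)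
  have "Poly_Mapping.lookup (p * q) 0 =
      (\<Sum>a. Poly_Mapping.lookup p a * (\<Sum>b. Poly_Mapping.lookup q b when 0 = a + b))"
    by (simp add: lookup_mult)
  also have "\<dots> = (\<Sum>a. Poly_Mapping.lookup p a * (Poly_Mapping.lookup q 0) when a = 0)"
  proof (rule Sum_any.cong)
    fix a
    have "(\<Sum>b. Poly_Mapping.lookup q b when 0 = a + b) = (Poly_Mapping.lookup q 0 when a = 0)"
    proof (cases "a = 0")
      case True
      then have "(\<Sum>b. Poly_Mapping.lookup q b when 0 = a + b) = (\<Sum>b. Poly_Mapping.lookup q b when b = 0)"
        by (intro Sum_any.cong) (auto simp: when_def)
      with True show ?thesis by simp
    next
      case False
      then have "(\<Sum>b. Poly_Mapping.lookup q b when 0 = a + b) = (\<Sum>b::monomial. 0)"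
        by (intro Sum_any.cong) (metis when_def zero)
      with False show ?thesis by simp
    qed
    then show "Poly_Mapping.lookup p a * (\<Sum>b. Poly_Mapping.lookup q b when 0 = a + b) =
        (Poly_Mapping.lookup p a * Poly_Mapping.lookup q 0 when a = 0)"
      by (simp add: when_def)
  qed
  finally show ?thesis by simp
qed

lemma constant_free_ideal: "ideal {p \<in> carrier (mpoly_ring V). Poly_Mapping.lookup p 0 = 0} (mpoly_ring V)"
  (is "ideal ?A ?R")
proof -
  interpret R: cring ?R by (rule mpoly_ring_cring)
  have minus: "\<ominus>\<^bsub>?R\<^esub> p = - p" if p: "p \<in> carrier ?R" for p
    using mpoly_ring_closed(3)[OF p p] p by (intro R.minus_equality) auto
  show ?thesis
  proof (rule idealI)
    show "ring ?R" by (rule R.ring_axioms)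
    have inv: "inv\<^bsub>add_monoid ?R\<^esub> p = - p" if "p \<in> carrier ?R" for p
      using minus[OF that] by (simp add: a_inv_def)
    show "subgroup ?A (add_monoid ?R)"
      by unfold_locales
         (use R.zero_closed in \<open>auto simp: mpoly_ring_closed lookup_add inv[simplified]\<close>)
  qed (auto simp: mpoly_ring_closed lookup_times_0)
qed

lemma chow_ideal_constant_free:
  "chow_ideal M \<subseteq> {p \<in> carrier (flat_poly_ring M). Poly_Mapping.lookup p 0 = 0}" (is "_ \<subseteq> ?A")
proof -
  interpret R: cring "flat_poly_ring M" by (rule mpoly_ring_cring)
  have ideal: "ideal ?A (flat_poly_ring M)" by (rule constant_free_ideal)
  have var: "Poly_Mapping.lookup (mpoly_var F) 0 = 0" for F
    by (simp add: mpoly_var_def lookup_single when_def single_zero poly_mapping_eq_iff fun_eq_iff)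
  have "chow_I M \<subseteq> ?A" unfolding chow_I_def
    using chow_generators_in_carrier(1)[of "proper_flats M"]
    by (intro R.genideal_minimal[OF ideal]) (auto simp: lookup_times_0 var)
  moreover have "chow_J M \<subseteq> ?A" unfolding chow_J_def
    using chow_generators_in_carrier(2)[of "proper_flats M" "ground M"]
    by (intro R.genideal_minimal[OF ideal]) (auto simp: lookup_minus lookup_sum var)
  ultimately show ?thesis
    unfolding chow_ideal_def set_add_def' by (fastforce simp: lookup_add intro: mpoly_ring_closed)
qed

lemma range_mpoly_const_subfield: "subfield (range mpoly_const) (mpoly_ring V)"
proof -
  interpret R: cring "mpoly_ring V" by (rule mpoly_ring_cring)
  have mult: "mpoly_const a * mpoly_const b = mpoly_const (a * b)" for a b
    by (simp add: mpoly_const_def mult_single)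
  have add: "mpoly_const a + mpoly_const b = mpoly_const (a + b)" for a b
    by (simp add: mpoly_const_def single_add)
  have one: "mpoly_const 1 = 1" and zero: "mpoly_const 0 = 0"
    by (simp_all add: mpoly_const_def)
  have minus: "\<ominus>\<^bsub>mpoly_ring V\<^esub> mpoly_const a = mpoly_const (- a)" for a
    by (intro R.minus_equality) (auto simp: add zero)
  have sub: "subring (range mpoly_const) (mpoly_ring V)"
    by (rule R.subringI) (auto simp: add mult minus simp flip: one)
  have "subcring (range mpoly_const) (mpoly_ring V)"
    using sub by (rule R.subcringI')
  then show ?thesis
  proof (rule R.subfieldI)
    show "Units (mpoly_ring V \<lparr>carrier := range mpoly_const\<rparr>) = range mpoly_const - {\<zero>\<^bsub>mpoly_ring V\<^esub>}"
    proof (intro equalityI subsetI)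
      fix p assume "p \<in> Units (mpoly_ring V \<lparr>carrier := range mpoly_const\<rparr>)"
      then show "p \<in> range mpoly_const - {\<zero>\<^bsub>mpoly_ring V\<^esub>}"
        by (auto simp: Units_def)
    next
      fix p assume "p \<in> range mpoly_const - {\<zero>\<^bsub>mpoly_ring V\<^esub>}"
      then obtain a where a: "p = mpoly_const a" "a \<noteq> 0" using zero by auto
      then show "p \<in> Units (mpoly_ring V \<lparr>carrier := range mpoly_const\<rparr>)"
        by (auto simp: Units_def mult one intro!: exI[of _ "inverse a"])
    qed
  qed
qed

lemma chow_scalars_subfield: "subfield (chow_scalars M) (chow_ring M)"
proof -
  interpret I: ideal "chow_ideal M" "flat_poly_ring M" by (rule chow_ideal_ideal)
  interpret h: ring_hom_ring "flat_poly_ring M" "chow_ring M" "chow_class M"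
    using I.rcos_ring_hom_ring unfolding chow_ring_def chow_class_def .
  have "(1 :: mpoly) \<notin> chow_ideal M"
    using chow_ideal_constant_free[of M] by (auto simp: lookup_one)
  have "\<one>\<^bsub>chow_ring M\<^esub> \<noteq> \<zero>\<^bsub>chow_ring M\<^esub>"
  proof
    assume "\<one>\<^bsub>chow_ring M\<^esub> = \<zero>\<^bsub>chow_ring M\<^esub>"
    then have "chow_ideal M +>\<^bsub>flat_poly_ring M\<^esub> \<one>\<^bsub>flat_poly_ring M\<^esub> = chow_ideal M"
      by (simp add: chow_ring_def FactRing_def)
    then have "\<one>\<^bsub>flat_poly_ring M\<^esub> \<in> chow_ideal M"
      using I.a_rcos_self[OF I.one_closed] by auto
    with \<open>1 \<notin> chow_ideal M\<close> show False by simp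
  qed
  then show ?thesis
    unfolding chow_scalars_def by (intro h.img_is_subfield range_mpoly_const_subfield)
qed

text \<open>The rational vector space structure on the Chow ring is multiplication by the classes of
  constants, which form a subfield by
  \<open>chow_scalars_subfield\<close>.\<close>

definition chow_dim :: "matroid \<Rightarrow> nat \<Rightarrow> nat" where
  "chow_dim M j = (ring.dim (chow_ring M) over chow_scalars M) (chow_graded M j)"

definition hilbert_series :: "matroid \<Rightarrow> int fps" where
  "hilbert_series M = Abs_fps (\<lambda>j. int (chow_dim M j))"

text \<open>The Hilbert--Poincare series viewed as an element of \<open>\<int>[x]\<close>; it is a polynomial because the
  Chow ring of a loopless matroid is finite-dimensional.\<close>

definition hilbert_poly :: "matroid \<Rightarrow> int poly" where
  "hilbert_poly M = (THE p. fps_of_poly p = hilbert_series M)"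

lemma hilbert_poly_eqI: "fps_of_poly p = hilbert_series M \<Longrightarrow> hilbert_poly M = p"
  unfolding hilbert_poly_def by (rule the_equality) (auto simp flip: fps_of_poly_eq_iff)

end

theory Submission
  imports Defs "HOL-Analysis.Analysis"
begin

text \<open>In terms of \<open>h\<^sub>F = - \<Sum>\<^sub>G\<^sub>\<supseteq>\<^sub>F x\<^sub>G\<close> the Chow ring has the relations
  \<open>h\<^sub>F h\<^sub>G = h\<^sub>U (h\<^sub>F + h\<^sub>G - h\<^sub>U)\<close> for the join \<open>U\<close> of \<open>F\<close> and \<open>G\<close>,
  \<open>h\<^sub>F h\<^sub>G\<^sup>d = h\<^sub>G\<^sup>d\<^sup>+\<^sup>1\<close> for \<open>F \<subset> G\<close> with rank difference \<open>d\<close>, and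
  \<open>h\<^sub>G\<^sup>r = 0\<close> for \<open>r\<close> the rank of \<open>G\<close>. They raise the sum of the ranks, so the monomials \<open>\<Prod> h\<^sub>F\<^sub>i\<^sup>a\<^sup>i\<close> along chains with
  \<open>a\<^sub>i < rk F\<^sub>i - rk F\<^sub>i\<^sub>-\<^sub>1\<close> span. They are independent because products of dragon Hall--Rado
  functionals of minors annihilate the ideal and pair triangularly with them. The
  dimensions therefore count chains of flats with prescribed ranks.

  The number of such chains is valuative: whether a chain of subsets consists of flats with
  prescribed ranks in a loopless matroid is a difference of two terms of the form ``the base polytope meets a
  given polyhedron'', and an integral relation between indicator functions of compact convex sets is inherited
  by the indicator of nonemptiness (the Euler characteristic).\<close>

section \<open>Matroid rank and flats\<close>

text \<open>The dimension of a quotient says nothing about base polytopes; it has to become a count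
  over an index set shared by all matroids on the ground set. Multisets of subsets with prescribed
  ranks form such an index set, and the matroid only decides which of them occur. The classes h_F
  are chosen because the linear relations become the vanishing of h_F for flats of rank one. A
  single degree functional would give a pairing matrix with no evident order. Each nested S
  therefore gets its own functional, built from its own support, and a dual monomial that uses up
  the remaining room; in its degree it detects S and otherwise only multisets of smaller rank sum.
  On the polytope side, looplessness and flatness ask for points with x_e > 0, and this strict
  condition would destroy compactness. It is replaced by x_e >= epsilon with epsilon depending only
  on the ground set and the chain data, so that one polyhedron serves all matroids of a relation.
  Subtracting the slice at weight c + 1/2 cancels the matroids whose maximal weight exceeds
  c.\<close>

lemma augmentation_of_exchange:
  fixes \<B> :: "'a set set"
  assumes fin: "\<And>B. B \<in> \<B> \<Longrightarrow> finite B"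
    and exch: "\<And>A B a. A \<in> \<B> \<Longrightarrow> B \<in> \<B> \<Longrightarrow> a \<in> A - B \<Longrightarrow> \<exists>b\<in>B - A. insert b (A - {a}) \<in> \<B>"
  shows "A \<in> \<B> \<Longrightarrow> B \<in> \<B> \<Longrightarrow> card A = card B"
    and "A \<in> \<B> \<Longrightarrow> B \<in> \<B> \<Longrightarrow> I \<subseteq> A \<Longrightarrow> J \<subseteq> B \<Longrightarrow> card I < card J \<Longrightarrow>
           \<exists>x\<in>J - I. \<exists>D\<in>\<B>. insert x I \<subseteq> D"
proof -
  have card_eq: "card A = card B" if "A \<in> \<B>" "B \<in> \<B>" for A B
    using that
  proof (induction "card (A - B)" arbitrary: A)
    case 0
    then have "A \<subseteq> B" using fin by simp
    moreover have "B - A = {}"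
    proof (rule ccontr)
      assume "B - A \<noteq> {}"
      then obtain b where "b \<in> B - A" by blast
      from exch[OF 0(3,2) this] \<open>A \<subseteq> B\<close> show False by blast
    qed
    ultimately show ?case by (metis Diff_eq_empty_iff subset_antisym)
  next
    case (Suc n)
    then obtain a where a: "a \<in> A - B" by (metis card.empty equals0I nat.distinct(1))
    from exch[OF Suc(3,4) a] obtain b where b: "b \<in> B - A" "insert b (A - {a}) \<in> \<B>" by blast
    have "insert b (A - {a}) - B = (A - B) - {a}" using b by blast
    then have "card (insert b (A - {a}) - B) = n" using Suc(2) a by simp
    with Suc(1)[of "insert b (A - {a})"] b Suc(4) have "card (insert b (A - {a})) = card B" by simp
    then show ?case using a b fin[OF Suc(3)]
      by (metis DiffD1 DiffD2 card.remove card_insert_disjoint finite_Diff)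
  qed
  show "card A = card B" if "A \<in> \<B>" "B \<in> \<B>" using card_eq that .
  show "\<exists>x\<in>J - I. \<exists>D\<in>\<B>. insert x I \<subseteq> D"
    if "A \<in> \<B>" "B \<in> \<B>" "I \<subseteq> A" "J \<subseteq> B" and less: "card I < card J"
  proof (rule ccontr)
    assume no: "\<not> ?thesis"
    \<comment> \<open>Bases B1 over I and B2 over J are chosen with as few elements of B2 as
      possible outside J \<union> B1. Minimality forces B2 into J \<union> B1, failure of
      augmentation forces B1 into I \<union> B2, and then card (B1 - B2) = card (B2 - B1)
      contradicts card I < card J.\<close>
    define P where "P = (\<lambda>(B1, B2). B1 \<in> \<B> \<and> B2 \<in> \<B> \<and> I \<subseteq> B1 \<and> J \<subseteq> B2)"
    have "P (A, B)" using that by (simp add: P_def)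
    then obtain p where p: "P p" and min: "\<And>q. P q \<Longrightarrow> card (snd p - (J \<union> fst p)) \<le> card (snd q - (J \<union> fst q))"
      using ex_has_least_nat[of P "(A, B)" "\<lambda>q. card (snd q - (J \<union> fst q))"] by blast
    obtain B1 B2 where [simp]: "p = (B1, B2)" by fastforce
    have B: "B1 \<in> \<B>" "B2 \<in> \<B>" "I \<subseteq> B1" "J \<subseteq> B2" using p by (auto simp: P_def)
    have JB1: "J - B1 = J - I" using no B by blast
    have "B2 - (J \<union> B1) = {}"
    proof (rule ccontr)
      assume "B2 - (J \<union> B1) \<noteq> {}"
      then obtain x where x: "x \<in> B2 - (J \<union> B1)" by blast
      then obtain y where y: "y \<in> B1 - B2" "insert y (B2 - {x}) \<in> \<B>" using exch[OF B(2,1)] by blast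
      have "P (B1, insert y (B2 - {x}))" using B x y by (auto simp: P_def)
      from min[OF this] have "card (B2 - (J \<union> B1)) \<le> card (insert y (B2 - {x}) - (J \<union> B1))" by simp
      moreover have "insert y (B2 - {x}) - (J \<union> B1) = B2 - (J \<union> B1) - {x}" using y by auto
      then have "insert y (B2 - {x}) - (J \<union> B1) \<subset> B2 - (J \<union> B1)" using x by auto
      ultimately show False using fin[OF B(2)] by (meson finite_Diff leD psubset_card_mono)
    qed
    then have B21: "B2 - B1 = J - I" using B JB1 by blast
    have "B1 - (I \<union> B2) = {}"
    proof (rule ccontr)
      assume "B1 - (I \<union> B2) \<noteq> {}"
      then obtain x where x: "x \<in> B1 - (I \<union> B2)" by blast
      then obtain y where y: "y \<in> B2 - B1" "insert y (B1 - {x}) \<in> \<B>" using exch[OF B(1,2)] by blast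
      then have "y \<in> J - I" "insert y I \<subseteq> insert y (B1 - {x})" using B21 x B by auto
      then show False using no y by blast
    qed
    then have B12: "B1 - B2 \<subseteq> I - J" using B by blast
    have "card (B1 - B2) = card (B2 - B1)"
      using card_eq[OF B(1,2)] fin B by (metis card_le_sym_Diff le_antisym order_refl)
    then have "card (J - I) \<le> card (I - J)"
      using B12 B21 by (metis B(1) B(3) card_mono fin finite_Diff finite_subset)
    moreover have "finite I" "finite J" using B fin finite_subset by blast+
    ultimately show False using less
      by (metis card_less_sym_Diff linorder_not_le)
  qed
qed

lemma finite_chain_Union_mem:
  "finite C \<Longrightarrow> C \<noteq> {} \<Longrightarrow> chain\<^sub>\<subseteq> C \<Longrightarrow> \<Union>C \<in> C"
proof (induction rule: finite_ne_induct)
  case (insert F C)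
  then have "\<Union>C \<in> C" by (auto simp: chain_subset_def)
  then have "F \<subseteq> \<Union>C \<or> \<Union>C \<subseteq> F" using insert.prems by (auto simp: chain_subset_def)
  then have "\<Union>(insert F C) = \<Union>C \<or> \<Union>(insert F C) = F" by auto
  with \<open>\<Union>C \<in> C\<close> show ?case by (metis insertCI)
qed auto

locale fin_matroid =
  fixes M :: matroid
  assumes matroid: "is_matroid M"
begin

abbreviation E where "E \<equiv> ground M"
abbreviation rk where "rk \<equiv> matroid_rank M"

definition indep :: "nat set \<Rightarrow> bool" where
  "indep I \<longleftrightarrow> (\<exists>B\<in>bases M. I \<subseteq> B)"

lemma finite_ground [simp]: "finite E"
  and bases_nonempty: "bases M \<noteq> {}"
  and basis_subset: "B \<in> bases M \<Longrightarrow> B \<subseteq> E"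
  using matroid by (auto simp: is_matroid_def)

lemma finite_basis: "B \<in> bases M \<Longrightarrow> finite B"
  using basis_subset finite_ground finite_subset by blast

lemma finite_bases [simp]: "finite (bases M)"
  using basis_subset by (intro finite_subset[of "bases M" "Pow E"]) auto

lemma exchange: "A \<in> bases M \<Longrightarrow> B \<in> bases M \<Longrightarrow> a \<in> A - B \<Longrightarrow> \<exists>b\<in>B - A. insert b (A - {a}) \<in> bases M"
  using matroid by (auto simp: is_matroid_def)

lemma augment:
  assumes "indep I" "indep J" "card I < card J"
  obtains x where "x \<in> J - I" "indep (insert x I)"
  using augmentation_of_exchange(2)[of "bases M"] finite_basis exchange assms
  unfolding indep_def by (metis (no_types, lifting))

lemma indep_subset: "indep I \<Longrightarrow> J \<subseteq> I \<Longrightarrow> indep J"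
  unfolding indep_def by blast

lemma indep_finite: "indep I \<Longrightarrow> finite I"
  unfolding indep_def using finite_basis finite_subset by blast

lemma card_Int_le_rk: "B \<in> bases M \<Longrightarrow> card (A \<inter> B) \<le> rk A"
  unfolding matroid_rank_def by (intro Max_ge) auto

lemma indep_card_le_rk:
  assumes "indep I" "I \<subseteq> A"
  shows "card I \<le> rk A"
proof -
  obtain B where B: "B \<in> bases M" "I \<subseteq> B" using assms indep_def by blast
  have "card I \<le> card (A \<inter> B)"
    using B assms finite_basis by (intro card_mono) auto
  then show ?thesis using card_Int_le_rk[OF B(1), of A] by simp
qed

lemma rk_attained: obtains B where "B \<in> bases M" "card (A \<inter> B) = rk A"
proof -
  have "rk A \<in> (\<lambda>B. card (A \<inter> B)) ` bases M"
    unfolding matroid_rank_def using bases_nonempty by (intro Max_in) auto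
  then show thesis using that by auto
qed

lemma indep_extend:
  assumes "indep I" "I \<subseteq> A"
  obtains J where "I \<subseteq> J" "J \<subseteq> A" "indep J" "card J = rk A"
proof -
  have "\<exists>J. I \<subseteq> J \<and> J \<subseteq> A \<and> indep J \<and> card J = rk A"
    using assms
  proof (induction "rk A - card I" arbitrary: I)
    case 0
    with indep_card_le_rk[of I A] show ?case by (intro exI[of _ I]) auto
  next
    case (Suc n)
    obtain B where B: "B \<in> bases M" "card (A \<inter> B) = rk A" using rk_attained .
    then have "indep (A \<inter> B)" "card I < card (A \<inter> B)" using Suc(2) by (auto simp: indep_def)
    from augment[OF Suc(3) this] obtain x where x: "x \<in> A \<inter> B - I" "indep (insert x I)" .
    have "card (insert x I) = Suc (card I)" using x indep_finite[OF Suc(3)] by simp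
    with Suc(2) have "n = rk A - card (insert x I)" by simp
    moreover have "insert x I \<subseteq> A" using x Suc(4) by blast
    ultimately obtain J where "insert x I \<subseteq> J" "J \<subseteq> A" "indep J" "card J = rk A"
      using Suc(1)[OF _ x(2)] by blast
    then show ?case by blast
  qed
  then show thesis using that by blast
qed

text \<open>Greedy choice along the chain: an independent set optimal for the smaller members is
  extended inside the largest one, and optimality below survives because no independent subset
  exceeds the rank. Hence the maximum over the bases of a positively weighted sum of
  \<open>card (F \<inter> B)\<close> along a chain is the same sum of ranks.\<close>

lemma rk_chain_attained:
  assumes "finite C" "chain\<^sub>\<subseteq> C"
  obtains B where "B \<in> bases M" "\<And>F. F \<in> C \<Longrightarrow> card (F \<inter> B) = rk F"
proof -
  have "\<exists>I. indep I \<and> I \<subseteq> \<Union>C \<and> (\<forall>F\<in>C. card (F \<inter> I) = rk F)"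
    using assms
  proof (induction "card C" arbitrary: C)
    case 0
    then show ?case using bases_nonempty by (auto simp: indep_def)
  next
    case (Suc n)
    define F where "F = \<Union>C"
    have F: "F \<in> C" using finite_chain_Union_mem[of C] Suc F_def by fastforce
    have "chain\<^sub>\<subseteq> (C - {F})" using Suc by (auto simp: chain_subset_def)
    with Suc F obtain I where I: "indep I" "I \<subseteq> \<Union>(C - {F})" "\<forall>K\<in>C - {F}. card (K \<inter> I) = rk K"
      by (metis card_Diff_singleton diff_Suc_1 finite_Diff)
    then have "I \<subseteq> F" by (auto simp: F_def)
    from indep_extend[OF I(1) this] obtain J where J: "I \<subseteq> J" "J \<subseteq> F" "indep J" "card J = rk F" .
    have "card (K \<inter> J) = rk K" if "K \<in> C" for K
    proof (cases "K = F")
      case True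
      then show ?thesis using J by (simp add: inf.absorb2)
    next
      case False
      then have "rk K = card (K \<inter> I)" using I that by auto
      also have "\<dots> \<le> card (K \<inter> J)" using J indep_finite by (intro card_mono) auto
      finally show ?thesis
        using indep_card_le_rk[of "K \<inter> J" K] indep_subset[OF J(3), of "K \<inter> J"] by auto
    qed
    then show ?case using J by (auto simp: F_def intro!: exI[of _ J])
  qed
  then obtain I where I: "indep I" "\<And>F. F \<in> C \<Longrightarrow> card (F \<inter> I) = rk F" by blast
  then obtain B where B: "B \<in> bases M" "I \<subseteq> B" by (auto simp: indep_def)
  have "card (F \<inter> B) = rk F" if "F \<in> C" for F
  proof (rule antisym)
    have "rk F = card (F \<inter> I)" using I that by simp
    also have "\<dots> \<le> card (F \<inter> B)" using B finite_basis by (intro card_mono) auto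
    finally show "rk F \<le> card (F \<inter> B)" .
  qed (rule card_Int_le_rk[OF B(1)])
  with B that show thesis by blast
qed

lemma rk_le_card: "finite A \<Longrightarrow> rk A \<le> card A"
  by (metis card_mono inf_le1 rk_attained)

lemma rk_empty [simp]: "rk {} = 0"
  using rk_le_card[of "{}"] by simp

lemma rk_mono: "A \<subseteq> A' \<Longrightarrow> rk A \<le> rk A'"
proof -
  assume A: "A \<subseteq> A'"
  obtain B where B: "B \<in> bases M" "card (A \<inter> B) = rk A" using rk_attained .
  have "card (A \<inter> B) \<le> card (A' \<inter> B)" using A B finite_basis by (intro card_mono) auto
  with B card_Int_le_rk[of B A'] show ?thesis by simp
qed

text \<open>X \<inter> Y and X \<union> Y form a chain, so one basis is optimal for both; counting
  its elements in X and Y gives the inequality.\<close>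

lemma rk_submodular: "rk (X \<union> Y) + rk (X \<inter> Y) \<le> rk X + rk Y"
proof -
  have "chain\<^sub>\<subseteq> {X \<inter> Y, X \<union> Y}" by (auto simp: chain_subset_def)
  then obtain B where B: "B \<in> bases M" "card ((X \<inter> Y) \<inter> B) = rk (X \<inter> Y)" "card ((X \<union> Y) \<inter> B) = rk (X \<union> Y)"
    using rk_chain_attained[of "{X \<inter> Y, X \<union> Y}"] by (metis finite.emptyI finite.insertI insertCI)
  have "card (X \<inter> B) + card (Y \<inter> B) = card ((X \<inter> B) \<union> (Y \<inter> B)) + card ((X \<inter> B) \<inter> (Y \<inter> B))"
    using finite_basis[OF B(1)] by (intro card_Un_Int) auto
  also have "(X \<inter> B) \<union> (Y \<inter> B) = (X \<union> Y) \<inter> B" by blast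
  also have "(X \<inter> B) \<inter> (Y \<inter> B) = (X \<inter> Y) \<inter> B" by blast
  finally show ?thesis using B card_Int_le_rk[OF B(1), of X] card_Int_le_rk[OF B(1), of Y] by simp
qed

lemma rk_insert_le: "rk (insert x A) \<le> Suc (rk A)"
  using rk_submodular[of "{x}" A] rk_le_card[of "{x}"] by simp

text \<open>What lies in the closure of X remains there after X grows by Z. The closure properties
  below rest on this consequence of submodularity.\<close>

lemma rk_absorb:
  assumes "rk (X \<union> Y) = rk X"
  shows "rk (X \<union> Y \<union> Z) = rk (X \<union> Z)"
proof (rule antisym)
  have "rk (X \<union> Y \<union> (X \<union> Z)) + rk ((X \<union> Y) \<inter> (X \<union> Z)) \<le> rk (X \<union> Y) + rk (X \<union> Z)"
    by (rule rk_submodular)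
  moreover have "rk X \<le> rk ((X \<union> Y) \<inter> (X \<union> Z))" by (rule rk_mono) blast
  moreover have "X \<union> Y \<union> (X \<union> Z) = X \<union> Y \<union> Z" by blast
  ultimately show "rk (X \<union> Y \<union> Z) \<le> rk (X \<union> Z)" using assms by simp
qed (rule rk_mono, blast)

lemma rk_absorb_all:
  assumes "finite Y" "\<And>y. y \<in> Y \<Longrightarrow> rk (insert y X) = rk X"
  shows "rk (X \<union> Y) = rk X"
  using assms
proof (induction Y)
  case (insert y Y)
  then have "rk (X \<union> Y) = rk X" "rk (X \<union> {y}) = rk X" by auto
  with rk_absorb[of X Y "{y}"] show ?case by (simp del: Un_insert_left add: Un_insert_right)
qed simp

definition cl :: "nat set \<Rightarrow> nat set" where
  "cl X = {i\<in>E. rk (insert i X) = rk X}"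

lemma flat_iff: "F \<in> flats M \<longleftrightarrow> F \<subseteq> E \<and> (\<forall>i\<in>E - F. rk (insert i F) = Suc (rk F))"
  unfolding flats_def using rk_insert_le le_antisym by (fastforce simp: Suc_le_eq)

lemma flat_subset: "F \<in> flats M \<Longrightarrow> F \<subseteq> E"
  by (simp add: flat_iff)

lemma finite_flats [simp]: "finite (flats M)"
  by (rule finite_subset[of _ "Pow E"]) (auto dest: flat_subset)

lemma ground_flat [simp]: "E \<in> flats M"
  by (simp add: flat_iff)

lemma rk_Un_cl: "rk (X \<union> cl X) = rk X"
  by (rule rk_absorb_all) (auto simp: cl_def)

lemma cl_superset: "X \<subseteq> E \<Longrightarrow> X \<subseteq> cl X"
  by (auto simp: cl_def insert_absorb)

lemma cl_subset: "cl X \<subseteq> E"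
  by (auto simp: cl_def)

lemma rk_cl_Un: "X \<subseteq> E \<Longrightarrow> rk (cl X \<union> Y) = rk (X \<union> Y)"
  using rk_absorb[OF rk_Un_cl, of X Y] cl_superset[of X] by (simp add: sup.absorb2)

lemma rk_cl: "X \<subseteq> E \<Longrightarrow> rk (cl X) = rk X"
  using rk_cl_Un[of X "{}"] by simp

lemma cl_flat: "X \<subseteq> E \<Longrightarrow> cl X \<in> flats M"
  unfolding flat_iff
proof (intro conjI ballI)
  fix i assume X: "X \<subseteq> E" and i: "i \<in> E - cl X"
  have "rk (insert i (cl X)) = rk (insert i X)" using rk_cl_Un[OF X, of "{i}"] by simp
  moreover have "rk (insert i X) \<noteq> rk X" using i by (auto simp: cl_def)
  moreover have "rk X \<le> rk (insert i X)" by (rule rk_mono) blast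
  ultimately show "rk (insert i (cl X)) = Suc (rk (cl X))"
    using rk_insert_le[of i X] rk_cl[OF X] by simp
qed (rule cl_subset)

lemma cl_minimal:
  assumes "F \<in> flats M" "X \<subseteq> F"
  shows "cl X \<subseteq> F"
proof
  fix i assume i: "i \<in> cl X"
  show "i \<in> F"
  proof (rule ccontr)
    assume "i \<notin> F"
    then have "rk (F \<union> {i}) = Suc (rk F)" using assms i by (auto simp: flat_iff cl_def)
    moreover have "rk (X \<union> {i} \<union> F) = rk (X \<union> F)" using i by (intro rk_absorb) (auto simp: cl_def)
    moreover have "X \<union> {i} \<union> F = F \<union> {i}" "X \<union> F = F" using assms by auto
    ultimately show False by simp
  qed
qed

lemma cl_least: "X \<subseteq> E \<Longrightarrow> F \<in> flats M \<Longrightarrow> cl X \<subseteq> F \<longleftrightarrow> X \<subseteq> F"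
  using cl_minimal cl_superset by blast

lemma flat_rk_less:
  assumes "F \<in> flats M" "G \<subseteq> E" "F \<subset> G"
  shows "rk F < rk G"
proof -
  obtain i where i: "i \<in> G - F" using assms by blast
  then have "rk (insert i F) = Suc (rk F)" using assms by (auto simp: flat_iff)
  moreover have "rk (insert i F) \<le> rk G" using i assms by (intro rk_mono) auto
  ultimately show ?thesis by simp
qed

lemma rk_flat_eq_imp_eq: "F \<in> flats M \<Longrightarrow> G \<in> flats M \<Longrightarrow> F \<subseteq> G \<Longrightarrow> rk F = rk G \<Longrightarrow> F = G"
  by (metis flat_rk_less flat_subset less_irrefl psubsetI)

lemma rk_cl_insert: "F \<in> flats M \<Longrightarrow> a \<in> E - F \<Longrightarrow> rk (cl (insert a F)) = Suc (rk F)"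
  using rk_cl[of "insert a F"] by (auto simp: flat_iff)

lemma mem_cl_singleton: "a \<in> E \<Longrightarrow> a \<in> cl {a}"
  by (simp add: cl_def)

end

locale loopless_matroid = fin_matroid +
  assumes loopless: "loopless M"
begin

lemma rk_singleton: "a \<in> E \<Longrightarrow> rk {a} = 1"
proof -
  assume "a \<in> E"
  then obtain B where "B \<in> bases M" "a \<in> B" using loopless by (auto simp: loopless_def)
  then have "indep {a}" by (auto simp: indep_def)
  from indep_card_le_rk[OF this, of "{a}"] rk_le_card[of "{a}"] show ?thesis by simp
qed

lemma empty_flat: "{} \<in> flats M"
  by (simp add: flat_iff rk_singleton)

lemma rk_cl_singleton: "a \<in> E \<Longrightarrow> rk (cl {a}) = 1"
  by (simp add: rk_cl rk_singleton)

end

section \<open>The Euler characteristic of compact convex sets\<close>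

text \<open>A point just to the right of s lies in the same intervals as s, except for those ending
  at s. The coefficients of the intervals ending at s therefore sum to zero, and grouping all
  intervals by their right endpoint finishes the argument.\<close>

lemma sum_eq_zero_of_interval_relation:
  fixes l u :: "'i \<Rightarrow> real" and a :: "'i \<Rightarrow> int"
  assumes fin: "finite I" and le: "\<And>i. i \<in> I \<Longrightarrow> l i \<le> u i"
    and rel: "\<And>t. (\<Sum>i\<in>{i\<in>I. l i \<le> t \<and> t \<le> u i}. a i) = 0"
  shows "(\<Sum>i\<in>I. a i) = 0"
proof -
  have zero: "(\<Sum>i\<in>{i\<in>I. u i = s}. a i) = 0" for s
  proof -
    have "eventually (\<lambda>t. \<forall>i\<in>I. (l i \<le> t \<longleftrightarrow> l i \<le> s) \<and> (t \<le> u i \<longleftrightarrow> s < u i)) (at_right s)"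
    proof (intro eventually_ball_finite fin ballI eventually_conj)
      fix i
      have gt: "eventually (\<lambda>t. s < t) (at_right s)" by (rule eventually_at_right_less)
      have lt: "eventually (\<lambda>t. t < b) (at_right s)" if "s < b" for b
        using that by (intro order_tendstoD(2)[OF tendsto_ident_at])
      show "eventually (\<lambda>t. l i \<le> t \<longleftrightarrow> l i \<le> s) (at_right s)"
      proof (cases "l i \<le> s")
        case True
        then show ?thesis by (intro eventually_mono[OF gt]) auto
      next
        case False
        then show ?thesis by (intro eventually_mono[OF lt[of "l i"]]) auto
      qed
      show "eventually (\<lambda>t. t \<le> u i \<longleftrightarrow> s < u i) (at_right s)"
      proof (cases "s < u i")
        case True
        then show ?thesis by (intro eventually_mono[OF lt[of "u i"]]) auto
      next
        case False
        then show ?thesis by (intro eventually_mono[OF gt]) auto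
      qed
    qed
    then obtain t where t: "\<forall>i\<in>I. (l i \<le> t \<longleftrightarrow> l i \<le> s) \<and> (t \<le> u i \<longleftrightarrow> s < u i)"
      using eventually_happens trivial_limit_at_right_real by blast
    have split: "{i\<in>I. l i \<le> s \<and> s \<le> u i} = {i\<in>I. u i = s} \<union> {i\<in>I. l i \<le> t \<and> t \<le> u i}"
      using t le by fastforce
    have "0 = (\<Sum>i\<in>{i\<in>I. u i = s}. a i) + (\<Sum>i\<in>{i\<in>I. l i \<le> t \<and> t \<le> u i}. a i)"
      unfolding rel[of s, symmetric] split
      using fin t by (intro sum.union_disjoint) auto
    then show ?thesis using rel[of t] by simp
  qed
  have "(\<Sum>i\<in>I. a i) = (\<Sum>s\<in>u ` I. \<Sum>i\<in>{i\<in>I. u i = s}. a i)"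
    using fin by (intro sum.group[symmetric]) auto
  then show ?thesis using zero by simp
qed

definition segment_closed :: "('a \<Rightarrow> real) set \<Rightarrow> bool" where
  "segment_closed K \<longleftrightarrow> (\<forall>x\<in>K. \<forall>y\<in>K. \<forall>t\<in>{0..1}. (\<lambda>i. (1 - t) * x i + t * y i) \<in> K)"

lemma segment_closed_Int: "segment_closed K \<Longrightarrow> segment_closed L \<Longrightarrow> segment_closed (K \<inter> L)"
  by (auto simp: segment_closed_def)

lemma segment_closed_hyperplane: "segment_closed {x. x e = t}"
  by (auto simp: segment_closed_def algebra_simps)

lemma closed_coordinate_hyperplane: "closed {x :: 'a \<Rightarrow> real. x e = t}"
  by (intro closed_Collect_eq continuous_on_product_coordinates continuous_on_const)

lemma coordinate_projection_interval:
  fixes K :: "('a \<Rightarrow> real) set"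
  assumes "compact K" "K \<noteq> {}" "segment_closed K"
  obtains l u where "l \<le> u" "\<And>t. (\<exists>x\<in>K. x e = t) \<longleftrightarrow> l \<le> t \<and> t \<le> u"
proof -
  have cont: "continuous_on K (\<lambda>x. x e)"
    by (rule continuous_on_subset[OF continuous_on_product_coordinates]) auto
  obtain x where x: "x \<in> K" "\<And>z. z \<in> K \<Longrightarrow> x e \<le> z e"
    using continuous_attains_inf[OF assms(1,2) cont] by blast
  obtain y where y: "y \<in> K" "\<And>z. z \<in> K \<Longrightarrow> z e \<le> y e"
    using continuous_attains_sup[OF assms(1,2) cont] by blast
  have "\<exists>z\<in>K. z e = t" if t: "x e \<le> t" "t \<le> y e" for t
  proof (cases "x e = y e")
    case True
    with t x show ?thesis by (intro bexI[of _ x]) auto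
  next
    case False
    with t have less: "x e < y e" by simp
    define s where "s = (t - x e) / (y e - x e)"
    have "s \<in> {0..1}" using t less by (auto simp: s_def field_simps)
    then have "(\<lambda>i. (1 - s) * x i + s * y i) \<in> K"
      using assms(3) x y by (auto simp: segment_closed_def)
    moreover have "s * (y e - x e) = t - x e" using less by (simp add: s_def)
    then have "(1 - s) * x e + s * y e = t" by (simp add: algebra_simps)
    ultimately show ?thesis by (intro bexI[of _ "\<lambda>i. (1 - s) * x i + s * y i"])
  qed
  then show thesis using x y by (intro that[of "x e" "y e"]) auto
qed

text \<open>By slicing along a coordinate, the relation passes to the projections, which are intervals.\<close>

lemma sum_nonempty_eq_zero:
  fixes K :: "'i \<Rightarrow> ('a \<Rightarrow> real) set" and a :: "'i \<Rightarrow> int"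
  assumes "finite A" "finite I"
    and "\<And>i. i \<in> I \<Longrightarrow> compact (K i)" "\<And>i. i \<in> I \<Longrightarrow> segment_closed (K i)"
    and "\<And>i x e. i \<in> I \<Longrightarrow> x \<in> K i \<Longrightarrow> e \<notin> A \<Longrightarrow> x e = z e"
    and "\<And>x. (\<Sum>i\<in>{i\<in>I. x \<in> K i}. a i) = 0"
  shows "(\<Sum>i\<in>{i\<in>I. K i \<noteq> {}}. a i) = 0"
  using assms(1,3-)
proof (induction A arbitrary: K z)
  case empty
  have "K i \<noteq> {} \<longleftrightarrow> z \<in> K i" if "i \<in> I" for i
  proof -
    have "x = z" if "x \<in> K i" for x
      using empty(3)[OF \<open>i \<in> I\<close> that] by auto
    then show ?thesis by blast
  qed
  then have "{i\<in>I. K i \<noteq> {}} = {i\<in>I. z \<in> K i}" by blast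
  then show ?case using empty(4)[of z] by simp
next
  case (insert e A)
  define J where "J = {i\<in>I. K i \<noteq> {}}"
  have J: "finite J" using assms(2) by (simp add: J_def)
  have "\<forall>i\<in>J. \<exists>l u. l \<le> u \<and> (\<forall>t. (\<exists>x\<in>K i. x e = t) \<longleftrightarrow> l \<le> t \<and> t \<le> u)"
  proof
    fix i assume "i \<in> J"
    then have "compact (K i)" "K i \<noteq> {}" "segment_closed (K i)" using insert.prems by (auto simp: J_def)
    from coordinate_projection_interval[OF this, of e] show "\<exists>l u. l \<le> u \<and> (\<forall>t. (\<exists>x\<in>K i. x e = t) \<longleftrightarrow> l \<le> t \<and> t \<le> u)"
      by metis
  qed
  then obtain l u where lu: "\<And>i. i \<in> J \<Longrightarrow> l i \<le> u i"
    "\<And>i t. i \<in> J \<Longrightarrow> (\<exists>x\<in>K i. x e = t) \<longleftrightarrow> l i \<le> t \<and> t \<le> u i"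
    by metis
  have "(\<Sum>i\<in>{i\<in>J. l i \<le> t \<and> t \<le> u i}. a i) = 0" for t
  proof -
    define K' where "K' i = K i \<inter> {x. x e = t}" for i
    have "(\<Sum>i\<in>{i\<in>I. K' i \<noteq> {}}. a i) = 0"
    \<comment> \<open>The values z of the fixed coordinates are a parameter of the induction: the
      slice moves e from the free coordinates to the fixed ones and records t in z.\<close>
    proof (rule insert.IH[where z = "z(e := t)"])
      fix i assume i: "i \<in> I"
      show "compact (K' i)" unfolding K'_def
        by (intro compact_Int_closed insert.prems(1) i closed_coordinate_hyperplane)
      show "segment_closed (K' i)" unfolding K'_def
        by (intro segment_closed_Int insert.prems(2) i segment_closed_hyperplane)
    next
      fix i x e' assume "i \<in> I" "x \<in> K' i" "e' \<notin> A"
      then show "x e' = (z(e := t)) e'" using insert.prems(3)[of i x e'] by (auto simp: K'_def)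
    next
      fix x
      show "(\<Sum>i\<in>{i\<in>I. x \<in> K' i}. a i) = 0"
        using insert.prems(4)[of x] by (cases "x e = t") (simp_all add: K'_def)
    qed
    moreover have "{i\<in>I. K' i \<noteq> {}} = {i\<in>J. l i \<le> t \<and> t \<le> u i}"
      using lu(2) by (auto simp: K'_def J_def)
    ultimately show ?thesis by simp
  qed
  from sum_eq_zero_of_interval_relation[OF J lu(1) this] show ?case by (simp add: J_def)
qed

lemma chain_subset_insert:
  "chain\<^sub>\<subseteq> C \<Longrightarrow> (\<And>F. F \<in> C \<Longrightarrow> F \<subseteq> X \<or> X \<subseteq> F) \<Longrightarrow> chain\<^sub>\<subseteq> (insert X C)"
  by (fastforce simp: chain_subset_def)

section \<open>Flags of flats through base polytopes\<close>

text \<open>The weights are place values in base n + 1, and the element inserted last takes the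
  units digit, so the weighted sum determines every digit. One linear functional can thus prescribe
  all ranks on a chain at once.\<close>

lemma exists_separating_weights:
  assumes "finite C"
  shows "\<exists>w :: 'a \<Rightarrow> nat. (\<forall>F. 0 < w F) \<and> (\<forall>f g. (\<forall>F\<in>C. f F \<le> n \<and> g F \<le> n) \<longrightarrow>
    (\<Sum>F\<in>C. w F * f F) = (\<Sum>F\<in>C. w F * g F) \<longrightarrow> (\<forall>F\<in>C. f F = g F))"
  using assms
proof (induction C)
  case empty
  show ?case by (intro exI[of _ "\<lambda>_. 1"]) auto
next
  case (insert K C)
  obtain w :: "'a \<Rightarrow> nat" where pos: "\<forall>F. 0 < w F" and
    sep: "\<forall>f g. (\<forall>F\<in>C. f F \<le> n \<and> g F \<le> n) \<longrightarrow>
      (\<Sum>F\<in>C. w F * f F) = (\<Sum>F\<in>C. w F * g F) \<longrightarrow> (\<forall>F\<in>C. f F = g F)"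
    using insert.IH by (elim exE conjE)
  define v where "v = (\<lambda>F. Suc n * w F)(K := 1)"
  have v: "(\<Sum>F\<in>insert K C. v F * f F) = Suc n * (\<Sum>F\<in>C. w F * f F) + f K" for f :: "'a \<Rightarrow> nat"
  proof -
    have "(\<Sum>F\<in>C. v F * f F) = (\<Sum>F\<in>C. Suc n * (w F * f F))"
      using insert.hyps by (intro sum.cong) (auto simp: v_def algebra_simps)
    then show ?thesis using insert.hyps by (simp add: v_def sum_distrib_left)
  qed
  have "\<forall>F. 0 < v F" using pos by (simp add: v_def)
  moreover have "\<forall>F\<in>insert K C. f F = g F"
    if le: "\<forall>F\<in>insert K C. f F \<le> n \<and> g F \<le> n"
      and eq: "(\<Sum>F\<in>insert K C. v F * f F) = (\<Sum>F\<in>insert K C. v F * g F)" for f g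
  proof -
    have K: "f K < Suc n" "g K < Suc n" using le by (auto simp: less_Suc_eq_le)
    have eq': "Suc n * (\<Sum>F\<in>C. w F * f F) + f K = Suc n * (\<Sum>F\<in>C. w F * g F) + g K"
      using eq by (simp only: v)
    have "(Suc n * (\<Sum>F\<in>C. w F * f F) + f K) mod Suc n = f K"
         "(Suc n * (\<Sum>F\<in>C. w F * g F) + g K) mod Suc n = g K"
      using K by (simp_all only: mod_mult_self4 mod_less)
    then have "f K = g K" using eq' by metis
    moreover from this eq' have "(\<Sum>F\<in>C. w F * f F) = (\<Sum>F\<in>C. w F * g F)"
      by (metis add_right_cancel mult_left_cancel nat.distinct(1))
    ultimately show ?thesis using sep[rule_format, of f g] le by blast
  qed
  ultimately show ?case by (intro exI[of _ v] conjI allI impI) simp_all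
qed

definition chain_weight :: "(nat set \<Rightarrow> nat) \<Rightarrow> nat set set \<Rightarrow> (nat \<Rightarrow> real) \<Rightarrow> real" where
  "chain_weight w C x = (\<Sum>F\<in>C. real (w F) * (\<Sum>i\<in>F. x i))"

context fin_matroid
begin

lemma base_polytopeE:
  assumes "x \<in> base_polytope M"
  obtains d where "\<forall>B\<in>bases M. 0 \<le> d B" "(\<Sum>B\<in>bases M. d B) = 1"
    "x = (\<lambda>i. \<Sum>B\<in>bases M. d B * indicator B i)"
  using assms unfolding base_polytope_def by blast

lemma compact_base_polytope: "compact (base_polytope M)"
proof -
  define S where "S B = (if B \<in> bases M then {0..1::real} else {0})" for B
  define D where "D = PiE UNIV S \<inter> {c. (\<Sum>B\<in>bases M. c B) = 1}"
  have "compactin (product_topology (\<lambda>_. euclidean) UNIV) (PiE UNIV S)"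
    by (subst compactin_PiE) (auto simp: S_def)
  then have "compact (PiE UNIV S)" by (simp add: euclidean_product_topology)
  moreover have "closed {c :: nat set \<Rightarrow> real. (\<Sum>B\<in>bases M. c B) = 1}"
    by (intro closed_Collect_eq continuous_on_sum continuous_on_product_coordinates continuous_on_const)
  ultimately have "compact D" unfolding D_def by (rule compact_Int_closed)
  moreover have "continuous_on D (\<lambda>c i. \<Sum>B\<in>bases M. c B * indicator B i)"
    by (intro continuous_on_coordinatewise_then_product continuous_on_sum continuous_on_mult
        continuous_on_const continuous_on_subset[OF continuous_on_product_coordinates]) auto
  ultimately have "compact ((\<lambda>c i. \<Sum>B\<in>bases M. c B * indicator B i) ` D :: (nat \<Rightarrow> real) set)"
    by (rule compact_continuous_image[rotated])
  moreover have "base_polytope M = (\<lambda>c i. \<Sum>B\<in>bases M. c B * indicator B i) ` D"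
  proof (intro equalityI subsetI)
    fix x assume "x \<in> base_polytope M"
    then obtain c where c: "\<forall>B\<in>bases M. 0 \<le> c B" "(\<Sum>B\<in>bases M. c B) = 1"
      "x = (\<lambda>i. \<Sum>B\<in>bases M. c B * indicator B i)"
      by (auto simp: base_polytope_def)
    define c' where "c' B = (if B \<in> bases M then c B else 0)" for B
    have le: "c B \<le> 1" if "B \<in> bases M" for B
      using member_le_sum[of B "bases M" c] c that by simp
    have "(\<Sum>B\<in>bases M. c' B) = 1" using c by (simp add: c'_def)
    then have "c' \<in> D" using c le by (auto simp: D_def S_def c'_def)
    moreover have "x = (\<lambda>i. \<Sum>B\<in>bases M. c' B * indicator B i)" using c by (simp add: c'_def)
    ultimately show "x \<in> (\<lambda>c i. \<Sum>B\<in>bases M. c B * indicator B i) ` D" by blast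
  next
    fix x assume "x \<in> (\<lambda>c i. \<Sum>B\<in>bases M. c B * indicator B i) ` D"
    then obtain c where c: "c \<in> D" "x = (\<lambda>i. \<Sum>B\<in>bases M. c B * indicator B i)" by blast
    have "0 \<le> c B" if "B \<in> bases M" for B
    proof -
      have "c B \<in> S B" using c by (auto simp: D_def)
      then show ?thesis using that by (simp add: S_def)
    qed
    then show "x \<in> base_polytope M" using c by (auto simp: base_polytope_def D_def)
  qed
  ultimately show ?thesis by simp
qed

lemma segment_closed_base_polytope: "segment_closed (base_polytope M)"
  unfolding segment_closed_def
proof (intro ballI)
  fix x y and t :: real assume "x \<in> base_polytope M" "y \<in> base_polytope M" and t: "t \<in> {0..1}"
  then obtain c d where c: "\<forall>B\<in>bases M. 0 \<le> c B" "(\<Sum>B\<in>bases M. c B) = 1"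
      "x = (\<lambda>i. \<Sum>B\<in>bases M. c B * indicator B i)"
    and d: "\<forall>B\<in>bases M. 0 \<le> d B" "(\<Sum>B\<in>bases M. d B) = 1"
      "y = (\<lambda>i. \<Sum>B\<in>bases M. d B * indicator B i)"
    unfolding base_polytope_def by blast
  define k where "k B = (1 - t) * c B + t * d B" for B
  have "\<forall>B\<in>bases M. 0 \<le> k B" using c d t by (auto simp: k_def)
  moreover have "(\<Sum>B\<in>bases M. k B) = 1"
    using c d by (simp add: k_def sum.distrib flip: sum_distrib_left)
  moreover have "(\<lambda>i. (1 - t) * x i + t * y i) = (\<lambda>i. \<Sum>B\<in>bases M. k B * indicator B i)"
    unfolding c(3) d(3) k_def sum_distrib_left sum.distrib[symmetric]
    by (intro ext sum.cong refl) (simp only: distrib_right mult.assoc)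
  ultimately show "(\<lambda>i. (1 - t) * x i + t * y i) \<in> base_polytope M"
    unfolding base_polytope_def by blast
qed

lemma base_polytope_subset: "base_polytope M \<subseteq> coord_space E"
  by (auto simp: base_polytope_def coord_space_def indicator_def intro!: sum.neutral dest: basis_subset)


lemma chain_weight_combination:
  assumes "finite C" "C \<subseteq> Pow E"
  shows "chain_weight w C (\<lambda>i. \<Sum>B\<in>bases M. c B * indicator B i) =
    (\<Sum>B\<in>bases M. c B * real (\<Sum>F\<in>C. w F * card (F \<inter> B)))"
proof -
  have inner: "(\<Sum>i\<in>F. \<Sum>B\<in>bases M. c B * indicator B i) = (\<Sum>B\<in>bases M. c B * real (card (F \<inter> B)))"
    if "F \<in> C" for F
  proof -
    have "finite F" using that assms finite_subset[OF _ finite_ground] by blast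
    then have "(\<Sum>i\<in>F. indicator B i) = real (card (F \<inter> B))" for B
      using sum.inter_restrict[of F "\<lambda>_. 1 :: real" B] by (simp add: indicator_def of_bool_def)
    then show ?thesis by (subst sum.swap) (simp flip: sum_distrib_left)
  qed
  have "chain_weight w C (\<lambda>i. \<Sum>B\<in>bases M. c B * indicator B i) =
      (\<Sum>F\<in>C. \<Sum>B\<in>bases M. c B * (real (w F) * real (card (F \<inter> B))))"
    unfolding chain_weight_def
    by (intro sum.cong refl) (simp only: inner sum_distrib_left mult.left_commute)
  also have "\<dots> = (\<Sum>B\<in>bases M. c B * real (\<Sum>F\<in>C. w F * card (F \<inter> B)))"
    by (subst sum.swap) (simp add: sum_distrib_left)
  finally show ?thesis .
qed

text \<open>These are the coefficients of the point (1 - t) V + t b with b the barycentre of D. With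
  h arbitrary, total mass, coordinates and chain weight of the point are all instances of one
  formula.\<close>

lemma base_polytope_combination:
  assumes "finite D" "D \<noteq> {}" "D \<subseteq> bases M" "V \<in> bases M" "0 \<le> t" "t \<le> 1"
  obtains c where "\<And>B. 0 \<le> c B" "(\<Sum>B\<in>bases M. c B) = 1"
    "\<And>h :: nat set \<Rightarrow> real. (\<Sum>B\<in>bases M. c B * h B) = (1 - t) * h V + t * (\<Sum>B\<in>D. h B) / card D"
proof -
  define c where "c B = (1 - t) * of_bool (B = V) + t * of_bool (B \<in> D) / card D" for B
  have card: "0 < card D" using assms by (simp add: card_gt_0_iff)
  have h: "(\<Sum>B\<in>bases M. c B * h B) = (1 - t) * h V + t * (\<Sum>B\<in>D. h B) / card D" for h :: "nat set \<Rightarrow> real"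
  proof -
    have "(\<Sum>B\<in>bases M. c B * h B) =
        (\<Sum>B\<in>bases M. if B = V then (1 - t) * h B else 0) + (\<Sum>B\<in>bases M. if B \<in> D then t * h B / card D else 0)"
      unfolding sum.distrib[symmetric] by (intro sum.cong) (auto simp: c_def algebra_simps)
    also have "(\<Sum>B\<in>bases M. if B = V then (1 - t) * h B else 0) = (1 - t) * h V"
      using assms by (simp add: sum.delta)
    also have "(\<Sum>B\<in>bases M. if B \<in> D then t * h B / card D else 0) = (\<Sum>B\<in>D. t * h B / card D)"
      using assms by (subst sum.inter_restrict[symmetric]) (auto simp: Int_absorb1)
    finally show ?thesis by (simp add: sum_distrib_left sum_divide_distrib)
  qed
  show thesis
  proof (rule that[of c])
    show "(\<Sum>B\<in>bases M. c B) = 1" using h[of "\<lambda>_. 1"] card by simp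
    show "0 \<le> c B" for B using assms by (simp add: c_def)
  qed (rule h)
qed

lemma rk_le_card_ground: "F \<subseteq> E \<Longrightarrow> rk F \<le> card E"
  by (meson card_mono finite_ground finite_subset le_trans rk_le_card)

lemma card_bases_le: "D \<subseteq> bases M \<Longrightarrow> card D \<le> 2 ^ card E"
proof -
  assume "D \<subseteq> bases M"
  then have "D \<subseteq> Pow E" using basis_subset by blast
  then have "card D \<le> card (Pow E)" by (intro card_mono) auto
  then show ?thesis by (simp add: card_Pow)
qed

text \<open>Let \<open>W\<close> be the maximum of the weight on the base polytope. If \<open>W < c\<close>, both slices are empty.
  If \<open>W > c\<close>, both are nonempty or both are empty: a small step from a vertex of maximal weight towards
  the barycentre of the vertices makes all coordinates positive and costs at most one half of the weight.
  If \<open>W = c\<close>, only the face of weight \<open>c\<close> counts, and it has a point with positive coordinates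
  iff the minors between consecutive members of \<open>C\<close> are loopless, that is, iff these members are flats.\<close>

lemma flag_indicator_eq:
  fixes w \<rho> :: "nat set \<Rightarrow> nat"
  assumes C: "finite C" "chain\<^sub>\<subseteq> C" "C \<subseteq> Pow E"
    and wpos: "\<And>F. 0 < w F"
    and sep: "\<forall>f g. (\<forall>F\<in>C. f F \<le> card E \<and> g F \<le> card E) \<longrightarrow>
      (\<Sum>F\<in>C. w F * f F) = (\<Sum>F\<in>C. w F * g F) \<longrightarrow> (\<forall>F\<in>C. f F = g F)"
    and \<rho>: "\<And>F. F \<in> C \<Longrightarrow> \<rho> F \<le> card E"
    and \<tau>: "\<tau> = 1 / (2 * (1 + real (\<Sum>F\<in>C. w F * card E)))"
    and \<epsilon>: "\<epsilon> = \<tau> / 2 ^ card E"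
    and c: "c = (\<Sum>F\<in>C. w F * \<rho> F)"
    and Q: "\<And>s. Q s = {x. s \<le> chain_weight w C x \<and> (\<forall>e\<in>E. \<epsilon> \<le> x e)}"
  shows "of_bool (loopless M \<and> (\<forall>F\<in>C. F \<in> flats M \<and> rk F = \<rho> F)) =
    (of_bool (base_polytope M \<inter> Q (real c) \<noteq> {}) - of_bool (base_polytope M \<inter> Q (real c + 1 / 2) \<noteq> {}) :: int)"
proof -
  define val where "val B = (\<Sum>F\<in>C. w F * card (F \<inter> B))" for B
  define W where "W = (\<Sum>F\<in>C. w F * rk F)"
  have finF: "finite F" if "F \<in> C" for F using that C finite_subset[OF _ finite_ground] by blast
  have W_le: "W \<le> (\<Sum>F\<in>C. w F * card E)"
    unfolding W_def using C rk_le_card_ground by (intro sum_mono mult_le_mono2) auto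
  have \<tau>_pos: "0 < \<tau>" "\<tau> \<le> 1"
    unfolding \<tau> by (simp_all add: divide_le_eq add_pos_nonneg del: of_nat_sum)
  have \<tau>W: "\<tau> * real W \<le> 1 / 2"
  proof -
    have "\<tau> * real W \<le> \<tau> * (1 + real (\<Sum>F\<in>C. w F * card E))"
      using W_le \<tau>_pos by (intro mult_left_mono) linarith+
    also have "\<dots> = 1 / 2"
    proof -
      have "0 < 1 + real (\<Sum>F\<in>C. w F * card E)" by linarith
      then show ?thesis unfolding \<tau> by (simp add: field_simps)
    qed
    finally show ?thesis .
  qed
  have \<epsilon>_pos: "0 < \<epsilon>" using \<tau>_pos by (simp add: \<epsilon>)
  have val_le: "val B \<le> W" if "B \<in> bases M" for B
    unfolding val_def W_def by (intro sum_mono mult_le_mono2 card_Int_le_rk that)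
  \<comment> \<open>Each term is bounded by its value at the rank and all weights are positive, so
    equality of the totals forces equality for every member of the chain.\<close>
  have val_eq: "card (F \<inter> B) = rk F" if "B \<in> bases M" "val B = W" "F \<in> C" for B F
  proof (rule ccontr)
    assume "card (F \<inter> B) \<noteq> rk F"
    then have "card (F \<inter> B) < rk F" using card_Int_le_rk[OF that(1), of F] by simp
    then have "val B < W" unfolding val_def W_def
      using C that(3) wpos[of F] by (intro sum_strict_mono_ex1) (auto intro!: bexI[of _ F] card_Int_le_rk that(1))
    with that show False by simp
  qed
  have poly: "\<exists>d. (\<forall>B\<in>bases M. 0 \<le> d B) \<and> (\<Sum>B\<in>bases M. d B) = 1 \<and>
      x = (\<lambda>i. \<Sum>B\<in>bases M. d B * indicator B i) \<and> chain_weight w C x = (\<Sum>B\<in>bases M. d B * real (val B))"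
    if x: "x \<in> base_polytope M" for x
  proof -
    obtain d where d: "\<forall>B\<in>bases M. 0 \<le> d B" "(\<Sum>B\<in>bases M. d B) = 1"
      "x = (\<lambda>i. \<Sum>B\<in>bases M. d B * indicator B i)" using x by (rule base_polytopeE)
    have "chain_weight w C x = (\<Sum>B\<in>bases M. d B * real (val B))"
      unfolding d(3) val_def by (rule chain_weight_combination[OF C(1,3)])
    with d show ?thesis by blast
  qed
  have weight_le: "chain_weight w C x \<le> W" if x: "x \<in> base_polytope M" for x
  proof -
    obtain d where d: "(\<forall>B\<in>bases M. 0 \<le> d B)" "(\<Sum>B\<in>bases M. d B) = 1"
      "chain_weight w C x = (\<Sum>B\<in>bases M. d B * real (val B))" using poly[OF x] by blast
    have "(\<Sum>B\<in>bases M. d B * real (val B)) \<le> (\<Sum>B\<in>bases M. d B * real W)"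
      using d val_le by (intro sum_mono mult_left_mono) auto
    also have "\<dots> = W" using d by (simp flip: sum_distrib_right)
    finally show ?thesis using d by simp
  qed
  have point: "base_polytope M \<inter> Q s \<noteq> {}"
    if D: "D \<noteq> {}" "D \<subseteq> bases M" "\<And>e. e \<in> E \<Longrightarrow> \<exists>B\<in>D. e \<in> B" and V: "V \<in> bases M"
      and s: "s \<le> (1 - \<tau>) * real (val V) + \<tau> * (\<Sum>B\<in>D. real (val B)) / card D" for D V s
  proof -
    have fin: "finite D" using D finite_bases finite_subset by blast
    obtain d where d: "\<And>B. 0 \<le> d B" "(\<Sum>B\<in>bases M. d B) = 1"
      "\<And>h :: nat set \<Rightarrow> real. (\<Sum>B\<in>bases M. d B * h B) = (1 - \<tau>) * h V + \<tau> * (\<Sum>B\<in>D. h B) / card D"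
      using base_polytope_combination[OF fin D(1,2) V, of \<tau>] \<tau>_pos by (metis less_imp_le)
    define x where "x = (\<lambda>i. \<Sum>B\<in>bases M. d B * indicator B i)"
    have "x \<in> base_polytope M" using d(1,2) unfolding x_def base_polytope_def by blast
    moreover have "chain_weight w C x = (\<Sum>B\<in>bases M. d B * real (val B))"
      unfolding x_def val_def by (rule chain_weight_combination[OF C(1,3)])
    then have "s \<le> chain_weight w C x" using s d(3)[of "\<lambda>B. real (val B)"] by simp
    \<comment> \<open>A basis of D through e has coefficient at least
      \<open>\<tau> / card D\<close>, and \<open>card D\<close> is at most
      \<open>2 ^ card E\<close>. This bound, unlike \<open>card D\<close>, does not depend on the
      matroid.\<close>
    moreover have "\<epsilon> \<le> x e" if e: "e \<in> E" for e
    proof -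
      obtain B where B: "B \<in> D" "e \<in> B" using D e by blast
      have "real (card D) \<le> real (2 ^ card E)" using card_bases_le[OF D(2)] by (simp only: of_nat_le_iff)
      then have card: "0 < card D" "real (card D) \<le> 2 ^ card E" using fin D by (simp_all add: card_gt_0_iff)
      have "1 \<le> (\<Sum>B\<in>D. indicator B e :: real)"
        using member_le_sum[of B D "\<lambda>B. indicator B e :: real"] fin B by simp
      then have "\<tau> * 1 / card D \<le> \<tau> * (\<Sum>B\<in>D. indicator B e) / card D"
        using \<tau>_pos by (intro divide_right_mono mult_left_mono) auto
      moreover have "0 \<le> (1 - \<tau>) * indicator V e" using \<tau>_pos by simp
      moreover have "\<epsilon> \<le> \<tau> * 1 / card D" unfolding \<epsilon> using card \<tau>_pos by (intro frac_le) auto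
      ultimately show ?thesis unfolding x_def d(3) by linarith
    qed
    ultimately show ?thesis unfolding Q by blast
  qed
  have loop: "base_polytope M \<inter> Q s = {}" if "\<not> loopless M" for s
  proof -
    obtain e where e: "e \<in> E" "\<And>B. B \<in> bases M \<Longrightarrow> e \<notin> B" using \<open>\<not> loopless M\<close> by (auto simp: loopless_def)
    have "x e = 0" if x: "x \<in> base_polytope M" for x
    proof -
      obtain d where "x = (\<lambda>i. \<Sum>B\<in>bases M. d B * indicator B i)"
        using x by (rule base_polytopeE)
      then show ?thesis using e(2) by (auto simp: indicator_def intro!: sum.neutral)
    qed
    then show ?thesis using \<epsilon>_pos e by (force simp: Q)
  qed
  have weight_eq: "W = c" if "\<forall>F\<in>C. F \<in> flats M \<and> rk F = \<rho> F"
    using that by (simp add: W_def c)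
  consider (loop) "\<not> loopless M" | (less) "loopless M" "W < c" | (greater) "loopless M" "c < W"
    | (eq) "loopless M" "W = c" by linarith
  then show ?thesis
  proof cases
    case loop
    with \<open>\<And>s. \<not> loopless M \<Longrightarrow> base_polytope M \<inter> Q s = {}\<close> show ?thesis by simp
  next
    case less
    have "\<not> (\<forall>F\<in>C. F \<in> flats M \<and> rk F = \<rho> F)"
      using less weight_eq by auto
    moreover have "base_polytope M \<inter> Q s = {}" if "real c \<le> s" for s
      using weight_le less that by (force simp: Q)
    ultimately show ?thesis by simp
  next
    case greater
    obtain V where V: "V \<in> bases M" "\<And>F. F \<in> C \<Longrightarrow> card (F \<inter> V) = rk F" using rk_chain_attained[OF C(1,2)] by metis
    then have "val V = W" by (simp add: val_def W_def)
    have "real c + 1 \<le> W" using greater by simp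
    then have "real c + 1 / 2 \<le> (1 - \<tau>) * real W + 0" using \<tau>W by (simp add: algebra_simps)
    also have "\<dots> \<le> (1 - \<tau>) * real (val V) + \<tau> * (\<Sum>B\<in>bases M. real (val B)) / card (bases M)"
      unfolding \<open>val V = W\<close> using \<tau>_pos by (intro add_mono order_refl divide_nonneg_nonneg mult_nonneg_nonneg sum_nonneg) auto
    finally have le: "real c + 1 / 2 \<le> (1 - \<tau>) * real (val V) + \<tau> * (\<Sum>B\<in>bases M. real (val B)) / card (bases M)" .
    have "base_polytope M \<inter> Q s \<noteq> {}" if "s \<le> real c + 1 / 2" for s
      using greater(1) that le by (intro point[of "bases M" V] bases_nonempty V) (auto simp: loopless_def)
    moreover have "\<not> (\<forall>F\<in>C. F \<in> flats M \<and> rk F = \<rho> F)"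
      using greater weight_eq by auto
    ultimately show ?thesis by simp
  next
    case eq
    \<comment> \<open>Both rank vectors are bounded by \<open>card E\<close>, so the single equality
      of weighted sums separates into equality at every F.\<close>
    have rk: "rk F = \<rho> F" if "F \<in> C" for F
    proof -
      have "\<forall>F\<in>C. rk F \<le> card E \<and> \<rho> F \<le> card E" using \<rho> C rk_le_card_ground by blast
      moreover have "(\<Sum>F\<in>C. w F * rk F) = (\<Sum>F\<in>C. w F * \<rho> F)" using eq by (simp add: W_def c)
      ultimately show ?thesis using sep that by blast
    qed
    have empty: "base_polytope M \<inter> Q (real c + 1 / 2) = {}"
      using weight_le eq by (force simp: Q)
    have "base_polytope M \<inter> Q (real c) \<noteq> {}" if flats: "\<forall>F\<in>C. F \<in> flats M"
    proof -
      define D where "D = {B\<in>bases M. val B = W}"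
      obtain V where V: "V \<in> bases M" "\<And>F. F \<in> C \<Longrightarrow> card (F \<inter> V) = rk F" using rk_chain_attained[OF C(1,2)] by metis
      then have VD: "V \<in> D" by (simp add: val_def W_def D_def)
      \<comment> \<open>K is the largest member of the chain avoiding e, or {}, which is a flat by
        looplessness. Adding K and \<open>insert e K\<close> still leaves a chain, so one basis is
        optimal for all these sets; as K is a flat, that basis must contain e.\<close>
      have "\<exists>B\<in>D. e \<in> B" if e: "e \<in> E" for e
      proof -
        define K where "K = \<Union>{F\<in>C. e \<notin> F}"
        interpret loopless_matroid M using eq by unfold_locales
        have K: "K \<in> flats M"
        proof (cases "{F\<in>C. e \<notin> F} = {}")
          case True
          then have "K = {}" unfolding K_def by (simp only: Union_empty)
          then show ?thesis using empty_flat by simp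
        next
          case False
          have "chain\<^sub>\<subseteq> {F\<in>C. e \<notin> F}" using C(2) by (auto simp: chain_subset_def)
          then have "K \<in> {F\<in>C. e \<notin> F}" unfolding K_def using False C(1)
            by (intro finite_chain_Union_mem) auto
          then show ?thesis using flats by blast
        qed
        have sub: "K \<subseteq> F" if "F \<in> C" "e \<in> F" for F
        proof -
          have "F' \<subseteq> F" if "F' \<in> C" "e \<notin> F'" for F'
            using \<open>F \<in> C\<close> \<open>e \<in> F\<close> that C(2) unfolding chain_subset_def by blast
          then show ?thesis by (auto simp: K_def)
        qed
        have below: "F \<subseteq> K" if "F \<in> C" "e \<notin> F" for F using that by (auto simp: K_def)
        have "F \<subseteq> insert e K \<or> insert e K \<subseteq> F" if "F \<in> C" for F
          using that sub[of F] below[of F] by (cases "e \<in> F") auto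
        then have "chain\<^sub>\<subseteq> (insert (insert e K) C)" by (intro chain_subset_insert C(2))
        moreover have "F \<subseteq> K \<or> K \<subseteq> F" if "F \<in> insert (insert e K) C" for F
          using that sub[of F] below[of F] by (cases "F = insert e K") auto
        ultimately have "chain\<^sub>\<subseteq> (insert K (insert (insert e K) C))" by (rule chain_subset_insert)
        then obtain B where B: "B \<in> bases M" "\<And>F. F \<in> insert K (insert (insert e K) C) \<Longrightarrow> card (F \<inter> B) = rk F"
          using rk_chain_attained[of "insert K (insert (insert e K) C)"] C(1) by (metis finite.insertI)
        have "e \<notin> K" by (auto simp: K_def)
        then have "rk (insert e K) = Suc (rk K)" using K e by (auto simp: flat_iff)
        then have "card (insert e K \<inter> B) \<noteq> card (K \<inter> B)" using B(2)[of K] B(2)[of "insert e K"] by simp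
        then have "e \<in> B" by (metis Int_insert_left_if0)
        moreover have "B \<in> D" using B by (simp add: D_def val_def W_def)
        ultimately show ?thesis by blast
      qed
      moreover have "real c \<le> (1 - \<tau>) * real (val V) + \<tau> * (\<Sum>B\<in>D. real (val B)) / card D"
      proof -
        have "0 < card D" using VD by (auto simp: card_gt_0_iff D_def)
        moreover have "(\<Sum>B\<in>D. real (val B)) = card D * real W" by (simp add: D_def)
        ultimately have "(1 - \<tau>) * real (val V) + \<tau> * (\<Sum>B\<in>D. real (val B)) / card D = (1 - \<tau>) * real (val V) + \<tau> * real W"
          by simp
        moreover have "val V = W" using VD by (simp add: D_def)
        ultimately show ?thesis using eq by (simp add: algebra_simps)
      qed
      ultimately show ?thesis using VD by (intro point[of D V]) (auto simp: D_def)
    qed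
    moreover have "F \<in> flats M" if ne: "base_polytope M \<inter> Q (real c) \<noteq> {}" and F: "F \<in> C" for F
      unfolding flat_iff
    proof (intro conjI ballI)
      show "F \<subseteq> E" using F C by blast
      fix e assume e: "e \<in> E - F"
      obtain x where x: "x \<in> base_polytope M" "x \<in> Q (real c)" using ne by blast
      obtain d where d: "\<And>B. B \<in> bases M \<Longrightarrow> 0 \<le> d B" "(\<Sum>B\<in>bases M. d B) = 1"
        "x = (\<lambda>i. \<Sum>B\<in>bases M. d B * indicator B i)" "chain_weight w C x = (\<Sum>B\<in>bases M. d B * real (val B))"
        using poly[OF x(1)] by (elim exE conjE) metis
      have "0 < x e" using x e \<epsilon>_pos by (force simp: Q)
      then have "(\<Sum>B\<in>bases M. d B * indicator B e) \<noteq> 0" unfolding d(3) by linarith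
      then obtain B where B: "B \<in> bases M" "d B * indicator B e \<noteq> 0" by (meson sum.neutral)
      then have "d B \<noteq> 0" "e \<in> B" by (auto simp: indicator_def split: if_splits)
      \<comment> \<open>The point attains the maximal weight, so every basis with nonzero
        coefficient does. One of them contains e; it is optimal for F and meets
        \<open>insert e F\<close> in one element more.\<close>
      have "(\<Sum>B\<in>bases M. d B * (real W - real (val B))) \<le> 0"
        using x(2) d(2,4) eq by (simp add: Q right_diff_distrib sum_subtractf flip: sum_distrib_right)
      moreover have nonneg: "0 \<le> d B * (real W - real (val B))" if "B \<in> bases M" for B
        using d(1)[OF that] val_le[OF that] by simp
      ultimately have "(\<Sum>B\<in>bases M. d B * (real W - real (val B))) = 0"
        by (meson antisym sum_nonneg)
      then have "d B * (real W - real (val B)) = 0"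
        using nonneg B(1) by (subst (asm) sum_nonneg_eq_0_iff) auto
      then have "val B = W" using \<open>d B \<noteq> 0\<close> by simp
      then have "card (F \<inter> B) = rk F" using val_eq B F by blast
      moreover have "card (insert e F \<inter> B) = Suc (card (F \<inter> B))"
        using e \<open>e \<in> B\<close> finite_basis[OF B(1)] by simp
      ultimately show "rk (insert e F) = Suc (rk F)"
        using card_Int_le_rk[OF B(1), of "insert e F"] rk_insert_le[of e F] by simp
    qed
    ultimately have "(loopless M \<and> (\<forall>F\<in>C. F \<in> flats M \<and> rk F = \<rho> F)) \<longleftrightarrow> base_polytope M \<inter> Q (real c) \<noteq> {}"
      using eq rk by blast
    then show ?thesis using empty by simp
  qed
qed

end

lemma chain_weight_segment:
  "chain_weight w C (\<lambda>i. (1 - t) * x i + t * y i) = (1 - t) * chain_weight w C x + t * chain_weight w C y"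
  unfolding chain_weight_def sum_distrib_left sum.distrib[symmetric]
  by (intro sum.cong refl) (simp add: sum.distrib sum_distrib_left algebra_simps)

lemma closed_weight_halfspace:
  "closed {x. s \<le> chain_weight w C x \<and> (\<forall>e\<in>A. \<epsilon> \<le> x e)}"
proof -
  have "closed {x. s \<le> chain_weight w C x}"
    unfolding chain_weight_def
    by (intro closed_Collect_le continuous_on_const continuous_on_sum continuous_on_mult
        continuous_on_product_coordinates)
  moreover have "closed {x :: nat \<Rightarrow> real. \<epsilon> \<le> x e}" for e
    by (intro closed_Collect_le continuous_on_const continuous_on_product_coordinates)
  then have "closed (\<Inter>e\<in>A. {x :: nat \<Rightarrow> real. \<epsilon> \<le> x e})" by blast
  moreover have "{x. s \<le> chain_weight w C x \<and> (\<forall>e\<in>A. \<epsilon> \<le> x e)} =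
      {x. s \<le> chain_weight w C x} \<inter> (\<Inter>e\<in>A. {x. \<epsilon> \<le> x e})" by blast
  ultimately show ?thesis by (simp only: closed_Int)
qed

lemma segment_closed_weight_halfspace:
  "segment_closed {x. s \<le> chain_weight w C x \<and> (\<forall>e\<in>A. \<epsilon> \<le> x e)}"
  unfolding segment_closed_def
proof (intro ballI)
  fix x y t
  assume x: "x \<in> {x. s \<le> chain_weight w C x \<and> (\<forall>e\<in>A. \<epsilon> \<le> x e)}"
    and y: "y \<in> {x. s \<le> chain_weight w C x \<and> (\<forall>e\<in>A. \<epsilon> \<le> x e)}" and t: "t \<in> {0..1::real}"
  have conv: "r \<le> (1 - t) * a + t * b" if "r \<le> a" "r \<le> b" for r a b :: real
  proof -
    have "(1 - t) * r + t * r \<le> (1 - t) * a + t * b"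
      using t that by (intro add_mono mult_left_mono) auto
    then show ?thesis by (simp add: algebra_simps)
  qed
  show "(\<lambda>i. (1 - t) * x i + t * y i) \<in> {x. s \<le> chain_weight w C x \<and> (\<forall>e\<in>A. \<epsilon> \<le> x e)}"
    using x y by (auto simp: chain_weight_segment intro!: conv)
qed

section \<open>Flag indicators are valuative\<close>

definition flag_type :: "matroid \<Rightarrow> nat set set \<Rightarrow> (nat set \<Rightarrow> nat) \<Rightarrow> bool" where
  "flag_type N C \<rho> \<longleftrightarrow> loopless N \<and> (\<forall>F\<in>C. F \<in> flats N \<and> matroid_rank N F = \<rho> F)"

text \<open>The weights, c and \<epsilon> depend only on A, C and \<rho>, so the same two slices
  serve every matroid of the relation. Intersecting with a fixed set preserves a relation between
  indicator functions, and the Euler characteristic then applies to each slice.\<close>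

lemma flag_type_valuative:
  fixes N :: "nat \<Rightarrow> matroid" and a :: "nat \<Rightarrow> int"
  assumes N: "\<And>i. i < s \<Longrightarrow> is_matroid (N i)" "\<And>i. i < s \<Longrightarrow> ground (N i) = A"
    and rel: "\<And>x. x \<in> coord_space A \<Longrightarrow> (\<Sum>i<s. a i * indicator (base_polytope (N i)) x) = 0"
    and A: "finite A" and C: "finite C" "chain\<^sub>\<subseteq> C" "C \<subseteq> Pow A" and \<rho>: "\<And>F. F \<in> C \<Longrightarrow> \<rho> F \<le> card A"
  shows "(\<Sum>i<s. a i * of_bool (flag_type (N i) C \<rho>)) = 0"
proof -
  obtain w :: "nat set \<Rightarrow> nat" where w: "\<forall>F. 0 < w F"
    "\<forall>f g. (\<forall>F\<in>C. f F \<le> card A \<and> g F \<le> card A) \<longrightarrow>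
      (\<Sum>F\<in>C. w F * f F) = (\<Sum>F\<in>C. w F * g F) \<longrightarrow> (\<forall>F\<in>C. f F = g F)"
    using exists_separating_weights[OF C(1), of "card A"] by (elim exE conjE)
  define \<epsilon> :: real where "\<epsilon> = 1 / (2 * (1 + real (\<Sum>F\<in>C. w F * card A))) / 2 ^ card A"
  define c where "c = (\<Sum>F\<in>C. w F * \<rho> F)"
  define Q where "Q r = {x. r \<le> chain_weight w C x \<and> (\<forall>e\<in>A. \<epsilon> \<le> x e)}" for r :: real
  have ind: "of_bool (flag_type (N i) C \<rho>) = (of_bool (base_polytope (N i) \<inter> Q (real c) \<noteq> {}) -
    of_bool (base_polytope (N i) \<inter> Q (real c + 1 / 2) \<noteq> {}) :: int)" if i: "i < s" for i
  proof -
    interpret fin_matroid "N i" using N(1)[OF i] by unfold_locales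
    show ?thesis unfolding flag_type_def
      by (rule flag_indicator_eq[where w = w and \<epsilon> = \<epsilon>, OF C(1,2) _ _ _ _ refl])
        (use C \<rho> w in \<open>simp_all add: N(2)[OF i] \<epsilon>_def c_def Q_def\<close>)
  qed
  have zero: "(\<Sum>i<s. a i * of_bool (base_polytope (N i) \<inter> Q r \<noteq> {})) = 0" for r
  proof -
    have "(\<Sum>i\<in>{i\<in>{..<s}. base_polytope (N i) \<inter> Q r \<noteq> {}}. a i) = 0"
    proof (rule sum_nonempty_eq_zero[OF A, where z = "\<lambda>_. 0"])
      fix i assume i: "i \<in> {..<s}"
      interpret fin_matroid "N i" using N(1) i by unfold_locales auto
      show "compact (base_polytope (N i) \<inter> Q r)"
        unfolding Q_def by (intro compact_Int_closed compact_base_polytope closed_weight_halfspace)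
      show "segment_closed (base_polytope (N i) \<inter> Q r)" unfolding Q_def
        by (intro segment_closed_Int segment_closed_base_polytope segment_closed_weight_halfspace)
      fix x e assume "x \<in> base_polytope (N i) \<inter> Q r" "e \<notin> A"
      then show "x e = 0" using base_polytope_subset i N(2) by (auto simp: coord_space_def)
    next
      fix x :: "nat \<Rightarrow> real"
      show "(\<Sum>i\<in>{i\<in>{..<s}. x \<in> base_polytope (N i) \<inter> Q r}. a i) = 0"
      proof (cases "x \<in> coord_space A \<and> x \<in> Q r")
        case True
        have "(\<Sum>i\<in>{i\<in>{..<s}. x \<in> base_polytope (N i) \<inter> Q r}. a i) =
            (\<Sum>i<s. if x \<in> base_polytope (N i) then a i else 0)"
          using True by (subst sum.inter_filter[symmetric]) auto
        also have "\<dots> = (\<Sum>i<s. a i * indicator (base_polytope (N i)) x)"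
          by (intro sum.cong) auto
        finally show ?thesis using rel True by simp
      next
        case False
        \<comment> \<open>The Euler argument needs the relation at every function; one outside
          \<open>coord_space A\<close> or outside the slice lies in none of the sets.\<close>
        have "x \<notin> base_polytope (N i) \<inter> Q r" if "i < s" for i
        proof -
          interpret fin_matroid "N i" using N(1)[OF that] by unfold_locales
          show ?thesis using False base_polytope_subset N(2)[OF that] by auto
        qed
        then have "{i\<in>{..<s}. x \<in> base_polytope (N i) \<inter> Q r} = {}" by blast
        then show ?thesis by (simp only: sum.empty)
      qed
    qed simp
    moreover have "(\<Sum>i<s. a i * of_bool (base_polytope (N i) \<inter> Q r \<noteq> {})) =
        (\<Sum>i\<in>{i\<in>{..<s}. base_polytope (N i) \<inter> Q r \<noteq> {}}. a i)"
      unfolding sum.inter_filter[OF finite_lessThan] by (rule sum.cong) auto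
    ultimately show ?thesis by simp
  qed
  have "(\<Sum>i<s. a i * of_bool (flag_type (N i) C \<rho>)) =
      (\<Sum>i<s. a i * of_bool (base_polytope (N i) \<inter> Q (real c) \<noteq> {}) -
        a i * of_bool (base_polytope (N i) \<inter> Q (real c + 1 / 2) \<noteq> {}))"
  proof (rule sum.cong[OF refl])
    fix i assume "i \<in> {..<s}"
    then have "i < s" by simp
    show "a i * of_bool (flag_type (N i) C \<rho>) = a i * of_bool (base_polytope (N i) \<inter> Q (real c) \<noteq> {}) -
        a i * of_bool (base_polytope (N i) \<inter> Q (real c + 1 / 2) \<noteq> {})"
      unfolding ind[OF \<open>i < s\<close>] by (rule right_diff_distrib)
  qed
  then show ?thesis by (simp only: sum_subtractf zero diff_self)
qed

section \<open>Linear maps and substitutions on polynomials\<close>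

text \<open>Linear extension from terms to polynomials, for f additive in the coefficient. As the
  coefficient is an argument of f, this serves ring-valued substitutions and rational functionals
  alike.\<close>

definition pm_sum :: "('a \<Rightarrow> 'b \<Rightarrow> 'c) \<Rightarrow> ('a \<Rightarrow>\<^sub>0 'b::zero) \<Rightarrow> 'c::comm_monoid_add" where
  "pm_sum f p = (\<Sum>m\<in>Poly_Mapping.keys p. f m (Poly_Mapping.lookup p m))"

lemma pm_sum_superset:
  assumes "\<And>m. f m 0 = 0" "finite A" "Poly_Mapping.keys p \<subseteq> A"
  shows "pm_sum f p = (\<Sum>m\<in>A. f m (Poly_Mapping.lookup p m))"
  unfolding pm_sum_def using assms by (intro sum.mono_neutral_left) (auto simp: in_keys_iff)

lemma pm_sum_add:
  assumes "\<And>m. f m 0 = 0" "\<And>m a b. f m (a + b) = f m a + f m b"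
  shows "pm_sum f (p + q) = pm_sum f p + pm_sum f q"
proof -
  let ?A = "Poly_Mapping.keys p \<union> Poly_Mapping.keys q"
  have "pm_sum f r = (\<Sum>m\<in>?A. f m (Poly_Mapping.lookup r m))" if "Poly_Mapping.keys r \<subseteq> ?A" for r
    using that by (intro pm_sum_superset assms) auto
  then show ?thesis using Poly_Mapping.keys_add[of p q]
    by (simp add: lookup_add assms(2) sum.distrib)
qed

lemma pm_sum_single: "f m 0 = 0 \<Longrightarrow> pm_sum f (Poly_Mapping.single m c) = f m c"
  by (cases "c = 0") (auto simp: pm_sum_def)

lemma poly_mapping_sum_singles:
  "p = (\<Sum>m\<in>Poly_Mapping.keys p. Poly_Mapping.single m (Poly_Mapping.lookup p m))"
proof (rule poly_mapping_eqI)
  fix k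
  have "Poly_Mapping.lookup (\<Sum>m\<in>Poly_Mapping.keys p. Poly_Mapping.single m (Poly_Mapping.lookup p m)) k =
      (\<Sum>m\<in>Poly_Mapping.keys p. if m = k then Poly_Mapping.lookup p m else 0)"
    unfolding lookup_sum by (intro sum.cong) (auto simp: lookup_single)
  then show "Poly_Mapping.lookup p k =
      Poly_Mapping.lookup (\<Sum>m\<in>Poly_Mapping.keys p. Poly_Mapping.single m (Poly_Mapping.lookup p m)) k"
    by (simp add: in_keys_iff)
qed

lemma poly_mapping_additive_induct [case_names zero single add]:
  fixes p :: "'a \<Rightarrow>\<^sub>0 'b::comm_monoid_add"
  assumes "P 0" "\<And>m c. P (Poly_Mapping.single m c)" "\<And>p q. P p \<Longrightarrow> P q \<Longrightarrow> P (p + q)"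
  shows "P p"
proof -
  have "P (\<Sum>m\<in>A. Poly_Mapping.single m (Poly_Mapping.lookup p m))" if "finite A" for A
    using that assms by (induction A) auto
  then show ?thesis using poly_mapping_sum_singles[of p] by (metis finite_keys)
qed

text \<open>Polynomials in the classes h_F. Their monomials are multisets because the Hall--Rado
  conditions range over submultisets.\<close>

type_synonym hpoly = "nat set multiset \<Rightarrow>\<^sub>0 rat"

definition mono_subst :: "(nat set \<Rightarrow> hpoly) \<Rightarrow> monomial \<Rightarrow> hpoly" where
  "mono_subst \<xi> m = (\<Prod>F\<in>Poly_Mapping.keys m. \<xi> F ^ Poly_Mapping.lookup m F)"

definition poly_subst :: "(nat set \<Rightarrow> hpoly) \<Rightarrow> mpoly \<Rightarrow> hpoly" where
  "poly_subst \<xi> = pm_sum (\<lambda>m c. Poly_Mapping.single 0 c * mono_subst \<xi> m)"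

lemma mono_subst_0 [simp]: "mono_subst \<xi> 0 = 1"
  by (simp add: mono_subst_def)

lemma mono_subst_superset:
  "finite A \<Longrightarrow> Poly_Mapping.keys m \<subseteq> A \<Longrightarrow> mono_subst \<xi> m = (\<Prod>F\<in>A. \<xi> F ^ Poly_Mapping.lookup m F)"
  unfolding mono_subst_def by (intro prod.mono_neutral_left) (auto simp: in_keys_iff)

lemma mono_subst_add: "mono_subst \<xi> (m + m') = mono_subst \<xi> m * mono_subst \<xi> m'"
proof -
  let ?A = "Poly_Mapping.keys m \<union> Poly_Mapping.keys m'"
  have "mono_subst \<xi> k = (\<Prod>F\<in>?A. \<xi> F ^ Poly_Mapping.lookup k F)" if "Poly_Mapping.keys k \<subseteq> ?A" for k
    using that by (intro mono_subst_superset) auto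
  then show ?thesis using Poly_Mapping.keys_add[of m m']
    by (simp add: lookup_add power_add prod.distrib)
qed

lemma poly_subst_add: "poly_subst \<xi> (p + q) = poly_subst \<xi> p + poly_subst \<xi> q"
  unfolding poly_subst_def by (rule pm_sum_add) (simp_all add: single_add distrib_right)

lemma poly_subst_single: "poly_subst \<xi> (Poly_Mapping.single m c) = Poly_Mapping.single 0 c * mono_subst \<xi> m"
  unfolding poly_subst_def by (simp add: pm_sum_single)

lemma poly_subst_0 [simp]: "poly_subst \<xi> 0 = 0"
  using poly_subst_single[of \<xi> 0 0] by simp

lemma poly_subst_mult: "poly_subst \<xi> (p * q) = poly_subst \<xi> p * poly_subst \<xi> q"
proof (induction p rule: poly_mapping_additive_induct)
  case (single m c)
  show ?case
  proof (induction q rule: poly_mapping_additive_induct)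
    case (single m' c')
    have const: "Poly_Mapping.single 0 (c * c') = (Poly_Mapping.single 0 c * Poly_Mapping.single 0 c' :: hpoly)"
      by (simp add: mult_single)
    have "poly_subst \<xi> (Poly_Mapping.single m c * Poly_Mapping.single m' c') =
        poly_subst \<xi> (Poly_Mapping.single (m + m') (c * c'))" by (simp only: mult_single)
    also have "\<dots> = Poly_Mapping.single 0 (c * c') * (mono_subst \<xi> m * mono_subst \<xi> m')"
      by (simp only: poly_subst_single mono_subst_add)
    also have "\<dots> = poly_subst \<xi> (Poly_Mapping.single m c) * poly_subst \<xi> (Poly_Mapping.single m' c')"
      unfolding const by (simp only: poly_subst_single ac_simps)
    finally show ?case .
  qed (simp_all add: poly_subst_add distrib_left)
qed (simp_all add: poly_subst_add distrib_right)

lemma poly_subst_const: "poly_subst \<xi> (mpoly_const c) = Poly_Mapping.single 0 c"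
  by (simp add: mpoly_const_def poly_subst_single)

lemma poly_subst_1 [simp]: "poly_subst \<xi> 1 = 1"
  using poly_subst_const[of \<xi> 1] by (simp add: mpoly_const_def)

lemma poly_subst_var: "poly_subst \<xi> (mpoly_var F) = \<xi> F"
  by (simp add: mpoly_var_def poly_subst_single mono_subst_def)

lemma poly_subst_diff: "poly_subst \<xi> (p - q) = poly_subst \<xi> p - poly_subst \<xi> q"
  using poly_subst_add[of \<xi> "p - q" q] by (simp add: algebra_simps)

lemma poly_subst_sum: "poly_subst \<xi> (sum f A) = (\<Sum>x\<in>A. poly_subst \<xi> (f x))"
  by (induction A rule: infinite_finite_induct) (simp_all add: poly_subst_add)

definition mono_mset :: "nat set multiset \<Rightarrow> mpoly" where
  "mono_mset X = (\<Prod>F\<in>#X. mpoly_var F)"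

lemma total_degree_superset:
  "finite A \<Longrightarrow> Poly_Mapping.keys m \<subseteq> A \<Longrightarrow> total_degree m = (\<Sum>F\<in>A. Poly_Mapping.lookup m F)"
  unfolding total_degree_def by (intro sum.mono_neutral_left) (auto simp: in_keys_iff)

lemma total_degree_add: "total_degree (m + m') = total_degree m + total_degree m'"
proof -
  let ?A = "Poly_Mapping.keys m \<union> Poly_Mapping.keys m'"
  have "total_degree k = (\<Sum>F\<in>?A. Poly_Mapping.lookup k F)" if "Poly_Mapping.keys k \<subseteq> ?A" for k
    using that by (intro total_degree_superset) auto
  then show ?thesis using Poly_Mapping.keys_add[of m m']
    by (simp add: lookup_add sum.distrib)
qed

lemma monomial_eq_mono_mset:
  fixes m :: monomial
  obtains X where "Poly_Mapping.single m 1 = mono_mset X" "set_mset X \<subseteq> Poly_Mapping.keys m" "size X = total_degree m"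
proof -
  have "\<exists>X. Poly_Mapping.single m 1 = mono_mset X \<and> set_mset X \<subseteq> Poly_Mapping.keys m \<and> size X = total_degree m"
  proof (induction "total_degree m" arbitrary: m)
    case 0
    then have "\<forall>F. Poly_Mapping.lookup m F = 0"
      by (auto simp: total_degree_def in_keys_iff)
    then have "m = 0" by (simp add: poly_mapping_eq_iff fun_eq_iff)
    then show ?case by (intro exI[of _ "{#}"]) (simp add: mono_mset_def total_degree_def)
  next
    case (Suc n)
    have "Poly_Mapping.keys m \<noteq> {}"
      using Suc(2) by (metis nat.distinct(1) sum.empty total_degree_def)
    then obtain F where F: "F \<in> Poly_Mapping.keys m" by blast
    define m' where "m' = m - Poly_Mapping.single F 1"
    have m: "m = Poly_Mapping.single F 1 + m'"
      using F by (intro poly_mapping_eqI) (auto simp: m'_def lookup_add lookup_minus lookup_single in_keys_iff when_def)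
    have "total_degree (Poly_Mapping.single F 1) = 1" by (simp add: total_degree_def)
    then have "n = total_degree m'" using Suc(2) m total_degree_add by (metis Suc_inject plus_1_eq_Suc)
    from Suc(1)[OF this] obtain X where X: "Poly_Mapping.single m' 1 = mono_mset X"
      "set_mset X \<subseteq> Poly_Mapping.keys m'" "size X = total_degree m'" by blast
    have "Poly_Mapping.single m 1 = mpoly_var F * Poly_Mapping.single m' 1"
      by (subst m) (simp add: mpoly_var_def mult_single)
    then have "Poly_Mapping.single m 1 = mono_mset (add_mset F X)" using X by (simp add: mono_mset_def)
    moreover have "Poly_Mapping.keys m' \<subseteq> Poly_Mapping.keys m"
      by (auto simp: m'_def in_keys_iff lookup_minus)
    ultimately show ?case using X F Suc(2) \<open>n = total_degree m'\<close>
      by (intro exI[of _ "add_mset F X"]) auto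
  qed
  then show thesis using that by blast
qed

section \<open>Functionals on the Chow ring\<close>

lemma finite_chain_Inter_mem:
  "finite C \<Longrightarrow> C \<noteq> {} \<Longrightarrow> chain\<^sub>\<subseteq> C \<Longrightarrow> \<Inter>C \<in> C"
proof (induction rule: finite_ne_induct)
  case (insert F C)
  then have "\<Inter>C \<in> C" by (auto simp: chain_subset_def)
  then have "F \<subseteq> \<Inter>C \<or> \<Inter>C \<subseteq> F" using insert.prems by (auto simp: chain_subset_def)
  then have "\<Inter>(insert F C) = \<Inter>C \<or> \<Inter>(insert F C) = F" by auto
  with \<open>\<Inter>C \<in> C\<close> show ?case by (metis insertCI)
qed auto

section \<open>Levels of a chain of flats and the Hall--Rado conditions\<close>

locale flat_chain = loopless_matroid +
  fixes C :: "nat set set"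
  assumes chain: "chain\<^sub>\<subseteq> C" and C_flats: "C \<subseteq> flats M - {{}}"
begin

text \<open>The level of H: the smallest member of the chain, completed by E, that contains H. It
  selects the minor in which the class of H is tested.\<close>

definition top :: "nat set \<Rightarrow> nat set" where
  "top H = \<Inter>{K\<in>insert E C. H \<subseteq> K}"

text \<open>The predecessor of F in the chain, with {} at the bottom; it is what is contracted on
  the level of F.\<close>

definition base :: "nat set \<Rightarrow> nat set" where
  "base F = \<Union>{K\<in>C. K \<subset> F}"

lemma C_subset: "K \<in> insert E C \<Longrightarrow> K \<subseteq> E"
  using C_flats flat_subset by auto

lemma C_flat: "K \<in> insert E C \<Longrightarrow> K \<in> flats M"
  using C_flats by auto

lemma finite_C: "finite C"
  using C_flats finite_flats finite_subset by (metis finite_Diff)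

lemma chain_E: "K \<in> insert E C \<Longrightarrow> L \<in> insert E C \<Longrightarrow> K \<subseteq> L \<or> L \<subseteq> K"
  using chain C_subset by (auto simp: chain_subset_def)

lemma top_superset: "H \<subseteq> top H"
  by (auto simp: top_def)

lemma top_least: "K \<in> insert E C \<Longrightarrow> H \<subseteq> K \<Longrightarrow> top H \<subseteq> K"
  by (auto simp: top_def)

lemma top_mem:
  assumes "H \<subseteq> E"
  shows "top H \<in> insert E C"
proof -
  have "top H \<in> {K\<in>insert E C. H \<subseteq> K}"
    unfolding top_def using assms finite_C chain_E
    by (intro finite_chain_Inter_mem) (auto simp: chain_subset_def)
  then show ?thesis by blast
qed

lemma top_of_mem: "K \<in> insert E C \<Longrightarrow> top K = K"
  using top_least[of K K] top_superset[of K] by blast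

lemma base_subset: "base F \<subseteq> F"
  by (auto simp: base_def)

lemma subset_base: "K \<in> C \<Longrightarrow> K \<subset> F \<Longrightarrow> K \<subseteq> base F"
  by (auto simp: base_def)

lemma base_mem: "base F \<in> insert {} C"
proof (cases "{K\<in>C. K \<subset> F} = {}")
  case True
  then have "base F = {}" unfolding base_def by (simp only: Union_empty)
  then show ?thesis by simp
next
  case False
  then have "base F \<in> {K\<in>C. K \<subset> F}"
    unfolding base_def using finite_C chain
    by (intro finite_chain_Union_mem) (auto simp: chain_subset_def)
  then show ?thesis by blast
qed

text \<open>For \<open>C = {F\<^sub>1 \<subset> \<dots> \<subset> F\<^sub>k}\<close> these are the dragon Hall--Rado conditions of Backman, Eur and Simpson
  for the minors \<open>M|F\<^sub>i/F\<^sub>i\<^sub>-\<^sub>1\<close>, in inhomogeneous form.\<close>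

definition good :: "nat set multiset \<Rightarrow> bool" where
  "good m \<longleftrightarrow> (\<forall>F\<in>insert E C. \<forall>J. J \<subseteq># m \<longrightarrow> J \<noteq> {#} \<longrightarrow> (\<forall>H\<in>#J. top H = F) \<longrightarrow>
     size J + 1 + rk (base F) \<le> rk (base F \<union> \<Union>(set_mset J)))"

text \<open>The Hall--Rado conditions for the subfamilies of level K that contain n - 1 additional
  classes with union X. Unlike in \<open>good\<close>, J may be empty.\<close>

definition excess :: "nat set multiset \<Rightarrow> nat set \<Rightarrow> nat \<Rightarrow> nat set \<Rightarrow> bool" where
  "excess m K n X \<longleftrightarrow> (\<forall>J. J \<subseteq># m \<longrightarrow> (\<forall>H\<in>#J. top H = K) \<longrightarrow>
     size J + n + rk (base K) \<le> rk (base K \<union> X \<union> \<Union>(set_mset J)))"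

text \<open>A subfamily either omits G or contains it; in the second case one copy of G moves from
  the family into X and raises the count by one.\<close>

lemma excess_add_mset:
  assumes "top G = K"
  shows "excess (add_mset G m) K n X \<longleftrightarrow> excess m K n X \<and> excess m K (Suc n) (X \<union> G)"
proof
  assume L: "excess (add_mset G m) K n X"
  have "excess m K n X" using L unfolding excess_def
    by (meson subset_mset.order_trans subset_mset.le_add_same_cancel2 mset_subset_eq_add_mset_cancel
        mset_subset_eq_insertD multi_psub_of_add_self subset_mset.less_imp_le)
  moreover have "excess m K (Suc n) (X \<union> G)"
    unfolding excess_def
  proof (intro allI impI)
    fix J assume J: "J \<subseteq># m" "\<forall>H\<in>#J. top H = K"
    then have "add_mset G J \<subseteq># add_mset G m" "\<forall>H\<in>#add_mset G J. top H = K" using assms by auto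
    then have "size (add_mset G J) + n + rk (base K) \<le> rk (base K \<union> X \<union> \<Union>(set_mset (add_mset G J)))"
      using L unfolding excess_def by blast
    then show "size J + Suc n + rk (base K) \<le> rk (base K \<union> (X \<union> G) \<union> \<Union>(set_mset J))"
      by (simp add: Un_assoc)
  qed
  ultimately show "excess m K n X \<and> excess m K (Suc n) (X \<union> G)" ..
next
  assume R: "excess m K n X \<and> excess m K (Suc n) (X \<union> G)"
  show "excess (add_mset G m) K n X"
    unfolding excess_def
  proof (intro allI impI)
    fix J assume J: "J \<subseteq># add_mset G m" "\<forall>H\<in>#J. top H = K"
    show "size J + n + rk (base K) \<le> rk (base K \<union> X \<union> \<Union>(set_mset J))"
    proof (cases "G \<in># J")
      case True
      then obtain J' where J': "J = add_mset G J'" by (metis insert_DiffM)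
      with J have "J' \<subseteq># m" "\<forall>H\<in>#J'. top H = K" by auto
      then have "size J' + Suc n + rk (base K) \<le> rk (base K \<union> (X \<union> G) \<union> \<Union>(set_mset J'))"
        using R unfolding excess_def by blast
      then show ?thesis by (simp add: J' Un_assoc)
    next
      case False
      then have "J \<subseteq># m" using J(1) by (metis diff_single_trivial subset_eq_diff_conv add_mset_add_single)
      then show ?thesis using R J(2) unfolding excess_def by blast
    qed
  qed
qed

lemma good_add_mset:
  assumes "H \<subseteq> E"
  shows "good (add_mset H m) \<longleftrightarrow> good m \<and> excess m (top H) 2 H"
proof
  assume L: "good (add_mset H m)"
  have "good m" unfolding good_def
  proof (intro ballI allI impI)
    fix F J assume F: "F \<in> insert E C" and J: "J \<subseteq># m" "J \<noteq> {#}" "\<forall>H\<in>#J. top H = F"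
    have "J \<subseteq># add_mset H m" using J(1) by (simp add: subset_mset.trans[OF J(1)])
    then show "size J + 1 + rk (base F) \<le> rk (base F \<union> \<Union> (set_mset J))"
      using L F J(2,3) unfolding good_def by blast
  qed
  moreover have "excess m (top H) 2 H"
    unfolding excess_def
  proof (intro allI impI)
    fix J assume J: "J \<subseteq># m" "\<forall>K\<in>#J. top K = top H"
    then have "add_mset H J \<subseteq># add_mset H m" "add_mset H J \<noteq> {#}" "\<forall>K\<in>#add_mset H J. top K = top H" by auto
    then have "size (add_mset H J) + 1 + rk (base (top H)) \<le> rk (base (top H) \<union> \<Union>(set_mset (add_mset H J)))"
      using L top_mem[OF assms] unfolding good_def by blast
    then show "size J + 2 + rk (base (top H)) \<le> rk (base (top H) \<union> H \<union> \<Union>(set_mset J))"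
      by (simp add: Un_assoc)
  qed
  ultimately show "good m \<and> excess m (top H) 2 H" ..
next
  assume R: "good m \<and> excess m (top H) 2 H"
  show "good (add_mset H m)"
    unfolding good_def
  proof (intro ballI allI impI)
    fix F J assume F: "F \<in> insert E C" and J: "J \<subseteq># add_mset H m" "J \<noteq> {#}" "\<forall>K\<in>#J. top K = F"
    show "size J + 1 + rk (base F) \<le> rk (base F \<union> \<Union>(set_mset J))"
    proof (cases "H \<in># J")
      case True
      then obtain J' where J': "J = add_mset H J'" by (metis insert_DiffM)
      then have "F = top H" using J(3) by simp
      have "J' \<subseteq># m" "\<forall>K\<in>#J'. top K = top H" using J J' \<open>F = top H\<close> by auto
      then have "size J' + 2 + rk (base F) \<le> rk (base F \<union> H \<union> \<Union>(set_mset J'))"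
        using R unfolding excess_def \<open>F = top H\<close> by blast
      then show ?thesis by (simp add: J' Un_assoc)
    next
      case False
      then have "J \<subseteq># m" using J(1) by (metis diff_single_trivial subset_eq_diff_conv add_mset_add_single)
      then show ?thesis using R J(2,3) F unfolding good_def by blast
    qed
  qed
qed

text \<open>The family consisting of H alone would have to raise the rank of the base by
  two.\<close>

lemma not_good_atom:
  assumes "H \<subseteq> E" "rk H \<le> 1"
  shows "\<not> good (add_mset H m)"
proof
  assume "good (add_mset H m)"
  then have "excess m (top H) 2 H" using good_add_mset[OF assms(1)] by blast
  then have "size {#} + 2 + rk (base (top H)) \<le> rk (base (top H) \<union> H \<union> \<Union>(set_mset {#}))"
    unfolding excess_def by (elim allE[of _ "{#}"]) simp
  then show False using rk_submodular[of "base (top H)" H] assms(2) by simp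
qed

lemma excess_cong:
  assumes "\<And>Z. rk (base K \<union> X \<union> Z) = rk (base K \<union> Y \<union> Z)"
  shows "excess m K n X \<longleftrightarrow> excess m K n Y"
  unfolding excess_def assms ..

lemma excess_mono: "excess m K n X \<Longrightarrow> n' \<le> n \<Longrightarrow> X \<subseteq> Y \<Longrightarrow> excess m K n' Y"
  unfolding excess_def
proof (intro allI impI)
  fix J assume *: "\<forall>J. J \<subseteq># m \<longrightarrow> (\<forall>H\<in>#J. top H = K) \<longrightarrow>
      size J + n + rk (base K) \<le> rk (base K \<union> X \<union> \<Union>(set_mset J))" "n' \<le> n" "X \<subseteq> Y" "J \<subseteq># m" "\<forall>H\<in>#J. top H = K"
  have "size J + n + rk (base K) \<le> rk (base K \<union> X \<union> \<Union>(set_mset J))" using * by blast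
  also have "\<dots> \<le> rk (base K \<union> Y \<union> \<Union>(set_mset J))" using * by (intro rk_mono) auto
  finally show "size J + n' + rk (base K) \<le> rk (base K \<union> Y \<union> \<Union>(set_mset J))" using * by simp
qed

text \<open>Uncrossing: let J violate the condition for F and J' the one for G. Submodularity of the
  two spans contradicts the lower bounds for J \<union># J', from the assumption on F \<union> G,
  and for J \<inter># J', from \<open>good m\<close>. The latter bound gives up its extra 1, since J
  \<inter># J' may be empty.\<close>

lemma excess_either:
  assumes good: "good m" and K: "K \<in> insert E C" and 3: "excess m K 3 (F \<union> G)"
  shows "excess m K 2 F \<or> excess m K 2 G"
proof (rule ccontr)
  let ?b = "base K"
  assume "\<not> ?thesis"
  then obtain J J' where J: "J \<subseteq># m" "\<forall>H\<in>#J. top H = K" "rk (?b \<union> F \<union> \<Union>(set_mset J)) < size J + 2 + rk ?b"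
    and J': "J' \<subseteq># m" "\<forall>H\<in>#J'. top H = K" "rk (?b \<union> G \<union> \<Union>(set_mset J')) < size J' + 2 + rk ?b"
    unfolding excess_def not_all de_Morgan_disj not_imp not_le by blast
  have size: "size (J \<union># J') + size (J \<inter># J') = size J + size J'"
  proof -
    have "J \<union># J' + J \<inter># J' = J + J'" by (rule multiset_eqI) auto
    then show ?thesis by (metis size_union)
  qed
  have "J \<union># J' \<subseteq># m" "\<forall>H\<in>#(J \<union># J'). top H = K" using J J' by auto
  then have sup: "size (J \<union># J') + 3 + rk ?b \<le> rk (?b \<union> (F \<union> G) \<union> \<Union>(set_mset (J \<union># J')))"
    using 3 unfolding excess_def by blast
  have inter: "size (J \<inter># J') + rk ?b \<le> rk (?b \<union> \<Union>(set_mset (J \<inter># J')))"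
  proof (cases "J \<inter># J' = {#}")
    case False
    have "J \<inter># J' \<subseteq># m" using J(1) by (simp add: subset_mset.le_infI1)
    moreover have "\<forall>H\<in>#J \<inter># J'. top H = K" using J(2) by auto
    ultimately have "size (J \<inter># J') + 1 + rk ?b \<le> rk (?b \<union> \<Union>(set_mset (J \<inter># J')))"
      using good K False unfolding good_def by blast
    then show ?thesis by simp
  qed simp
  define X where "X = ?b \<union> F \<union> \<Union>(set_mset J)"
  define Y where "Y = ?b \<union> G \<union> \<Union>(set_mset J')"
  have "?b \<union> (F \<union> G) \<union> \<Union>(set_mset (J \<union># J')) = X \<union> Y" by (auto simp: X_def Y_def)
  moreover have "rk (?b \<union> \<Union>(set_mset (J \<inter># J'))) \<le> rk (X \<inter> Y)"
    by (intro rk_mono) (auto simp: X_def Y_def)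
  moreover have "rk (X \<union> Y) + rk (X \<inter> Y) \<le> rk X + rk Y" by (rule rk_submodular)
  ultimately show False using sup inter size J(3) J'(3) by (simp add: X_def Y_def)
qed

text \<open>The relation h_F h_G + h_U^2 = h_F h_U + h_G h_U, read through the 0/1 values. On a
  common level, the separate conditions p and q of F and G satisfy p q + 1 = p + q as soon as one of
  them holds. On different levels, the lower flat lies in the base of the higher level, so there U
  and the other flat are interchangeable and the terms cancel in pairs.\<close>

lemma good_quadric:
  assumes F: "F \<in> flats M" and G: "G \<in> flats M" and U: "U = cl (F \<union> G)"
  shows "of_bool (good (add_mset F (add_mset G m))) + of_bool (good (add_mset U (add_mset U m))) =
    (of_bool (good (add_mset F (add_mset U m))) + of_bool (good (add_mset G (add_mset U m))) :: rat)"
proof -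
  have sub: "F \<subseteq> E" "G \<subseteq> E" "U \<subseteq> E" "F \<subseteq> U" "G \<subseteq> U"
    using F G flat_subset cl_subset cl_superset[of "F \<union> G"] by (auto simp: U)
  have least: "U \<subseteq> K \<longleftrightarrow> F \<subseteq> K \<and> G \<subseteq> K" if "K \<in> insert E C" for K
    using cl_least[OF _ C_flat[OF that], of "F \<union> G"] sub by (simp add: U)
  have strict: ?thesis if F': "F' \<in> flats M" and G': "G' \<in> flats M" and FG: "F' = F \<and> G' = G \<or> F' = G \<and> G' = F" and less: "top F' \<subset> top G'" for F' G'
  proof -
    have sub': "F' \<subseteq> E" "G' \<subseteq> E" using F' G' flat_subset by blast+
    have "top F' \<noteq> E" using less C_subset[OF top_mem[OF sub'(2)]] by blast
    then have "top F' \<in> C" using top_mem[OF sub'(1)] by blast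
    then have Fb: "F' \<subseteq> base (top G')" using subset_base[OF _ less] top_superset[of F'] by blast
    have "F' \<subseteq> top G'" "G' \<subseteq> top G'" using top_superset[of F'] top_superset[of G'] less by blast+
    then have "U \<subseteq> top G'" unfolding least[OF top_mem[OF sub'(2)]] using FG by (elim disjE) simp_all
    then have "top U \<subseteq> top G'" by (rule top_least[OF top_mem[OF sub'(2)]])
    moreover have "G' \<subseteq> U" using sub(4,5) FG by (elim disjE) simp_all
    then have "G' \<subseteq> top U" using top_superset[of U] by blast
    then have "top G' \<subseteq> top U" by (rule top_least[OF top_mem[OF sub(3)]])
    ultimately have top: "top U = top G'" by blast
    have "rk (base (top G') \<union> U \<union> Z) = rk (base (top G') \<union> G' \<union> Z)" for Z
    proof -
      have "rk (U \<union> (base (top G') \<union> Z)) = rk (F \<union> G \<union> (base (top G') \<union> Z))"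
        unfolding U using sub by (intro rk_cl_Un) auto
      moreover have "F \<union> G \<union> (base (top G') \<union> Z) = base (top G') \<union> G' \<union> Z"
        using Fb FG by (elim disjE) auto
      moreover have "base (top G') \<union> U \<union> Z = U \<union> (base (top G') \<union> Z)" by blast
      ultimately show ?thesis by simp
    qed
    then have "good (add_mset U k) \<longleftrightarrow> good (add_mset G' k)" for k
      unfolding good_add_mset[OF sub(3)] good_add_mset[OF sub'(2)] top
      using excess_cong[of "top G'" U G'] by metis
    then have eq: "good (add_mset U (add_mset F' m)) \<longleftrightarrow> good (add_mset G' (add_mset F' m))"
      "good (add_mset U (add_mset U m)) \<longleftrightarrow> good (add_mset G' (add_mset U m))" by blast+
    from FG show ?thesis
    proof (elim disjE conjE)
      assume FG': "F' = F" "G' = G"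
      have "good (add_mset F (add_mset G m)) \<longleftrightarrow> good (add_mset F (add_mset U m))"
        using eq(1) by (simp only: FG' add_mset_commute[of F G m] add_mset_commute[of F U m])
      then show ?thesis by (simp only: eq(2) FG')
    next
      assume FG': "F' = G" "G' = F"
      have "good (add_mset G (add_mset U m)) \<longleftrightarrow> good (add_mset F (add_mset G m))"
        using eq(1) by (simp only: FG' add_mset_commute[of G U m])
      then show ?thesis by (simp only: eq(2) FG' add.commute)
    qed
  qed
  consider "top F = top G" | "top F \<subset> top G" | "top G \<subset> top F"
    using chain_E[OF top_mem[OF sub(1)] top_mem[OF sub(2)]] by blast
  then show ?thesis
  proof cases
    case 1
    define K where "K = top G"
    have K: "K \<in> insert E C" "top F = K" "top G = K" using 1 top_mem[OF sub(2)] by (simp_all add: K_def)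
    have "U \<subseteq> K" using least[OF K(1)] top_superset K by metis
    then have "top U \<subseteq> K" by (rule top_least[OF K(1)])
    moreover have "F \<subseteq> top U" using top_superset[of U] sub by blast
    then have "top F \<subseteq> top U" by (rule top_least[OF top_mem[OF sub(3)]])
    ultimately have top: "top U = K" using K by blast
    have rkU: "rk (base K \<union> U \<union> Z) = rk (base K \<union> (F \<union> G) \<union> Z)" for Z
    proof -
      have "rk (U \<union> (base K \<union> Z)) = rk (F \<union> G \<union> (base K \<union> Z))"
        unfolding U using sub by (intro rk_cl_Un) auto
      then show ?thesis by (simp add: Un_ac)
    qed
    have U3: "excess m K n U \<longleftrightarrow> excess m K n (F \<union> G)" for n by (rule excess_cong[OF rkU])
    have two: "good (add_mset H (add_mset H' m)) \<longleftrightarrow> good m \<and> excess m K 2 H' \<and> excess m K 2 H \<and> excess m K 3 (H \<union> H')"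
      if "H \<subseteq> E" "H' \<subseteq> E" "top H = K" "top H' = K" for H H'
      unfolding good_add_mset[OF that(1)] good_add_mset[OF that(2)] that(3,4) excess_add_mset[OF that(4)]
      by (simp add: numeral_3_eq_3 numeral_2_eq_2)
    have U2: "excess m K 3 (F \<union> G) \<Longrightarrow> excess m K 2 U" unfolding U3 by (rule excess_mono) auto
    have un: "F \<union> U = U" "G \<union> U = U" "U \<union> U = U" using sub by auto
    have "good (add_mset F (add_mset G m)) \<longleftrightarrow> good m \<and> excess m K 2 G \<and> excess m K 2 F \<and> excess m K 3 (F \<union> G)"
      by (rule two[OF sub(1,2) K(2,3)])
    moreover have "good (add_mset U (add_mset U m)) \<longleftrightarrow> good m \<and> excess m K 3 (F \<union> G)"
      using two[OF sub(3,3) top top] U2 unfolding un U3[of 3] by blast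
    moreover have "good (add_mset F (add_mset U m)) \<longleftrightarrow> good m \<and> excess m K 2 F \<and> excess m K 3 (F \<union> G)"
      using two[OF sub(1,3) K(2) top] U2 unfolding un U3[of 3] by blast
    moreover have "good (add_mset G (add_mset U m)) \<longleftrightarrow> good m \<and> excess m K 2 G \<and> excess m K 3 (F \<union> G)"
      using two[OF sub(2,3) K(3) top] U2 unfolding un U3[of 3] by blast
    moreover have "of_bool (g \<and> p \<and> q \<and> r) + of_bool (g \<and> r) = (of_bool (g \<and> q \<and> r) + of_bool (g \<and> p \<and> r) :: rat)"
      if "g \<Longrightarrow> r \<Longrightarrow> q \<or> p" for g p q r using that by auto
    ultimately show ?thesis using excess_either[OF _ K(1), of m F G] by presburger
  next
    case 2
    show ?thesis by (rule strict[OF F G _ 2]) simp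
  next
    case 3
    show ?thesis by (rule strict[OF G F _ 3]) auto
  qed
qed

end

section \<open>The functional on polynomials and its vanishing on the Chow ideal\<close>

definition hvar :: "nat set \<Rightarrow> hpoly" where
  "hvar F = Poly_Mapping.single {#F#} 1"

lemma hvar_times_single: "hvar F * Poly_Mapping.single m c = Poly_Mapping.single (add_mset F m) c"
  by (simp add: hvar_def mult_single)

text \<open>The system is triangular: a minimal F occurs in no equation but its own, so the system
  for V - {F} is solved and the value at F adjusted afterwards.\<close>

lemma moebius_exists:
  fixes g :: "'a set \<Rightarrow> 'b::ab_group_add"
  assumes "finite V"
  shows "\<exists>\<xi>. \<forall>F\<in>V. (\<Sum>G\<in>{G\<in>V. F \<subseteq> G}. \<xi> G) = g F"
  using assms
proof (induction V rule: finite_psubset_induct)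
  case (psubset V)
  show ?case
  proof (cases "V = {}")
    case False
    then obtain F where F: "F \<in> V" "\<And>G. G \<in> V \<Longrightarrow> G \<subseteq> F \<Longrightarrow> F = G"
      using finite_has_minimal[OF psubset.hyps] by blast
    then have "V - {F} \<subset> V" by blast
    from psubset.IH[OF this] obtain \<xi> where \<xi>: "\<forall>H\<in>V - {F}. (\<Sum>G\<in>{G\<in>V - {F}. H \<subseteq> G}. \<xi> G) = g H" by blast
    define \<xi>' where "\<xi>' = \<xi>(F := g F - (\<Sum>G\<in>{G\<in>V - {F}. F \<subseteq> G}. \<xi> G))"
    have same: "(\<Sum>G\<in>{G\<in>V - {F}. H \<subseteq> G}. \<xi>' G) = (\<Sum>G\<in>{G\<in>V - {F}. H \<subseteq> G}. \<xi> G)" for H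
      by (intro sum.cong) (auto simp: \<xi>'_def)
    have "(\<Sum>G\<in>{G\<in>V. H \<subseteq> G}. \<xi>' G) = g H" if H: "H \<in> V" for H
    proof (cases "H = F")
      case True
      have "{G\<in>V. F \<subseteq> G} = insert F {G\<in>V - {F}. F \<subseteq> G}" using F by blast
      then have "(\<Sum>G\<in>{G\<in>V. F \<subseteq> G}. \<xi>' G) = \<xi>' F + (\<Sum>G\<in>{G\<in>V - {F}. F \<subseteq> G}. \<xi>' G)"
        using psubset.hyps by simp
      then show ?thesis unfolding True same by (simp add: \<xi>'_def)
    next
      case False
      then have "{G\<in>V. H \<subseteq> G} = {G\<in>V - {F}. H \<subseteq> G}" using F(2)[OF H] by blast
      then show ?thesis using same[of H] \<xi> H False by simp
    qed
    then show ?thesis by blast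
  qed simp
qed

lemma mpoly_ring_minus: "p \<in> carrier (mpoly_ring V) \<Longrightarrow> \<ominus>\<^bsub>mpoly_ring V\<^esub> p = - p"
proof -
  assume p: "p \<in> carrier (mpoly_ring V)"
  interpret cring "mpoly_ring V" by (rule mpoly_ring_cring)
  show ?thesis using mpoly_ring_closed(3)[OF p p] p by (intro minus_equality) auto
qed

lemma mpoly_idealI:
  assumes "I \<subseteq> carrier (mpoly_ring V)" "0 \<in> I" "\<And>p q. p \<in> I \<Longrightarrow> q \<in> I \<Longrightarrow> p + q \<in> I"
    and "\<And>p q. p \<in> I \<Longrightarrow> q \<in> carrier (mpoly_ring V) \<Longrightarrow> q * p \<in> I"
  shows "ideal I (mpoly_ring V)"
proof -
  interpret R: cring "mpoly_ring V" by (rule mpoly_ring_cring)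
  have inv: "inv\<^bsub>add_monoid (mpoly_ring V)\<^esub> p = - p" if "p \<in> I" for p
    using mpoly_ring_minus[of p V] that assms(1) by (auto simp: a_inv_def)
  have neg: "- p \<in> I" if "p \<in> I" for p
  proof -
    have "- 1 \<in> carrier (mpoly_ring V)" using mpoly_ring_closed(3)[of 1 V 1] R.one_closed by simp
    from assms(4)[OF that this] show ?thesis by simp
  qed
  show ?thesis
  proof (rule idealI)
    show "subgroup I (add_monoid (mpoly_ring V))"
      by unfold_locales (use assms inv neg in auto)
  qed (use assms in \<open>auto simp: R.ring_axioms mult.commute\<close>)
qed

lemma chow_ideal_memE:
  assumes "p \<in> chow_ideal M"
  obtains q r where "p = q + r" "q \<in> chow_I M" "r \<in> chow_J M"
  using assms unfolding chow_ideal_def set_add_def' by auto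

context loopless_matroid
begin

abbreviation PF where "PF \<equiv> proper_flats M"

lemma finite_PF [simp]: "finite PF"
  by (simp add: proper_flats_def)

lemma PF_flat: "F \<in> PF \<Longrightarrow> F \<in> flats M"
  by (simp add: proper_flats_def)

lemma PF_nonempty: "F \<in> PF \<Longrightarrow> F \<noteq> {}"
  by (simp add: proper_flats_def)

text \<open>The variable x_G rewritten in the classes h_F. With x_E = - h_E, the sum of x_G over the
  proper flats containing F is h_E - h_F, and these equations determine x_G on the proper
  flats.\<close>

definition xi :: "nat set \<Rightarrow> hpoly" where
  "xi = (SOME \<xi>. \<forall>F\<in>PF. (\<Sum>G\<in>{G\<in>PF. F \<subseteq> G}. \<xi> G) = hvar E - hvar F)"

lemma sum_xi:
  assumes F: "F \<in> flats M" "F \<noteq> {}"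
  shows "(\<Sum>G\<in>{G\<in>PF. F \<subseteq> G}. xi G) = hvar E - hvar F"
proof (cases "F = E")
  case True
  have none: "{G\<in>PF. E \<subseteq> G} = {}" using PF_flat flat_subset by (auto simp: proper_flats_def)
  show ?thesis unfolding True none by simp
next
  case False
  then have "F \<in> PF" using F by (simp add: proper_flats_def)
  moreover have "\<forall>F\<in>PF. (\<Sum>G\<in>{G\<in>PF. F \<subseteq> G}. xi G) = hvar E - hvar F"
    unfolding xi_def by (rule someI_ex[OF moebius_exists[OF finite_PF]])
  ultimately show ?thesis by blast
qed

lemma cl_singleton_nonempty: "a \<in> E \<Longrightarrow> cl {a} \<in> flats M" "a \<in> E \<Longrightarrow> cl {a} \<noteq> {}"
  using cl_flat mem_cl_singleton by auto

lemma cl_singleton_subset_iff: "a \<in> E \<Longrightarrow> F \<in> flats M \<Longrightarrow> cl {a} \<subseteq> F \<longleftrightarrow> a \<in> F"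
  using cl_least[of "{a}" F] by simp

end

context flat_chain
begin

definition Lam :: "hpoly \<Rightarrow> rat" where
  "Lam = pm_sum (\<lambda>m c. c * of_bool (good m))"

lemma Lam_add: "Lam (p + q) = Lam p + Lam q"
  unfolding Lam_def by (rule pm_sum_add) (auto simp: algebra_simps)

lemma Lam_single: "Lam (Poly_Mapping.single m c) = c * of_bool (good m)"
  unfolding Lam_def by (simp add: pm_sum_single)

lemma Lam_0 [simp]: "Lam 0 = 0"
  using Lam_single[of 0 0] by simp

lemma Lam_diff: "Lam (p - q) = Lam p - Lam q"
  using Lam_add[of "p - q" q] by simp

lemma Lam_sum: "Lam (sum f A) = (\<Sum>x\<in>A. Lam (f x))"
  by (induction A rule: infinite_finite_induct) (simp_all add: Lam_add)

lemma Lam_atom: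
  assumes "H \<subseteq> E" "rk H \<le> 1"
  shows "Lam (hvar H * q) = 0"
proof (induction q rule: poly_mapping_additive_induct)
  case (single m c)
  show ?case using not_good_atom[OF assms] by (simp add: hvar_times_single Lam_single)
qed (simp_all add: distrib_left Lam_add)

lemma Lam_quadric:
  assumes "F \<in> flats M" "G \<in> flats M" and U: "U = cl (F \<union> G)"
  shows "Lam ((hvar U - hvar F) * (hvar U - hvar G) * q) = 0"
proof (induction q rule: poly_mapping_additive_induct)
  case (single m c)
  have "(hvar U - hvar F) * (hvar U - hvar G) * Poly_Mapping.single m c =
      hvar U * (hvar U * Poly_Mapping.single m c) - hvar F * (hvar U * Poly_Mapping.single m c)
      - (hvar G * (hvar U * Poly_Mapping.single m c) - hvar F * (hvar G * Poly_Mapping.single m c))"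
    by (simp add: algebra_simps)
  then have "Lam ((hvar U - hvar F) * (hvar U - hvar G) * Poly_Mapping.single m c) =
      c * (of_bool (good (add_mset F (add_mset G m))) + of_bool (good (add_mset U (add_mset U m))))
      - c * (of_bool (good (add_mset F (add_mset U m))) + of_bool (good (add_mset G (add_mset U m))))"
    by (simp only: hvar_times_single Lam_diff Lam_single) (simp only: algebra_simps)
  then show ?case unfolding good_quadric[OF assms] by simp
qed (simp_all add: distrib_left Lam_add)

text \<open>The product \<open>(h\<^sub>U - h\<^sub>F)(h\<^sub>U - h\<^sub>G)\<close> expands to \<open>x\<^sub>F x\<^sub>G\<close> plus products of larger incomparable pairs.\<close>

lemma Lam_incomparable:
  assumes "F \<in> PF" "G \<in> PF" "\<not> F \<subseteq> G" "\<not> G \<subseteq> F"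
  shows "Lam (xi F * xi G * q) = 0"
  using assms
proof (induction "card (E - F) + card (E - G)" arbitrary: F G rule: less_induct)
  case less
  have flats: "F \<in> flats M" "G \<in> flats M" using less.prems PF_flat by blast+
  have subE: "F \<union> G \<subseteq> E" using flats flat_subset by blast
  define U where "U = cl (F \<union> G)"
  have U: "U \<in> flats M" "U \<noteq> {}" "F \<subseteq> U"
    using cl_flat[OF subE] cl_superset[OF subE] PF_nonempty[OF less.prems(1)] by (auto simp: U_def)
  have U_iff: "U \<subseteq> H \<longleftrightarrow> F \<subseteq> H \<and> G \<subseteq> H" if "H \<in> PF" for H
    using cl_least[OF subE PF_flat[OF that]] by (simp add: U_def)
  define S where "S = {H\<in>PF. F \<subseteq> H \<and> \<not> G \<subseteq> H}"
  define T where "T = {H\<in>PF. G \<subseteq> H \<and> \<not> F \<subseteq> H}"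
  have fin: "finite S" "finite T" by (simp_all add: S_def T_def)
  have diff: "hvar U - hvar F' = (\<Sum>H\<in>{H\<in>PF. F' \<subseteq> H \<and> \<not> U \<subseteq> H}. xi H)"
    if F': "F' \<in> flats M" "F' \<noteq> {}" "F' \<subseteq> U" for F'
  proof -
    have "{H\<in>PF. F' \<subseteq> H} = {H\<in>PF. F' \<subseteq> H \<and> \<not> U \<subseteq> H} \<union> {H\<in>PF. U \<subseteq> H}" using F' by blast
    then have "(\<Sum>H\<in>{H\<in>PF. F' \<subseteq> H}. xi H) =
        (\<Sum>H\<in>{H\<in>PF. F' \<subseteq> H \<and> \<not> U \<subseteq> H}. xi H) + (\<Sum>H\<in>{H\<in>PF. U \<subseteq> H}. xi H)"
      by (simp only:) (intro sum.union_disjoint, auto)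
    then show ?thesis using sum_xi[OF F'(1,2)] sum_xi[OF U(1,2)] by (simp add: algebra_simps)
  qed
  have "{H\<in>PF. F \<subseteq> H \<and> \<not> U \<subseteq> H} = S" "{H\<in>PF. G \<subseteq> H \<and> \<not> U \<subseteq> H} = T"
    using U_iff by (auto simp: S_def T_def)
  moreover have "G \<subseteq> U" using cl_superset[OF subE] by (simp add: U_def)
  ultimately have ST: "hvar U - hvar F = (\<Sum>H\<in>S. xi H)" "hvar U - hvar G = (\<Sum>H\<in>T. xi H)"
    using diff[of F] diff[of G] flats U(3) PF_nonempty less.prems(1,2) by simp_all
  have FG: "F \<in> S" "G \<in> T" using less.prems by (auto simp: S_def T_def)
  have "0 = Lam ((\<Sum>H\<in>S. xi H) * (\<Sum>K\<in>T. xi K) * q)"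
    unfolding ST[symmetric] by (rule Lam_quadric[OF flats U_def, symmetric])
  also have "\<dots> = (\<Sum>H\<in>S. \<Sum>K\<in>T. Lam (xi H * xi K * q))"
    unfolding sum_product by (simp only: sum_distrib_right Lam_sum)
  also have "\<dots> = (\<Sum>p\<in>S \<times> T. Lam (xi (fst p) * xi (snd p) * q))"
    by (simp add: sum.cartesian_product case_prod_beta)
  also have "\<dots> = (\<Sum>p\<in>{(F, G)}. Lam (xi (fst p) * xi (snd p) * q))"
  proof (rule sum.mono_neutral_right)
    show "\<forall>p\<in>S \<times> T - {(F, G)}. Lam (xi (fst p) * xi (snd p) * q) = 0"
    proof
      fix p assume p: "p \<in> S \<times> T - {(F, G)}"
      obtain H K where HK: "p = (H, K)" by fastforce
      with p have H: "H \<in> PF" "F \<subseteq> H" "\<not> G \<subseteq> H" and K: "K \<in> PF" "G \<subseteq> K" "\<not> F \<subseteq> K" and ne: "H \<noteq> F \<or> K \<noteq> G"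
        by (auto simp: S_def T_def)
      have HE: "H \<subseteq> E" "K \<subseteq> E" using H K PF_flat flat_subset by blast+
      have "card (E - H) \<le> card (E - F)" "card (E - K) \<le> card (E - G)"
        using H K by (auto intro!: card_mono)
      moreover have "card (E - H) < card (E - F) \<or> card (E - K) < card (E - G)"
        using ne
      proof
        assume "H \<noteq> F"
        then have "E - H \<subset> E - F" using H(2) HE by auto
        then show ?thesis by (simp add: psubset_card_mono)
      next
        assume "K \<noteq> G"
        then have "E - K \<subset> E - G" using K(2) HE by auto
        then show ?thesis by (simp add: psubset_card_mono)
      qed
      ultimately have "card (E - H) + card (E - K) < card (E - F) + card (E - G)" by linarith
      moreover have "\<not> H \<subseteq> K" "\<not> K \<subseteq> H" using H K by auto
      ultimately show "Lam (xi (fst p) * xi (snd p) * q) = 0"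
        using less.hyps[of H K] H(1) K(1) by (simp add: HK)
    qed
  qed (use FG fin in auto)
  finally show ?case by simp
qed

text \<open>The arbitrary multiplier q makes the annihilated polynomials an ideal, so generators
  suffice. A linear generator becomes a difference of two classes of rank one, which no good family
  contains.\<close>

lemma Lam_chow_ideal:
  assumes "p \<in> chow_ideal M"
  shows "Lam (poly_subst xi p * q) = 0"
proof -
  interpret R: cring "flat_poly_ring M" by (rule mpoly_ring_cring)
  define K where "K = {p \<in> carrier (flat_poly_ring M). \<forall>q. Lam (poly_subst xi p * q) = 0}"
  have ideal: "ideal K (flat_poly_ring M)"
  proof (rule mpoly_idealI)
    fix p q assume pq: "p \<in> K" "q \<in> carrier (flat_poly_ring M)"
    have "Lam (poly_subst xi (q * p) * r) = 0" for r
    proof -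
      have "poly_subst xi (q * p) * r = poly_subst xi p * (poly_subst xi q * r)"
        by (simp add: poly_subst_mult ac_simps)
      then show ?thesis using pq by (simp add: K_def)
    qed
    then show "q * p \<in> K" using pq mpoly_ring_closed(2)[of q PF p] by (simp add: K_def)
  next
    show "0 \<in> K" using R.zero_closed by (simp add: K_def)
  qed (auto simp: K_def poly_subst_add distrib_right Lam_add mpoly_ring_closed)
  have "chow_I M \<subseteq> K"
    unfolding chow_I_def
  proof (rule R.genideal_minimal[OF ideal], rule subsetI)
    fix p assume p: "p \<in> {mpoly_var F * mpoly_var G | F G. F \<in> PF \<and> G \<in> PF \<and> \<not> F \<subseteq> G \<and> \<not> G \<subseteq> F}"
    then have "p \<in> carrier (flat_poly_ring M)" using chow_generators_in_carrier(1) by blast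
    with p show "p \<in> K" by (auto simp: K_def poly_subst_mult poly_subst_var intro!: Lam_incomparable)
  qed
  moreover have "chow_J M \<subseteq> K"
    unfolding chow_J_def
  proof (rule R.genideal_minimal[OF ideal], rule subsetI)
    fix p assume p: "p \<in> {(\<Sum>F\<in>{F\<in>PF. i \<in> F}. mpoly_var F) - (\<Sum>F\<in>{F\<in>PF. j \<in> F}. mpoly_var F) | i j.
      i \<in> E \<and> j \<in> E}"
    then have car: "p \<in> carrier (flat_poly_ring M)" using chow_generators_in_carrier(2) by blast
    obtain i j where ij: "i \<in> E" "j \<in> E" "p = (\<Sum>F\<in>{F\<in>PF. i \<in> F}. mpoly_var F) - (\<Sum>F\<in>{F\<in>PF. j \<in> F}. mpoly_var F)"
      using p by blast
    have "{F\<in>PF. a \<in> F} = {F\<in>PF. cl {a} \<subseteq> F}" if "a \<in> E" for a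
      using cl_singleton_subset_iff[OF that PF_flat] by blast
    then have sub: "poly_subst xi (\<Sum>F\<in>{F\<in>PF. a \<in> F}. mpoly_var F) = hvar E - hvar (cl {a})" if "a \<in> E" for a
      using sum_xi[OF cl_singleton_nonempty[OF that]] that by (simp add: poly_subst_sum poly_subst_var)
    have "Lam (poly_subst xi p * q) = 0" for q
    proof -
      have "poly_subst xi p * q = hvar (cl {j}) * q - hvar (cl {i}) * q"
        unfolding ij(3) poly_subst_diff sub[OF ij(1)] sub[OF ij(2)] by (simp add: algebra_simps)
      then show ?thesis using Lam_atom[OF cl_subset] rk_cl_singleton ij(1,2) by (simp add: Lam_diff)
    qed
    then show "p \<in> K" using car by (simp add: K_def)
  qed
  moreover obtain a b where "p = a + b" "a \<in> chow_I M" "b \<in> chow_J M" using assms by (rule chow_ideal_memE)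
  ultimately have "a \<in> K" "b \<in> K" by blast+
  then show ?thesis by (simp add: \<open>p = a + b\<close> K_def poly_subst_add distrib_right Lam_add)
qed

end

text \<open>The exponents \<open>a\<^sub>i\<close> of a monomial along a chain \<open>F\<^sub>1 \<subset> \<dots> \<subset> F\<^sub>k\<close> of flats satisfy
  \<open>a\<^sub>i < rk F\<^sub>i - rk F\<^sub>i\<^sub>-\<^sub>1\<close>; it is the same to compare with all smaller members of the chain.\<close>

definition nested :: "matroid \<Rightarrow> nat set multiset \<Rightarrow> bool" where
  "nested M S \<longleftrightarrow> set_mset S \<subseteq> flats M \<and> chain\<^sub>\<subseteq> (set_mset S) \<and>
     (\<forall>G\<in>#S. count S G < matroid_rank M G) \<and>
     (\<forall>F\<in>#S. \<forall>G\<in>#S. F \<subset> G \<longrightarrow> count S G + matroid_rank M F < matroid_rank M G)"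

section \<open>Dual monomials, triangularity and linear independence\<close>

context fin_matroid
begin

lemma nested_nonempty: "nested M S \<Longrightarrow> F \<in># S \<Longrightarrow> F \<in> flats M - {{}}"
  unfolding nested_def using rk_empty by (metis Diff_iff less_zeroE singletonD subsetD)

text \<open>The order behind both halves of the basis property: the pairing is triangular for it,
  and straightening increases it.\<close>

definition rank_sum :: "nat set multiset \<Rightarrow> nat" where
  "rank_sum S = (\<Sum>F\<in>#S. rk F)"

lemma rank_sum_add [simp]: "rank_sum (add_mset F S) = rk F + rank_sum S"
  by (simp add: rank_sum_def)

end

locale nested_flats = flat_chain M "set_mset S" for M S +
  assumes nested: "nested M S"

lemma (in loopless_matroid) nested_flatsI:
  assumes "nested M S"
  shows "nested_flats M S"
proof -
  have "set_mset S \<subseteq> flats M - {{}}" using nested_nonempty[OF assms] by blast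
  moreover have "chain\<^sub>\<subseteq> (set_mset S)" using assms by (simp add: nested_def)
  ultimately show ?thesis using assms by unfold_locales
qed

context nested_flats
begin

text \<open>The multiplicities fill every level up to the dragon Hall--Rado bound, so that \<open>dual\<close> detects \<open>S\<close> among
  the nested multisets whose \<open>rank_sum\<close> is at least that of \<open>S\<close>.\<close>

definition dual :: "nat set multiset" where
  "dual = (\<Sum>F\<in>insert E (set_mset S). replicate_mset (rk F - rk (base F) - 1 - count S F) F)"

lemma count_dual: "F \<in> insert E (set_mset S) \<Longrightarrow> count dual F = rk F - rk (base F) - 1 - count S F"
proof -
  assume F: "F \<in> insert E (set_mset S)"
  have "count dual F = (\<Sum>G\<in>insert E (set_mset S). if G = F then rk F - rk (base F) - 1 - count S F else 0)"
    unfolding dual_def count_sum by (rule sum.cong) auto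
  also have "\<dots> = rk F - rk (base F) - 1 - count S F" using F by (subst sum.delta) auto
  finally show ?thesis .
qed

lemma set_dual: "set_mset dual \<subseteq> insert E (set_mset S)"
  unfolding dual_def by (subst set_mset_sum) auto

lemma count_less:
  assumes "F \<in># S"
  shows "count S F + rk (base F) < rk F"
proof -
  have "base F = {} \<or> base F \<in># S \<and> base F \<subset> F"
  proof (cases "base F = F")
    case True
    then have "F \<subseteq> \<Union>{K\<in>set_mset S. K \<subset> F}" by (simp add: base_def)
    have "{K\<in>set_mset S. K \<subset> F} = {}"
    proof (rule ccontr)
      assume "{K\<in>set_mset S. K \<subset> F} \<noteq> {}"
      then have "\<Union>{K\<in>set_mset S. K \<subset> F} \<in> {K\<in>set_mset S. K \<subset> F}"
        using chain by (intro finite_chain_Union_mem) (auto simp: chain_subset_def)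
      then show False using \<open>F \<subseteq> \<Union>{K\<in>set_mset S. K \<subset> F}\<close> by blast
    qed
    then show ?thesis unfolding base_def by (simp only: Union_empty simp_thms)
  next
    case False
    then show ?thesis using base_mem[of F] base_subset[of F] by blast
  qed
  then show ?thesis
  proof (elim disjE conjE)
    assume "base F = {}"
    then show ?thesis using nested assms by (simp add: nested_def)
  next
    assume "base F \<in># S" "base F \<subset> F"
    then show ?thesis using nested assms unfolding nested_def by blast
  qed
qed

lemma good_dual: "good (S + dual)"
  unfolding good_def
proof (intro ballI allI impI)
  fix F J assume F: "F \<in> insert E (set_mset S)" and J: "J \<subseteq># S + dual" "J \<noteq> {#}" "\<forall>H\<in>#J. top H = F"
  have "set_mset J \<subseteq> {F}"
  proof
    fix H assume H: "H \<in># J"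
    then have "H \<in># S \<or> H \<in># dual" using mset_subset_eqD[OF J(1)] by auto
    then have "H \<in> insert E (set_mset S)" using set_dual by blast
    then have "top H = H" by (rule top_of_mem)
    then show "H \<in> {F}" using J(3) H by blast
  qed
  then have n: "J = replicate_mset (size J) F" by (rule set_mset_subset_singletonD)
  define n where "n = size J"
  with n have n: "J = replicate_mset n F" by simp
  then have "0 < n" using J(2) by (cases n) auto
  have "n \<le> count (S + dual) F" using mset_subset_eq_count[OF J(1), of F] by (simp add: n)
  also have "\<dots> = count S F + (rk F - rk (base F) - 1 - count S F)" using count_dual[OF F] by simp
  finally have le: "n \<le> count S F + (rk F - rk (base F) - 1 - count S F)" .
  have "n + 1 + rk (base F) \<le> rk F"
  \<comment> \<open>Subtraction is truncated. On members of S the strict bound on multiplicities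
    excludes truncation; for F = E outside S the positivity of n does.\<close>
  proof (cases "F \<in># S")
    case True
    then show ?thesis using count_less[OF True] le by linarith
  next
    case False
    then have "count S F = 0" by (simp add: not_in_iff)
    then show ?thesis using le \<open>0 < n\<close> by linarith
  qed
  moreover have "base F \<union> \<Union>(set_mset J) = F" using base_subset[of F] \<open>0 < n\<close> by (auto simp: n)
  ultimately show "size J + 1 + rk (base F) \<le> rk (base F \<union> \<Union>(set_mset J))" by (simp add: n)
qed

text \<open>On the level of F, \<open>dual\<close> contributes all copies of F for which S leaves
  room, and every class of the level lies inside F, whose rank bounds the total. So S' has at most
  \<open>count S F\<close> members on that level, and equality of sizes makes the counts
  agree.\<close>

lemma good_dual_imp_top:
  assumes S': "set_mset S' \<subseteq> flats M" "size S' = size S" and good: "good (S' + dual)"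
  shows "image_mset top S' = S"
proof -
  have "image_mset top S' \<subseteq># S"
  proof (rule mset_subset_eqI)
    fix F
    define J where "J = {#H \<in># S'. top H = F#}"
    have count: "count (image_mset top S') F = size J"
      unfolding J_def by (induction S') auto
    show "count (image_mset top S') F \<le> count S F"
    proof (cases "J = {#}")
      case False
      then obtain H where H: "H \<in># S'" "top H = F" by (auto simp: J_def)
      then have F: "F \<in> insert E (set_mset S)" using top_mem[of H] S' flat_subset by blast
      define d where "d = rk F - rk (base F) - 1 - count S F"
      have "J \<subseteq># S'" by (simp add: J_def)
      moreover have "replicate_mset d F \<subseteq># dual"
        using count_dual[OF F] unfolding d_def by (metis count_le_replicate_mset_subset_eq order_refl)
      ultimately have "J + replicate_mset d F \<subseteq># S' + dual" by (rule subset_mset.add_mono)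
      moreover have "\<forall>K\<in>#J + replicate_mset d F. top K = F" using top_of_mem[OF F] by (auto simp: J_def split: if_splits)
      moreover have "J + replicate_mset d F \<noteq> {#}" using False by simp
      ultimately have "size (J + replicate_mset d F) + 1 + rk (base F) \<le> rk (base F \<union> \<Union>(set_mset (J + replicate_mset d F)))"
        using good F unfolding good_def by blast
      also have "\<dots> \<le> rk F" using base_subset[of F] top_superset
        by (intro rk_mono) (auto simp: J_def split: if_splits)
      finally have "size J + d + 1 + rk (base F) \<le> rk F" by simp
      then show ?thesis unfolding count d_def by linarith
    qed (simp add: count)
  qed
  then show ?thesis using S'(2)
    by (metis size_image_mset mset_subset_size subset_mset.le_imp_less_or_eq nat_less_le)
qed

text \<open>Replacing each member of S' by its level turns S' into S. A flat has strictly smaller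
  rank than its level unless the two coincide, and S' differs from S somewhere.\<close>

lemma good_dual_imp_less:
  assumes S': "set_mset S' \<subseteq> flats M" "size S' = size S" and good: "good (S' + dual)" and ne: "S' \<noteq> S"
  shows "rank_sum S' < rank_sum S"
proof -
  have img: "image_mset top S' = S" by (rule good_dual_imp_top[OF S' good])
  have "\<exists>H\<in>#S'. top H \<noteq> H"
  proof (rule ccontr)
    assume "\<not> ?thesis"
    then have "image_mset top S' = image_mset id S'" by (intro image_mset_cong) auto
    with img ne show False by simp
  qed
  then obtain H where H: "H \<in># S'" "top H \<noteq> H" by blast
  obtain S'' where S'': "S' = add_mset H S''" using H by (metis insert_DiffM)
  have "H \<in> flats M" using H S' by blast
  then have "rk H < rk (top H)"
    using flat_rk_less[of H "top H"] C_subset[OF top_mem[OF flat_subset]] top_superset[of H] H(2) by blast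
  moreover have "rank_sum S'' \<le> rank_sum (image_mset top S'')"
    unfolding rank_sum_def image_mset.compositionality comp_def
    by (intro sum_mset_mono rk_mono top_superset)
  moreover have "rank_sum S = rk (top H) + rank_sum (image_mset top S'')"
    by (metis S'' img image_mset_add_mset rank_sum_add)
  ultimately show ?thesis by (simp add: S'')
qed

end

context loopless_matroid
begin

definition elt :: nat where
  "elt = (SOME i. i \<in> E)"

lemma elt_mem: "F \<in> flats M \<Longrightarrow> F \<noteq> {} \<Longrightarrow> elt \<in> E"
  using flat_subset unfolding elt_def by (metis ex_in_conv someI_ex subset_empty)

text \<open>The class \<open>h\<^sub>F\<close> is \<open>- \<Sum>\<^sub>G\<^sub>\<supseteq>\<^sub>F x\<^sub>G\<close> with the ground set included and
  \<open>x\<^sub>E\<close> eliminated by the linear relation of \<open>elt\<close>.\<close>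

definition hflat :: "nat set \<Rightarrow> mpoly" where
  "hflat F = (\<Sum>G\<in>{G\<in>PF. elt \<in> G}. mpoly_var G) - (\<Sum>G\<in>{G\<in>PF. F \<subseteq> G}. mpoly_var G)"

definition hprod :: "nat set multiset \<Rightarrow> mpoly" where
  "hprod S = (\<Prod>F\<in>#S. hflat F)"

lemma poly_subst_hflat:
  assumes "F \<in> flats M" "F \<noteq> {}"
  shows "poly_subst xi (hflat F) = hvar F - hvar (cl {elt})"
proof -
  have i: "elt \<in> E" using elt_mem[OF assms] .
  have "{G\<in>PF. elt \<in> G} = {G\<in>PF. cl {elt} \<subseteq> G}"
    using cl_singleton_subset_iff[OF i PF_flat] by blast
  then show ?thesis
    using sum_xi[OF cl_singleton_nonempty[OF i]] sum_xi[OF assms]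
    by (simp add: hflat_def poly_subst_diff poly_subst_sum poly_subst_var)
qed

end

text \<open>The substitution sends \<open>hflat F\<close> to h_F minus the class of an atom. The
  functional kills all multiples of the latter, so \<open>hprod T\<close> acts like the monomial
  T.\<close>

lemma (in flat_chain) Lam_hprod:
  assumes "set_mset T \<subseteq> flats M - {{}}"
  shows "Lam (poly_subst xi (hprod T) * q) = Lam (Poly_Mapping.single T 1 * q)"
  using assms
proof (induction T arbitrary: q)
  case empty
  then show ?case by (simp add: hprod_def)
next
  case (add F T)
  then have F: "F \<in> flats M" "F \<noteq> {}" by auto
  let ?P = "poly_subst xi (hprod T)"
  have "poly_subst xi (hprod (add_mset F T)) * q = ?P * (hvar F * q) - hvar (cl {elt}) * (?P * q)"
    by (simp add: hprod_def poly_subst_mult poly_subst_hflat[OF F] algebra_simps)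
  moreover have "Lam (hvar (cl {elt}) * (?P * q)) = 0"
    using rk_cl_singleton[OF elt_mem[OF F]] by (intro Lam_atom cl_subset) simp
  ultimately have "Lam (poly_subst xi (hprod (add_mset F T)) * q) = Lam (?P * (hvar F * q))"
    by (simp add: Lam_diff)
  also have "\<dots> = Lam (Poly_Mapping.single T 1 * (hvar F * q))" using add by simp
  also have "Poly_Mapping.single T 1 * (hvar F * q) = Poly_Mapping.single (add_mset F T) 1 * q"
    by (simp add: hvar_def mult_single flip: mult.assoc)
  finally show ?case .
qed

context loopless_matroid
begin

text \<open>Among the multisets with nonzero coefficient, one of least rank sum is tested with its
  own functional and dual. The others have at least this rank sum and give 0, so its coefficient
  alone survives.\<close>

lemma nested_independent:
  assumes I: "finite I" "\<And>T. T \<in> I \<Longrightarrow> nested M T" "\<And>T. T \<in> I \<Longrightarrow> size T = j"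
    and mem: "(\<Sum>T\<in>I. mpoly_const (k T) * hprod T) \<in> chow_ideal M" and S: "S \<in> I"
  shows "k S = 0"
proof (rule ccontr)
  assume "k S \<noteq> 0"
  then obtain S where S: "S \<in> I" "k S \<noteq> 0"
    and min: "\<And>T. T \<in> I \<Longrightarrow> k T \<noteq> 0 \<Longrightarrow> rank_sum S \<le> rank_sum T"
    using ex_has_least_nat[of "\<lambda>T. T \<in> I \<and> k T \<noteq> 0" S rank_sum] \<open>S \<in> I\<close> by blast
  interpret nested_flats M S using I(2)[OF S(1)] by (rule nested_flatsI)
  define d where "d = (Poly_Mapping.single dual 1 :: hpoly)"
  have "0 = Lam (poly_subst xi (\<Sum>T\<in>I. mpoly_const (k T) * hprod T) * d)"
    by (rule Lam_chow_ideal[OF mem, symmetric])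
  also have "\<dots> = (\<Sum>T\<in>I. Lam (poly_subst xi (hprod T) * (Poly_Mapping.single 0 (k T) * d)))"
    unfolding poly_subst_sum poly_subst_mult poly_subst_const sum_distrib_right Lam_sum
    by (intro sum.cong refl arg_cong[of _ _ Lam]) (simp only: ac_simps)
  also have "\<dots> = (\<Sum>T\<in>I. k T * of_bool (good (T + dual)))"
  proof (rule sum.cong[OF refl])
    fix T assume "T \<in> I"
    then have "set_mset T \<subseteq> flats M - {{}}" using nested_nonempty I(2) by blast
    from Lam_hprod[OF this] show "Lam (poly_subst xi (hprod T) * (Poly_Mapping.single 0 (k T) * d)) = k T * of_bool (good (T + dual))"
      by (simp add: d_def mult_single Lam_single)
  qed
  also have "\<dots> = (\<Sum>T\<in>I. if T = S then k S else 0)"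
  proof (rule sum.cong[OF refl])
    fix T assume T: "T \<in> I"
    have "\<not> good (T + dual)" if "T \<noteq> S" "k T \<noteq> 0"
    proof
      assume "good (T + dual)"
      moreover have "set_mset T \<subseteq> flats M" using I(2)[OF T] by (simp add: nested_def)
      ultimately have "rank_sum T < rank_sum S"
        using good_dual_imp_less[of T] I(3) T S(1) that(1) by simp
      with min[OF T that(2)] show False by simp
    qed
    then show "k T * of_bool (good (T + dual)) = (if T = S then k S else 0)"
      using good_dual by auto
  qed
  also have "\<dots> = k S" using I(1) S(1) by simp
  finally show False using S(2) by simp
qed

end

section \<open>Straightening\<close>

lemma chow_ideal_add: "p \<in> chow_ideal M \<Longrightarrow> q \<in> chow_ideal M \<Longrightarrow> p + q \<in> chow_ideal M"
proof -
  interpret additive_subgroup "chow_ideal M" "flat_poly_ring M"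
    by (rule ideal.axioms(1)[OF chow_ideal_ideal])
  show "p \<in> chow_ideal M \<Longrightarrow> q \<in> chow_ideal M \<Longrightarrow> p + q \<in> chow_ideal M"
    using a_closed[of p q] by simp
qed

lemma chow_ideal_0 [simp]: "0 \<in> chow_ideal M"
proof -
  interpret additive_subgroup "chow_ideal M" "flat_poly_ring M"
    by (rule ideal.axioms(1)[OF chow_ideal_ideal])
  show ?thesis using zero_closed by simp
qed

lemma chow_ideal_mult:
  assumes "p \<in> chow_ideal M" "q \<in> carrier (flat_poly_ring M)"
  shows "q * p \<in> chow_ideal M" "p * q \<in> chow_ideal M"
proof -
  interpret ideal "chow_ideal M" "flat_poly_ring M" by (rule chow_ideal_ideal)
  show "q * p \<in> chow_ideal M" "p * q \<in> chow_ideal M"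
    using I_l_closed[OF assms] I_r_closed[OF assms] by simp_all
qed

lemma mpoly_carrier_1 [simp]: "1 \<in> carrier (mpoly_ring V)"
  and mpoly_carrier_0 [simp]: "0 \<in> carrier (mpoly_ring V)"
proof -
  interpret cring "mpoly_ring V" by (rule mpoly_ring_cring)
  show "1 \<in> carrier (mpoly_ring V)" "0 \<in> carrier (mpoly_ring V)" using one_closed zero_closed by simp_all
qed

lemma mpoly_carrier_diff:
  "p \<in> carrier (mpoly_ring V) \<Longrightarrow> q \<in> carrier (mpoly_ring V) \<Longrightarrow> p - q \<in> carrier (mpoly_ring V)"
  using mpoly_ring_closed(1)[of p V "- q"] mpoly_ring_closed(3)[of q V q] by simp

lemma mpoly_carrier_sum: "(\<And>x. x \<in> A \<Longrightarrow> f x \<in> carrier (mpoly_ring V)) \<Longrightarrow> sum f A \<in> carrier (mpoly_ring V)"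
  by (induction A rule: infinite_finite_induct) (auto intro: mpoly_ring_closed)

lemma mpoly_carrier_power: "p \<in> carrier (mpoly_ring V) \<Longrightarrow> p ^ n \<in> carrier (mpoly_ring V)"
  by (induction n) (auto intro: mpoly_ring_closed)

lemma chow_ideal_uminus: "p \<in> chow_ideal M \<Longrightarrow> - p \<in> chow_ideal M"
  using chow_ideal_mult(1)[of p M "- 1"] mpoly_ring_closed(3)[of 1 "proper_flats M" 1] by simp

lemma chow_ideal_diff: "p \<in> chow_ideal M \<Longrightarrow> q \<in> chow_ideal M \<Longrightarrow> p - q \<in> chow_ideal M"
  using chow_ideal_add[of p M "- q"] chow_ideal_uminus[of q M] by simp

lemma chow_ideal_sum: "(\<And>x. x \<in> A \<Longrightarrow> f x \<in> chow_ideal M) \<Longrightarrow> sum f A \<in> chow_ideal M"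
  by (induction A rule: infinite_finite_induct) (auto intro: chow_ideal_add)

lemma incomparable_in_chow_ideal:
  assumes "F \<in> proper_flats M" "G \<in> proper_flats M" "\<not> F \<subseteq> G" "\<not> G \<subseteq> F"
  shows "mpoly_var F * mpoly_var G \<in> chow_ideal M"
proof -
  interpret R: cring "flat_poly_ring M" by (rule mpoly_ring_cring)
  have "mpoly_var F * mpoly_var G \<in> chow_I M"
    unfolding chow_I_def using assms by (intro subsetD[OF R.genideal_self[OF chow_generators_in_carrier(1)]]) blast
  moreover have "0 \<in> chow_J M"
  proof -
    interpret J: additive_subgroup "chow_J M" "flat_poly_ring M"
      unfolding chow_J_def by (rule ideal.axioms(1)[OF R.genideal_ideal[OF chow_generators_in_carrier(2)]])
    show ?thesis using J.zero_closed by simp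
  qed
  ultimately show ?thesis unfolding chow_ideal_def set_add_def' by force
qed

lemma linear_relation_in_chow_ideal:
  assumes "i \<in> ground M" "j \<in> ground M"
  shows "(\<Sum>F\<in>{F\<in>proper_flats M. i \<in> F}. mpoly_var F) - (\<Sum>F\<in>{F\<in>proper_flats M. j \<in> F}. mpoly_var F) \<in> chow_ideal M"
    (is "?p \<in> _")
proof -
  interpret R: cring "flat_poly_ring M" by (rule mpoly_ring_cring)
  have "?p \<in> chow_J M"
    unfolding chow_J_def using assms by (intro subsetD[OF R.genideal_self[OF chow_generators_in_carrier(2)]]) blast
  moreover have "0 \<in> chow_I M"
  proof -
    interpret I: additive_subgroup "chow_I M" "flat_poly_ring M"
      unfolding chow_I_def by (rule ideal.axioms(1)[OF R.genideal_ideal[OF chow_generators_in_carrier(1)]])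
    show ?thesis using I.zero_closed by simp
  qed
  ultimately show ?thesis unfolding chow_ideal_def set_add_def' by force
qed

section \<open>Relations between the classes of flats\<close>

definition chow_eq :: "matroid \<Rightarrow> mpoly \<Rightarrow> mpoly \<Rightarrow> bool" where
  "chow_eq M p q \<longleftrightarrow> p - q \<in> chow_ideal M"

lemma chow_eq_sym: "chow_eq M p q \<Longrightarrow> chow_eq M q p"
  unfolding chow_eq_def using chow_ideal_uminus[of "p - q" M] by simp

lemma chow_eq_trans [trans]: "chow_eq M p q \<Longrightarrow> chow_eq M q r \<Longrightarrow> chow_eq M p r"
  unfolding chow_eq_def using chow_ideal_add[of "p - q" M "q - r"] by simp

lemma chow_eq_mult: "chow_eq M p q \<Longrightarrow> r \<in> carrier (flat_poly_ring M) \<Longrightarrow> chow_eq M (r * p) (r * q)"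
  unfolding chow_eq_def using chow_ideal_mult(1)[of "p - q" M r] by (simp add: right_diff_distrib)

context loopless_matroid
begin

abbreviation R where "R \<equiv> flat_poly_ring M"

lemma hflat_carrier: "hflat F \<in> carrier R"
  unfolding hflat_def by (intro mpoly_carrier_diff mpoly_carrier_sum mpoly_var_in_carrier) auto

lemma hprod_carrier: "hprod S \<in> carrier R"
  unfolding hprod_def by (induction S) (auto intro: mpoly_ring_closed hflat_carrier)

lemma hprod_add_mset: "hprod (add_mset F S) = hflat F * hprod S"
  by (simp add: hprod_def)

lemma hprod_union: "hprod (S + T) = hprod S * hprod T"
  by (simp add: hprod_def)

lemma hprod_replicate: "hprod (replicate_mset n F) = hflat F ^ n"
  by (induction n) (simp_all add: hprod_def)

text \<open>The factors are sums of variables over the proper flats above F, respectively G, that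
  are not above U. Two such flats are incomparable: the larger would contain F and G, hence their
  join U.\<close>

lemma hflat_quadric:
  assumes F: "F \<in> flats M" and G: "G \<in> flats M" and U: "U = cl (F \<union> G)"
  shows "(hflat F - hflat U) * (hflat G - hflat U) \<in> chow_ideal M"
proof -
  have sub: "F \<union> G \<subseteq> E" using F G flat_subset by blast
  have U_iff: "U \<subseteq> H \<longleftrightarrow> F \<subseteq> H \<and> G \<subseteq> H" if "H \<in> PF" for H
    using cl_least[OF sub PF_flat[OF that]] by (simp add: U)
  have diff: "hflat F' - hflat U = - (\<Sum>H\<in>{H\<in>PF. F' \<subseteq> H \<and> \<not> U \<subseteq> H}. mpoly_var H)" if "F' \<subseteq> U" for F'
  proof -
    have "{H\<in>PF. F' \<subseteq> H} = {H\<in>PF. F' \<subseteq> H \<and> \<not> U \<subseteq> H} \<union> {H\<in>PF. U \<subseteq> H}" using that by blast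
    then have "(\<Sum>H\<in>{H\<in>PF. F' \<subseteq> H}. mpoly_var H) =
        (\<Sum>H\<in>{H\<in>PF. F' \<subseteq> H \<and> \<not> U \<subseteq> H}. mpoly_var H) + (\<Sum>H\<in>{H\<in>PF. U \<subseteq> H}. mpoly_var H)"
      by (simp only:) (intro sum.union_disjoint, auto)
    then show ?thesis by (simp add: hflat_def)
  qed
  have FU: "F \<subseteq> U" "G \<subseteq> U" using cl_superset[OF sub] by (auto simp: U)
  let ?S = "{H\<in>PF. F \<subseteq> H \<and> \<not> U \<subseteq> H}" and ?T = "{H\<in>PF. G \<subseteq> H \<and> \<not> U \<subseteq> H}"
  have "(hflat F - hflat U) * (hflat G - hflat U) = (\<Sum>H\<in>?S. \<Sum>K\<in>?T. mpoly_var H * mpoly_var K)"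
    unfolding diff[OF FU(1)] diff[OF FU(2)] by (simp add: sum_product)
  also have "\<dots> \<in> chow_ideal M"
  proof (intro chow_ideal_sum incomparable_in_chow_ideal)
    fix H K assume "H \<in> ?S" "K \<in> ?T"
    then show "H \<in> PF" "K \<in> PF" "\<not> H \<subseteq> K" "\<not> K \<subseteq> H" using U_iff by auto
  qed
  finally show ?thesis .
qed

text \<open>The flats above the closure of a are those containing a, so this is a linear generator
  of the ideal.\<close>

lemma hflat_atom:
  assumes "a \<in> E"
  shows "hflat (cl {a}) \<in> chow_ideal M"
proof -
  have "elt \<in> E" using elt_mem[OF cl_singleton_nonempty] assms by blast
  moreover have "{G\<in>PF. cl {a} \<subseteq> G} = {G\<in>PF. a \<in> G}"
    using cl_singleton_subset_iff[OF assms PF_flat] by blast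
  ultimately show ?thesis
    using linear_relation_in_chow_ideal[of elt M a] assms by (simp add: hflat_def)
qed

text \<open>G is the join of F and the atom spanned by a. The class of an atom vanishes, so the
  quadratic relation collapses to (h_F - h_G) h_G = 0.\<close>

lemma hflat_cover:
  assumes F: "F \<in> flats M" and a: "a \<in> E - F" and G: "G = cl (insert a F)"
  shows "chow_eq M (hflat F * hflat G) (hflat G * hflat G)"
proof -
  have FE: "F \<subseteq> E" using F flat_subset by blast
  have aE: "a \<in> E" using a by blast
  have "G = cl (F \<union> cl {a})"
  proof (rule subset_antisym)
    have "insert a F \<subseteq> F \<union> cl {a}" using mem_cl_singleton[OF aE] by blast
    also have "\<dots> \<subseteq> cl (F \<union> cl {a})" using FE cl_subset by (intro cl_superset) blast
    finally show "G \<subseteq> cl (F \<union> cl {a})"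
      unfolding G using FE cl_subset by (intro cl_minimal cl_flat) blast+
    have ins: "insert a F \<subseteq> cl (insert a F)" using FE aE by (intro cl_superset) blast
    have "cl (insert a F) \<in> flats M" using FE aE by (intro cl_flat) blast
    moreover from this have "cl {a} \<subseteq> cl (insert a F)" using ins by (intro cl_minimal) blast+
    ultimately show "cl (F \<union> cl {a}) \<subseteq> G"
      unfolding G using ins by (intro cl_minimal) blast+
  qed
  then have "(hflat F - hflat G) * (hflat (cl {a}) - hflat G) \<in> chow_ideal M"
    using hflat_quadric[OF F cl_singleton_nonempty(1)[OF aE]] by blast
  moreover have "(hflat F - hflat G) * hflat (cl {a}) \<in> chow_ideal M"
    by (intro chow_ideal_mult(1) hflat_atom[OF aE] mpoly_carrier_diff hflat_carrier)
  ultimately have "(hflat F - hflat G) * (hflat (cl {a}) - hflat G) - (hflat F - hflat G) * hflat (cl {a}) \<in> chow_ideal M"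
    by (rule chow_ideal_diff)
  then have "chow_eq M (hflat G * hflat G) (hflat F * hflat G)"
    unfolding chow_eq_def by (simp add: algebra_simps)
  then show ?thesis by (rule chow_eq_sym)
qed

text \<open>A cover F' of F below G is interposed. The induction hypothesis for F' trades one h_G
  for h_F', the cover relation replaces h_F by a second h_F', and the induction hypothesis then
  turns both copies of h_F' into h_G.\<close>

lemma hflat_power:
  assumes G: "G \<in> flats M"
  shows "F \<in> flats M \<Longrightarrow> F \<subset> G \<Longrightarrow> rk G = rk F + Suc n \<Longrightarrow>
    chow_eq M (hflat F * hflat G ^ Suc n) (hflat G ^ Suc (Suc n))"
proof (induction n arbitrary: F)
  case 0
  then obtain a where a: "a \<in> G - F" by blast
  then have aE: "a \<in> E - F" using G flat_subset by blast
  have cl: "cl (insert a F) \<in> flats M" using aE flat_subset[OF 0(1)] by (intro cl_flat) blast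
  have "cl (insert a F) \<subseteq> G" using a 0 by (intro cl_minimal[OF G]) blast
  then have "cl (insert a F) = G"
    using rk_flat_eq_imp_eq[OF cl G] rk_cl_insert[OF 0(1) aE] 0(3) by simp
  then show ?case using hflat_cover[OF 0(1) aE] by simp
next
  case (Suc n)
  then obtain a where a: "a \<in> G - F" by blast
  then have aE: "a \<in> E - F" using G flat_subset by blast
  define F' where "F' = cl (insert a F)"
  have F': "F' \<in> flats M" unfolding F'_def using aE flat_subset[OF Suc.prems(1)] by (intro cl_flat) blast
  have rk: "rk F' = Suc (rk F)" unfolding F'_def by (rule rk_cl_insert[OF Suc.prems(1) aE])
  have "F' \<subseteq> G" unfolding F'_def using a Suc.prems by (intro cl_minimal[OF G]) blast
  moreover have "F' \<noteq> G" using rk Suc.prems(3) by auto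
  ultimately have IH: "chow_eq M (hflat F' * hflat G ^ Suc n) (hflat G ^ Suc (Suc n))"
    using Suc.IH[OF F'] rk Suc.prems(3) by simp
  have pow: "hflat G ^ k \<in> carrier R" for k by (rule mpoly_carrier_power[OF hflat_carrier])
  have "chow_eq M (hflat F * hflat G ^ Suc (Suc n)) (hflat F * (hflat F' * hflat G ^ Suc n))"
    by (rule chow_eq_sym[OF chow_eq_mult[OF IH hflat_carrier]])
  also have "hflat F * (hflat F' * hflat G ^ Suc n) = hflat G ^ Suc n * (hflat F * hflat F')"
    by (simp only: ac_simps)
  also have "chow_eq M \<dots> (hflat G ^ Suc n * (hflat F' * hflat F'))"
    by (rule chow_eq_mult[OF hflat_cover[OF Suc.prems(1) aE F'_def] pow])
  also have "hflat G ^ Suc n * (hflat F' * hflat F') = hflat F' * (hflat F' * hflat G ^ Suc n)"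
    by (simp only: ac_simps)
  also have "chow_eq M \<dots> (hflat F' * hflat G ^ Suc (Suc n))"
    by (rule chow_eq_mult[OF IH hflat_carrier])
  also have "hflat F' * hflat G ^ Suc (Suc n) = hflat G * (hflat F' * hflat G ^ Suc n)"
    by (simp only: power_Suc ac_simps)
  also have "chow_eq M \<dots> (hflat G * hflat G ^ Suc (Suc n))"
    by (rule chow_eq_mult[OF IH hflat_carrier])
  finally show ?case by (simp only: power_Suc)
qed

text \<open>In the power relation with F an atom the left side vanishes. The rank gap from an atom
  to G is rk G - 1 = Suc n, whence n = rk G - 2.\<close>

lemma hflat_power_rank:
  assumes G: "G \<in> flats M" "G \<noteq> {}"
  shows "hflat G ^ rk G \<in> chow_ideal M"
proof -
  obtain a where a: "a \<in> G" using G by blast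
  then have aE: "a \<in> E" using G flat_subset by blast
  have sub: "cl {a} \<subseteq> G" using a by (intro cl_minimal[OF G(1)]) blast
  show ?thesis
  proof (cases "cl {a} = G")
    case True
    then show ?thesis using hflat_atom[OF aE] rk_cl_singleton[OF aE] by simp
  next
    case False
    then have less: "rk (cl {a}) < rk G"
      using flat_rk_less[OF cl_singleton_nonempty(1)[OF aE] flat_subset[OF G(1)]] sub by blast
    define n where "n = rk G - 2"
    have n: "rk G = rk (cl {a}) + Suc n" using less rk_cl_singleton[OF aE] by (simp add: n_def)
    have "chow_eq M (hflat (cl {a}) * hflat G ^ Suc n) (hflat G ^ Suc (Suc n))"
      using hflat_power[OF G(1) cl_singleton_nonempty(1)[OF aE] _ n] sub False by blast
    then have "hflat (cl {a}) * hflat G ^ Suc n - hflat G ^ Suc (Suc n) \<in> chow_ideal M"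
      by (simp only: chow_eq_def)
    moreover have "hflat (cl {a}) * hflat G ^ Suc n \<in> chow_ideal M"
      by (intro chow_ideal_mult(2) hflat_atom[OF aE] mpoly_carrier_power hflat_carrier)
    ultimately have "hflat (cl {a}) * hflat G ^ Suc n - (hflat (cl {a}) * hflat G ^ Suc n - hflat G ^ Suc (Suc n)) \<in> chow_ideal M"
      by (rule chow_ideal_diff[rotated])
    moreover have "rk G = Suc (Suc n)" using n rk_cl_singleton[OF aE] by simp
    ultimately show ?thesis by simp
  qed
qed

section \<open>Spanning by nested monomials\<close>

definition nested_msets :: "nat \<Rightarrow> nat set multiset set" where
  "nested_msets j = {S. nested M S \<and> size S = j}"

lemma finite_nested_msets [simp]: "finite (nested_msets j)"
proof -
  have "nested_msets j \<subseteq> mset ` {xs. set xs \<subseteq> flats M \<and> length xs = j}"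
  proof
    fix S assume S: "S \<in> nested_msets j"
    obtain xs where xs: "mset xs = S" using ex_mset by blast
    moreover have "set xs \<subseteq> flats M" "length xs = j"
      using S unfolding nested_msets_def nested_def xs[symmetric] by auto
    ultimately show "S \<in> mset ` {xs. set xs \<subseteq> flats M \<and> length xs = j}" by blast
  qed
  then show ?thesis by (rule finite_subset) (simp add: finite_lists_length_eq)
qed

text \<open>Congruence modulo the Chow ideal is built in. The degree j stays fixed because all
  straightening relations are homogeneous.\<close>

definition nspan :: "nat \<Rightarrow> mpoly set" where
  "nspan j = {p. \<exists>k. chow_eq M p (\<Sum>S\<in>nested_msets j. mpoly_const (k S) * hprod S)}"

lemma mpoly_const_add: "mpoly_const (a + b) = mpoly_const a + mpoly_const b"
  and mpoly_const_mult: "mpoly_const (a * b) = mpoly_const a * mpoly_const b"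
  and mpoly_const_0 [simp]: "mpoly_const 0 = 0" and mpoly_const_1 [simp]: "mpoly_const 1 = 1"
  by (simp_all add: mpoly_const_def single_add mult_single)

lemma nspan_add: "p \<in> nspan j \<Longrightarrow> q \<in> nspan j \<Longrightarrow> p + q \<in> nspan j"
proof -
  assume "p \<in> nspan j" "q \<in> nspan j"
  then obtain k l where k: "p - (\<Sum>S\<in>nested_msets j. mpoly_const (k S) * hprod S) \<in> chow_ideal M"
    and l: "q - (\<Sum>S\<in>nested_msets j. mpoly_const (l S) * hprod S) \<in> chow_ideal M"
    by (auto simp: nspan_def chow_eq_def)
  have "p + q - (\<Sum>S\<in>nested_msets j. mpoly_const (k S + l S) * hprod S) =
      (p - (\<Sum>S\<in>nested_msets j. mpoly_const (k S) * hprod S)) + (q - (\<Sum>S\<in>nested_msets j. mpoly_const (l S) * hprod S))"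
    by (simp add: mpoly_const_add distrib_right sum.distrib)
  then have "chow_eq M (p + q) (\<Sum>S\<in>nested_msets j. mpoly_const (k S + l S) * hprod S)"
    using chow_ideal_add[OF k l] by (simp only: chow_eq_def)
  then show ?thesis unfolding nspan_def by (intro CollectI exI[of _ "\<lambda>S. k S + l S"])
qed

lemma nspan_const_mult: "p \<in> nspan j \<Longrightarrow> mpoly_const c * p \<in> nspan j"
proof -
  assume "p \<in> nspan j"
  then obtain k where k: "chow_eq M p (\<Sum>S\<in>nested_msets j. mpoly_const (k S) * hprod S)"
    by (auto simp: nspan_def)
  have "chow_eq M (mpoly_const c * p) (\<Sum>S\<in>nested_msets j. mpoly_const (c * k S) * hprod S)"
    using chow_eq_mult[OF k mpoly_const_in_carrier[of c]] by (simp add: sum_distrib_left mpoly_const_mult mult.assoc)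
  then show ?thesis unfolding nspan_def by (intro CollectI exI[of _ "\<lambda>S. c * k S"])
qed

lemma nspan_uminus: "p \<in> nspan j \<Longrightarrow> - p \<in> nspan j"
proof -
  have "1 + mpoly_const (- 1) = 0" using mpoly_const_add[of 1 "- 1"] by simp
  then have "(1 + mpoly_const (- 1)) * p = 0" by simp
  then have "mpoly_const (- 1) * p = - p" by (simp add: distrib_right eq_neg_iff_add_eq_0 add.commute)
  then show "p \<in> nspan j \<Longrightarrow> - p \<in> nspan j" using nspan_const_mult[of p j "- 1"] by simp
qed

lemma nspan_cong: "chow_eq M p q \<Longrightarrow> q \<in> nspan j \<Longrightarrow> p \<in> nspan j"
  unfolding nspan_def using chow_eq_trans by blast

lemma nspan_0: "0 \<in> nspan j"
  unfolding nspan_def by (intro CollectI exI[of _ "\<lambda>_. 0"]) (simp add: chow_eq_def)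

lemma nspan_sum: "(\<And>x. x \<in> A \<Longrightarrow> f x \<in> nspan j) \<Longrightarrow> sum f A \<in> nspan j"
  by (induction A rule: infinite_finite_induct) (auto intro: nspan_add nspan_0)

lemma nspan_nested:
  assumes "nested M S"
  shows "hprod S \<in> nspan (size S)"
proof -
  have "(\<Sum>T\<in>nested_msets (size S). mpoly_const (of_bool (T = S)) * hprod T) =
      (\<Sum>T\<in>nested_msets (size S). if T = S then hprod S else 0)"
    by (rule sum.cong) auto
  also have "\<dots> = hprod S" using assms by (simp add: nested_msets_def[symmetric]) (simp add: nested_msets_def)
  finally show ?thesis unfolding nspan_def
    by (intro CollectI exI[of _ "\<lambda>T. of_bool (T = S)"]) (simp add: chow_eq_def)
qed

lemma rank_sum_le: "set_mset S \<subseteq> flats M \<Longrightarrow> rank_sum S \<le> size S * rk E"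
proof (induction S)
  case (add F S)
  then have "rk F \<le> rk E" using flat_subset by (intro rk_mono) auto
  then show ?case using add by simp
qed (simp add: rank_sum_def)

text \<open>The measure is the gap between \<open>rank_sum S\<close> and its upper bound for the
  given size. A multiset of nonempty flats that is not nested has an incomparable pair, too many
  copies of a flat, or too many copies of a flat above another member. Each defect is removed by a
  relation whose other terms, if any, have the same size and larger rank sum.\<close>

lemma hprod_in_nspan:
  "set_mset S \<subseteq> flats M - {{}} \<Longrightarrow> hprod S \<in> nspan (size S)"
proof (induction "size S * rk E - rank_sum S" arbitrary: S rule: less_induct)
  case less
  note flats = less.prems
  have IH: "hprod T \<in> nspan (size S)"
    if "set_mset T \<subseteq> flats M - {{}}" "size T = size S" "rank_sum S < rank_sum T" for T
  proof -
    have "rank_sum T \<le> size T * rk E" using that by (intro rank_sum_le) blast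
    then show ?thesis using less.hyps[of T] that by simp
  qed
  consider (nested) "nested M S" | (chain) F G where "F \<in># S" "G \<in># S" "\<not> F \<subseteq> G" "\<not> G \<subseteq> F"
    | (rank) G where "G \<in># S" "rk G \<le> count S G"
    | (pair) F G where "F \<in># S" "G \<in># S" "F \<subset> G" "rk G \<le> count S G + rk F"
  proof -
    have "nested M S" if "\<forall>F\<in>#S. \<forall>G\<in>#S. F \<subseteq> G \<or> G \<subseteq> F" "\<forall>G\<in>#S. \<not> rk G \<le> count S G"
      "\<forall>F\<in>#S. \<forall>G\<in>#S. F \<subset> G \<longrightarrow> \<not> rk G \<le> count S G + rk F"
      unfolding nested_def chain_subset_def using flats that by (simp only: not_le simp_thms) blast
    then show thesis using nested chain rank pair by metis
  qed
  then show ?case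
  proof cases
    case nested
    then show ?thesis by (rule nspan_nested)
  next
    case chain
    then have "G \<in># S - {#F#}" by (metis in_diff_count insert_DiffM insert_noteq_member order_refl)
    with chain obtain S' where S': "S = add_mset F (add_mset G S')" by (metis insert_DiffM)
    define U where "U = cl (F \<union> G)"
    have FG: "F \<in> flats M" "G \<in> flats M" "F \<union> G \<subseteq> E" using flats chain flat_subset by blast+
    have U: "U \<in> flats M" "F \<subset> U" "G \<subset> U"
      using cl_flat[OF FG(3)] cl_superset[OF FG(3)] chain by (auto simp: U_def)
    have rk: "rk F < rk U" "rk G < rk U"
      using flat_rk_less[OF FG(1) flat_subset[OF U(1)] U(2)] flat_rk_less[OF FG(2) flat_subset[OF U(1)] U(3)] .
    have S'_flats: "set_mset S' \<subseteq> flats M - {{}}" "F \<noteq> {}" "G \<noteq> {}" "U \<noteq> {}" using flats S' U by auto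
    have "hprod S' * ((hflat F - hflat U) * (hflat G - hflat U)) \<in> chow_ideal M"
      by (intro chow_ideal_mult(1) hflat_quadric[OF FG(1,2) U_def] hprod_carrier)
    moreover have "hprod S' * ((hflat F - hflat U) * (hflat G - hflat U)) =
        hprod S - (hprod (add_mset F (add_mset U S')) + hprod (add_mset G (add_mset U S')) + - hprod (add_mset U (add_mset U S')))"
      by (simp add: S' hprod_add_mset algebra_simps)
    ultimately have "chow_eq M (hprod S)
        (hprod (add_mset F (add_mset U S')) + hprod (add_mset G (add_mset U S')) + - hprod (add_mset U (add_mset U S')))"
      by (simp only: chow_eq_def)
    then show ?thesis
    proof (rule nspan_cong)
      show "hprod (add_mset F (add_mset U S')) + hprod (add_mset G (add_mset U S')) + - hprod (add_mset U (add_mset U S')) \<in> nspan (size S)"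
        by (intro nspan_add nspan_uminus IH) (use S'_flats FG U rk in \<open>simp_all add: S'\<close>)
    qed
  next
    case rank
    define S' where "S' = S - replicate_mset (rk G) G"
    have "replicate_mset (rk G) G \<subseteq># S" using rank by (simp flip: count_le_replicate_mset_subset_eq)
    then have S': "S = replicate_mset (rk G) G + S'" by (simp add: S'_def)
    have "G \<in> flats M" "G \<noteq> {}" using rank flats by blast+
    then have "hprod S \<in> chow_ideal M"
      by (subst S', unfold hprod_union hprod_replicate)
        (intro chow_ideal_mult(2) hflat_power_rank hprod_carrier)
    then have "chow_eq M (hprod S) 0" by (simp add: chow_eq_def)
    then show ?thesis using nspan_0 by (rule nspan_cong)
  next
    case pair
    have FG: "F \<in> flats M" "G \<in> flats M" "F \<noteq> {}" "G \<noteq> {}" using pair flats by blast+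
    have rk: "rk F < rk G" using flat_rk_less[OF FG(1) flat_subset[OF FG(2)] pair(3)] .
    define n where "n = rk G - rk F - 1"
    have n: "rk G = rk F + Suc n" using rk by (simp add: n_def)
    have "F \<noteq> G" using pair(3) by blast
    then have "Suc n \<le> count (S - {#F#}) G" using pair(4) n by simp
    then have "replicate_mset (Suc n) G \<subseteq># S - {#F#}" by (simp only: count_le_replicate_mset_subset_eq)
    then obtain S' where "S - {#F#} = replicate_mset (Suc n) G + S'" by (metis subset_mset.add_diff_inverse)
    then have S': "S = add_mset F (replicate_mset (Suc n) G + S')" using pair(1) by (metis insert_DiffM)
    have "chow_eq M (hflat F * hflat G ^ Suc n) (hflat G ^ Suc (Suc n))"
      by (rule hflat_power[OF FG(2,1) pair(3) n])
    from chow_eq_mult[OF this hprod_carrier[of S']]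
    have "chow_eq M (hprod S) (hprod (replicate_mset (Suc (Suc n)) G + S'))"
      unfolding S' hprod_add_mset hprod_union hprod_replicate by (simp only: ac_simps)
    then show ?thesis
    proof (rule nspan_cong)
      have "rank_sum (replicate_mset k G + S') = k * rk G + rank_sum S'" for k
        by (induction k) simp_all
      then have "rank_sum S < rank_sum (replicate_mset (Suc (Suc n)) G + S')"
        unfolding S' rank_sum_add using rk by simp
      then show "hprod (replicate_mset (Suc (Suc n)) G + S') \<in> nspan (size S)"
        using flats FG by (intro IH) (auto simp: S')
    qed
  qed
qed

text \<open>This holds for polynomials, not only for classes: x_F is h_E - h_F minus the variables
  of the larger proper flats, which are already expressed.\<close>

lemma var_hflat_combination:
  assumes "F \<in> PF"
  shows "\<exists>z. mpoly_var F = (\<Sum>G\<in>flats M - {{}}. mpoly_const (z G) * hflat G)"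
proof -
  define W where "W = {p. \<exists>z. p = (\<Sum>G\<in>flats M - {{}}. mpoly_const (z G) * hflat G)}"
  have W_diff: "p - q \<in> W" if pq: "p \<in> W" "q \<in> W" for p q
  proof -
    obtain y z where yz: "p = (\<Sum>G\<in>flats M - {{}}. mpoly_const (y G) * hflat G)"
      "q = (\<Sum>G\<in>flats M - {{}}. mpoly_const (z G) * hflat G)" using pq by (auto simp: W_def)
    have "mpoly_const (y G - z G) = mpoly_const (y G) - mpoly_const (z G)" for G
      using mpoly_const_add[of "y G - z G" "z G"] by (simp add: algebra_simps)
    then have "p - q = (\<Sum>G\<in>flats M - {{}}. mpoly_const (y G - z G) * hflat G)"
      unfolding yz by (simp add: left_diff_distrib sum_subtractf)
    then show ?thesis unfolding W_def by (intro CollectI exI)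
  qed
  have W_h: "hflat H \<in> W" if H: "H \<in> flats M" "H \<noteq> {}" for H
  proof -
    have "(\<Sum>G\<in>flats M - {{}}. mpoly_const (of_bool (G = H)) * hflat G) = (\<Sum>G\<in>flats M - {{}}. if G = H then hflat H else 0)"
      by (rule sum.cong) auto
    also have "\<dots> = hflat H" using H by (subst sum.delta) auto
    finally show ?thesis unfolding W_def by (intro CollectI exI[of _ "\<lambda>G. of_bool (G = H)"]) simp
  qed
  have W_0: "0 \<in> W" unfolding W_def by (intro CollectI exI[of _ "\<lambda>_. 0"]) simp
  have W_add: "p + q \<in> W" if "p \<in> W" "q \<in> W" for p q
    using W_diff[OF that(1) W_diff[OF W_0 that(2)]] by simp
  have W_sum: "sum f A \<in> W" if "\<And>x. x \<in> A \<Longrightarrow> f x \<in> W" for f :: "nat set \<Rightarrow> mpoly" and A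
    using that by (induction A rule: infinite_finite_induct) (auto intro: W_add W_0)
  have "mpoly_var F \<in> W"
    using assms
  proof (induction "card (E - F)" arbitrary: F rule: less_induct)
    case less
    have F: "F \<in> flats M" "F \<noteq> {}" "F \<noteq> E" using less.prems by (auto simp: proper_flats_def)
    have "E \<noteq> {}" using F flat_subset by blast
    have none: "{G\<in>PF. E \<subseteq> G} = {}" using PF_flat flat_subset by (auto simp: proper_flats_def)
    have "hflat E - hflat F = (\<Sum>G\<in>{G\<in>PF. F \<subseteq> G}. mpoly_var G)"
      unfolding hflat_def none by simp
    also have "{G\<in>PF. F \<subseteq> G} = insert F {G\<in>PF. F \<subset> G}" using less.prems by blast
    also have "(\<Sum>G\<in>insert F {G\<in>PF. F \<subset> G}. mpoly_var G) = mpoly_var F + (\<Sum>G\<in>{G\<in>PF. F \<subset> G}. mpoly_var G)"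
      by (subst sum.insert) auto
    finally have "mpoly_var F = hflat E - hflat F - (\<Sum>G\<in>{G\<in>PF. F \<subset> G}. mpoly_var G)" by (simp add: algebra_simps)
    moreover have "(\<Sum>G\<in>{G\<in>PF. F \<subset> G}. mpoly_var G) \<in> W"
    proof (rule W_sum)
      fix G assume G: "G \<in> {G\<in>PF. F \<subset> G}"
      then have "G \<subseteq> E" using PF_flat flat_subset by blast
      then have "E - G \<subset> E - F" using G by auto
      then have "card (E - G) < card (E - F)" by (simp add: psubset_card_mono)
      then show "mpoly_var G \<in> W" using less.hyps[of G] G by blast
    qed
    ultimately show ?case using W_diff W_h F \<open>E \<noteq> {}\<close> by simp
  qed
  then show ?thesis by (simp add: W_def)
qed

lemma mono_mset_hprod_in_nspan:
  "set_mset X \<subseteq> PF \<Longrightarrow> set_mset S \<subseteq> flats M - {{}} \<Longrightarrow> mono_mset X * hprod S \<in> nspan (size X + size S)"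
proof (induction X arbitrary: S)
  case empty
  then show ?case using hprod_in_nspan by (simp add: mono_mset_def)
next
  case (add F X)
  then obtain z where z: "mpoly_var F = (\<Sum>G\<in>flats M - {{}}. mpoly_const (z G) * hflat G)"
    using var_hflat_combination[of F] by auto
  have "mono_mset (add_mset F X) * hprod S = mpoly_var F * (mono_mset X * hprod S)"
    by (simp add: mono_mset_def mult.assoc)
  also have "\<dots> = (\<Sum>G\<in>flats M - {{}}. mpoly_const (z G) * (mono_mset X * hprod (add_mset G S)))"
    unfolding z sum_distrib_right hprod_add_mset by (intro sum.cong refl) (simp only: ac_simps)
  also have "\<dots> \<in> nspan (size (add_mset F X) + size S)"
  proof (intro nspan_sum nspan_const_mult)
    fix G assume "G \<in> flats M - {{}}"
    then have "mono_mset X * hprod (add_mset G S) \<in> nspan (size X + size (add_mset G S))"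
      using add.prems by (intro add.IH) auto
    then show "mono_mset X * hprod (add_mset G S) \<in> nspan (size (add_mset F X) + size S)" by simp
  qed
  finally show ?case .
qed

lemma homogeneous_in_nspan:
  assumes p: "p \<in> carrier R" "homogeneous j p"
  shows "p \<in> nspan j"
proof -
  have "Poly_Mapping.single m (Poly_Mapping.lookup p m) \<in> nspan j" if m: "m \<in> Poly_Mapping.keys p" for m
  proof -
    obtain X where X: "Poly_Mapping.single m 1 = mono_mset X" "set_mset X \<subseteq> Poly_Mapping.keys m" "size X = total_degree m"
      by (rule monomial_eq_mono_mset)
    have "set_mset X \<subseteq> PF" "size X = j"
      using X p m by (auto simp: carrier_mpoly_ring homogeneous_def)
    then have "mono_mset X \<in> nspan j" using mono_mset_hprod_in_nspan[of X "{#}"] by (simp add: hprod_def)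
    then have "mpoly_const (Poly_Mapping.lookup p m) * Poly_Mapping.single m 1 \<in> nspan j"
      unfolding X(1) by (rule nspan_const_mult)
    then show ?thesis by (simp add: mpoly_const_def mult_single)
  qed
  then have "(\<Sum>m\<in>Poly_Mapping.keys p. Poly_Mapping.single m (Poly_Mapping.lookup p m)) \<in> nspan j"
    by (rule nspan_sum)
  then show ?thesis by (simp flip: poly_mapping_sum_singles)
qed

end

section \<open>The Hilbert series\<close>

lemma homogeneous_0 [simp]: "homogeneous j 0"
  by (simp add: homogeneous_def)

lemma homogeneous_add: "homogeneous j p \<Longrightarrow> homogeneous j q \<Longrightarrow> homogeneous j (p + q)"
  unfolding homogeneous_def using Poly_Mapping.keys_add[of p q] by blast

lemma homogeneous_diff: "homogeneous j p \<Longrightarrow> homogeneous j q \<Longrightarrow> homogeneous j (p - q)"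
  using homogeneous_add[of j p "- q"] by (simp add: homogeneous_def)

lemma homogeneous_sum: "(\<And>x. x \<in> A \<Longrightarrow> homogeneous j (f x)) \<Longrightarrow> homogeneous j (sum f A)"
  by (induction A rule: infinite_finite_induct) (auto intro: homogeneous_add)

lemma homogeneous_mult: "homogeneous i p \<Longrightarrow> homogeneous j q \<Longrightarrow> homogeneous (i + j) (p * q)"
  unfolding homogeneous_def
proof
  fix m assume *: "\<forall>m\<in>Poly_Mapping.keys p. total_degree m = i" "\<forall>m\<in>Poly_Mapping.keys q. total_degree m = j"
    "m \<in> Poly_Mapping.keys (p * q)"
  then obtain a b where "m = a + b" "a \<in> Poly_Mapping.keys p" "b \<in> Poly_Mapping.keys q"
    using Poly_Mapping.keys_mult[of p q] by blast
  with * show "total_degree m = i + j" by (simp add: total_degree_add)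
qed

lemma homogeneous_const: "homogeneous 0 (mpoly_const c)"
  by (simp add: homogeneous_def mpoly_const_def total_degree_def)

lemma homogeneous_var: "homogeneous 1 (mpoly_var F)"
  by (simp add: homogeneous_def mpoly_var_def total_degree_def)

lemma chow_class_hom: "ring_hom_ring (flat_poly_ring M) (chow_ring M) (chow_class M)"
proof -
  interpret I: ideal "chow_ideal M" "flat_poly_ring M" by (rule chow_ideal_ideal)
  show ?thesis using I.rcos_ring_hom_ring unfolding chow_ring_def chow_class_def .
qed

lemma chow_class_eq_iff:
  assumes "p \<in> carrier (flat_poly_ring M)" "q \<in> carrier (flat_poly_ring M)"
  shows "chow_class M p = chow_class M q \<longleftrightarrow> chow_eq M p q"
proof -
  interpret R: cring "flat_poly_ring M" by (rule mpoly_ring_cring)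
  have "p \<ominus>\<^bsub>flat_poly_ring M\<^esub> q = p - q" using assms by (simp add: a_minus_def mpoly_ring_minus)
  then show ?thesis
    using R.quotient_eq_iff_same_a_r_cos[OF chow_ideal_ideal assms] by (simp add: chow_class_def chow_eq_def)
qed

lemma exists_function_on_list: "distinct xs \<Longrightarrow> length xs = length ys \<Longrightarrow> \<exists>f. map f xs = ys"
proof (induction xs arbitrary: ys)
  case (Cons x xs)
  then obtain y ys' where ys: "ys = y # ys'" by (cases ys) auto
  with Cons obtain f where "map f xs = ys'" by auto
  then have "map (f(x := y)) (x # xs) = ys" using Cons.prems ys by auto
  then show ?case by blast
qed simp

context loopless_matroid
begin

lemma homogeneous_hprod: "homogeneous (size S) (hprod S)"
proof (induction S)
  case empty
  show ?case using homogeneous_const[of 1] by (simp add: hprod_def)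
next
  case (add F S)
  have "homogeneous 1 (hflat F)"
    unfolding hflat_def by (intro homogeneous_diff homogeneous_sum homogeneous_var)
  from homogeneous_mult[OF this add] show ?case by (simp add: hprod_add_mset)
qed

section \<open>Graded dimensions\<close>

definition hcomb :: "(nat set multiset \<Rightarrow> rat) \<Rightarrow> nat set multiset list \<Rightarrow> mpoly" where
  "hcomb k Ts = (\<Sum>T\<leftarrow>Ts. mpoly_const (k T) * hprod T)"

lemma hcomb_carrier: "hcomb k Ts \<in> carrier R"
  unfolding hcomb_def by (induction Ts) (auto intro!: mpoly_ring_closed hprod_carrier)

lemma hcomb_eq_sum: "distinct Ts \<Longrightarrow> hcomb k Ts = (\<Sum>T\<in>set Ts. mpoly_const (k T) * hprod T)"
  by (simp add: hcomb_def sum_list_distinct_conv_sum_set)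

lemma combine_hcomb:
  "ring.combine (chow_ring M) (map (\<lambda>T. chow_class M (mpoly_const (k T))) Ts) (map (\<lambda>T. chow_class M (hprod T)) Ts) =
    chow_class M (hcomb k Ts)"
proof -
  interpret C: cring "chow_ring M" by (rule chow_ring_cring)
  interpret h: ring_hom_ring R "chow_ring M" "chow_class M" by (rule chow_class_hom)
  show ?thesis
  proof (induction Ts)
    case Nil
    show ?case using h.hom_zero by (simp add: hcomb_def)
  next
    case (Cons T Ts)
    have "chow_class M (hcomb k (T # Ts)) = chow_class M (mpoly_const (k T) * hprod T + hcomb k Ts)"
      by (simp add: hcomb_def)
    also have "\<dots> = chow_class M (mpoly_const (k T) * hprod T) \<oplus>\<^bsub>chow_ring M\<^esub> chow_class M (hcomb k Ts)"
      using h.hom_add[of "mpoly_const (k T) * hprod T" "hcomb k Ts"] hcomb_carrier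
        mpoly_ring_closed(2)[OF mpoly_const_in_carrier hprod_carrier] by simp
    also have "chow_class M (mpoly_const (k T) * hprod T) =
        chow_class M (mpoly_const (k T)) \<otimes>\<^bsub>chow_ring M\<^esub> chow_class M (hprod T)"
      using h.hom_mult[of "mpoly_const (k T)" "hprod T"] hprod_carrier by simp
    finally show ?case using Cons by simp
  qed
qed

text \<open>Distinctness of Ts lets a list of scalars be read as a function of the multisets, and
  each scalar is the class of a rational constant.\<close>

lemma Span_hprod:
  assumes "distinct Ts"
  shows "ring.Span (chow_ring M) (chow_scalars M) (map (\<lambda>T. chow_class M (hprod T)) Ts) =
    {chow_class M (hcomb k Ts) | k. True}"
proof -
  interpret C: cring "chow_ring M" by (rule chow_ring_cring)
  interpret h: ring_hom_ring R "chow_ring M" "chow_class M" by (rule chow_class_hom)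
  let ?Us = "map (\<lambda>T. chow_class M (hprod T)) Ts"
  have Us: "set ?Us \<subseteq> carrier (chow_ring M)" using h.hom_closed hprod_carrier by auto
  have "C.Span (chow_scalars M) ?Us = {C.combine Ks ?Us | Ks. length Ks = length ?Us \<and> set Ks \<subseteq> chow_scalars M}"
    by (rule C.Span_eq_combine_set_length_version[OF chow_scalars_subfield Us])
  also have "\<dots> = {chow_class M (hcomb k Ts) | k. True}"
  proof (intro equalityI subsetI)
    fix x assume "x \<in> {C.combine Ks ?Us | Ks. length Ks = length ?Us \<and> set Ks \<subseteq> chow_scalars M}"
    then obtain Ks where Ks: "x = C.combine Ks ?Us" "length Ks = length Ts" "set Ks \<subseteq> chow_scalars M" by auto
    obtain f where f: "map f Ts = Ks" using exists_function_on_list[OF assms] Ks(2) by metis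
    have "\<forall>T\<in>set Ts. \<exists>c. f T = chow_class M (mpoly_const c)"
      using Ks(3) unfolding f[symmetric] chow_scalars_def by auto
    then obtain k where k: "\<forall>T\<in>set Ts. f T = chow_class M (mpoly_const (k T))" by metis
    have "Ks = map (\<lambda>T. chow_class M (mpoly_const (k T))) Ts" unfolding f[symmetric] using k by simp
    then have "x = chow_class M (hcomb k Ts)" using Ks(1) combine_hcomb[of k Ts] by simp
    then show "x \<in> {chow_class M (hcomb k Ts) | k. True}" by blast
  next
    fix x assume "x \<in> {chow_class M (hcomb k Ts) | k. True}"
    then obtain k where "x = chow_class M (hcomb k Ts)" by blast
    then have "x = C.combine (map (\<lambda>T. chow_class M (mpoly_const (k T))) Ts) ?Us"
      by (simp only: combine_hcomb)
    moreover have "set (map (\<lambda>T. chow_class M (mpoly_const (k T))) Ts) \<subseteq> chow_scalars M"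
      by (auto simp: chow_scalars_def)
    ultimately show "x \<in> {C.combine Ks ?Us | Ks. length Ks = length ?Us \<and> set Ks \<subseteq> chow_scalars M}"
      by (intro CollectI exI[of _ "map (\<lambda>T. chow_class M (mpoly_const (k T))) Ts"]) simp
  qed
  finally show ?thesis .
qed

lemma independent_hprod:
  "distinct Ts \<Longrightarrow> set Ts \<subseteq> nested_msets j \<Longrightarrow>
    ring.independent (chow_ring M) (chow_scalars M) (map (\<lambda>T. chow_class M (hprod T)) Ts)"
proof -
  interpret C: cring "chow_ring M" by (rule chow_ring_cring)
  interpret h: ring_hom_ring R "chow_ring M" "chow_class M" by (rule chow_class_hom)
  show "distinct Ts \<Longrightarrow> set Ts \<subseteq> nested_msets j \<Longrightarrow>
    C.independent (chow_scalars M) (map (\<lambda>T. chow_class M (hprod T)) Ts)"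
  proof (induction Ts)
    case (Cons T Ts)
    have "chow_class M (hprod T) \<notin> C.Span (chow_scalars M) (map (\<lambda>T. chow_class M (hprod T)) Ts)"
    proof
      assume "chow_class M (hprod T) \<in> C.Span (chow_scalars M) (map (\<lambda>T. chow_class M (hprod T)) Ts)"
      then obtain k where "chow_class M (hprod T) = chow_class M (hcomb k Ts)"
        using Span_hprod[of Ts] Cons.prems(1) by auto
      then have eq: "hprod T - hcomb k Ts \<in> chow_ideal M"
        using chow_class_eq_iff[OF hprod_carrier hcomb_carrier] by (simp add: chow_eq_def)
      \<comment> \<open>Membership in the span becomes a linear relation with coefficient 1 at T,
        which does not occur in Ts.\<close>
      define l where "l = (\<lambda>T'. - k T')(T := 1)"
      have "(\<Sum>T'\<in>set Ts. mpoly_const (l T') * hprod T') = (\<Sum>T'\<in>set Ts. - (mpoly_const (k T') * hprod T'))"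
        using Cons.prems(1) by (intro sum.cong) (auto simp: l_def mpoly_const_def single_uminus)
      then have "(\<Sum>T'\<in>set (T # Ts). mpoly_const (l T') * hprod T') = hprod T - hcomb k Ts"
        using Cons.prems(1) by (simp add: hcomb_eq_sum l_def sum_negf)
      then have mem: "(\<Sum>T'\<in>set (T # Ts). mpoly_const (l T') * hprod T') \<in> chow_ideal M" using eq by simp
      have "l T = 0"
        by (rule nested_independent[OF _ _ _ mem]) (use Cons.prems(2) in \<open>auto simp: nested_msets_def\<close>)
      then show False by (simp add: l_def)
    qed
    then show ?case using Cons h.hom_closed[OF hprod_carrier] by (auto intro!: C.li_Cons)
  qed simp
qed

theorem chow_dim_eq: "chow_dim M j = card (nested_msets j)"
proof -
  interpret C: cring "chow_ring M" by (rule chow_ring_cring)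
  obtain Ts where Ts: "set Ts = nested_msets j" "distinct Ts" "length Ts = card (nested_msets j)"
    using finite_distinct_list[OF finite_nested_msets[of j]] by (metis distinct_card)
  let ?Us = "map (\<lambda>T. chow_class M (hprod T)) Ts"
  have "C.Span (chow_scalars M) ?Us = chow_graded M j"
    unfolding Span_hprod[OF Ts(2)]
  proof (intro equalityI subsetI)
    fix x assume "x \<in> {chow_class M (hcomb k Ts) | k. True}"
    then obtain k where x: "x = chow_class M (hcomb k Ts)" by blast
    have "homogeneous j (mpoly_const (k T) * hprod T)" if "T \<in> set Ts" for T
      using homogeneous_mult[OF homogeneous_const[of "k T"] homogeneous_hprod[of T]] that
      unfolding Ts(1) by (simp add: nested_msets_def)
    then have "homogeneous j (hcomb k Ts)"
      unfolding hcomb_eq_sum[OF Ts(2)] by (rule homogeneous_sum)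
    then show "x \<in> chow_graded M j" unfolding x chow_graded_def using hcomb_carrier by blast
  next
    fix x assume "x \<in> chow_graded M j"
    then obtain p where p: "x = chow_class M p" "p \<in> carrier R" "homogeneous j p" by (auto simp: chow_graded_def)
    then obtain k where "chow_eq M p (hcomb k Ts)"
      using homogeneous_in_nspan[of p j] by (auto simp: nspan_def hcomb_eq_sum[OF Ts(2)] Ts(1))
    then show "x \<in> {chow_class M (hcomb k Ts) | k. True}"
      using chow_class_eq_iff[OF p(2) hcomb_carrier] p(1) by blast
  qed
  then have "C.dimension (card (nested_msets j)) (chow_scalars M) (chow_graded M j)"
    using C.dimension_independent[OF independent_hprod[OF Ts(2)], of j] Ts by simp
  then show ?thesis unfolding chow_dim_def by (rule C.dimI[OF chow_scalars_subfield])
qed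

text \<open>Every multiplicity is below a rank. The resulting degree bound makes the Hilbert series
  a polynomial.\<close>

lemma nested_size_le: "nested M S \<Longrightarrow> size S \<le> card (flats M) * rk E"
proof -
  assume S: "nested M S"
  have "size S = (\<Sum>G\<in>set_mset S. count S G)" by (rule size_multiset_overloaded_eq)
  also have "\<dots> \<le> (\<Sum>G\<in>set_mset S. rk E)"
  proof (rule sum_mono)
    fix G assume G: "G \<in># S"
    then have "count S G < rk G" "G \<in> flats M" using S by (auto simp: nested_def)
    moreover from this have "rk G \<le> rk E" using flat_subset by (intro rk_mono) auto
    ultimately show "count S G \<le> rk E" by simp
  qed
  also have "\<dots> = card (set_mset S) * rk E" by simp
  also have "\<dots> \<le> card (flats M) * rk E"
    using S by (intro mult_le_mono1 card_mono) (auto simp: nested_def)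
  finally show ?thesis .
qed

lemma coeff_hilbert_poly: "Polynomial.coeff (hilbert_poly M) j = int (card (nested_msets j))"
proof -
  define n where "n = card (flats M) * rk E"
  define p :: "int poly" where "p = (\<Sum>j\<le>n. Polynomial.monom (int (card (nested_msets j))) j)"
  have coeff: "Polynomial.coeff p j = int (card (nested_msets j))" for j
  proof (cases "j \<le> n")
    case True
    then show ?thesis by (simp add: p_def Polynomial.coeff_sum Polynomial.coeff_monom)
  next
    case False
    then have "nested_msets j = {}" using nested_size_le by (auto simp: nested_msets_def n_def)
    then show ?thesis using False by (simp add: p_def Polynomial.coeff_sum Polynomial.coeff_monom)
  qed
  have "fps_of_poly p = hilbert_series M"
    by (rule fps_ext) (simp add: hilbert_series_def chow_dim_eq coeff)
  then show ?thesis using hilbert_poly_eqI coeff by metis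
qed

end

section \<open>Valuativity\<close>

text \<open>Splitting over rank vectors \<rho> turns the numerical part of nestedness into a
  condition on S and \<rho> alone. A given matroid contributes only through its own rank vector;
  extensionality makes that vector occur at most once, and the bound by
  \<open>card (ground N)\<close> keeps the index set finite and common to all matroids on the ground
  set.\<close>

lemma nested_eq_sum_flag_type:
  assumes N: "is_matroid N" and S: "set_mset S \<subseteq> Pow (ground N)" "chain\<^sub>\<subseteq> (set_mset S)"
  defines "P \<equiv> {\<rho> \<in> PiE (set_mset S) (\<lambda>_. {..card (ground N)}). (\<forall>G\<in>#S. count S G < \<rho> G) \<and>
     (\<forall>F\<in>#S. \<forall>G\<in>#S. F \<subset> G \<longrightarrow> count S G + \<rho> F < \<rho> G)}"
  shows "of_bool (loopless N \<and> nested N S) = (\<Sum>\<rho>\<in>P. of_bool (flag_type N (set_mset S) \<rho>) :: int)"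
proof -
  interpret fin_matroid N using N by unfold_locales
  define r where "r = restrict rk (set_mset S)"
  have "finite (PiE (set_mset S) (\<lambda>_. {..card E}))" by (intro finite_PiE) auto
  then have fin: "finite P" unfolding P_def by simp
  have eq: "flag_type N (set_mset S) \<rho> \<longleftrightarrow> \<rho> = r \<and> loopless N \<and> set_mset S \<subseteq> flats N" if "\<rho> \<in> P" for \<rho>
  proof -
    have "\<rho> \<in> PiE (set_mset S) (\<lambda>_. {..card E})" using that by (simp add: P_def)
    then have "\<rho> = r \<longleftrightarrow> (\<forall>F\<in>#S. rk F = \<rho> F)"
      unfolding r_def by (auto simp: PiE_def extensional_def fun_eq_iff)
    then show ?thesis by (auto simp: flag_type_def)
  qed
  have r: "r \<in> P \<longleftrightarrow> (\<forall>G\<in>#S. count S G < rk G) \<and> (\<forall>F\<in>#S. \<forall>G\<in>#S. F \<subset> G \<longrightarrow> count S G + rk F < rk G)"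
  proof -
    have "r \<in> PiE (set_mset S) (\<lambda>_. {..card E})"
      using S(1) rk_le_card_ground by (auto simp: r_def)
    then show ?thesis by (simp add: P_def r_def)
  qed
  have "(\<Sum>\<rho>\<in>P. of_bool (flag_type N (set_mset S) \<rho>)) =
      (\<Sum>\<rho>\<in>P. if \<rho> = r then of_bool (loopless N \<and> set_mset S \<subseteq> flats N) else 0 :: int)"
    by (rule sum.cong) (simp_all add: eq)
  also have "\<dots> = of_bool (r \<in> P \<and> loopless N \<and> set_mset S \<subseteq> flats N)"
    using fin by (simp add: sum.delta)
  also have "r \<in> P \<and> loopless N \<and> set_mset S \<subseteq> flats N \<longleftrightarrow> loopless N \<and> nested N S"
    unfolding r nested_def by (simp only: S(2) simp_thms conj_ac)
  finally show ?thesis ..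
qed

text \<open>The index sets U and P S do not depend on i, so the sum over the matroids can be moved
  inside, where it vanishes for each flag type.\<close>

lemma card_nested_valuative:
  fixes N :: "nat \<Rightarrow> matroid" and a :: "nat \<Rightarrow> int"
  assumes N: "\<And>i. i < s \<Longrightarrow> is_matroid (N i)" "\<And>i. i < s \<Longrightarrow> ground (N i) = A"
    and rel: "\<And>x. x \<in> coord_space A \<Longrightarrow> (\<Sum>i<s. a i * indicator (base_polytope (N i)) x) = 0"
    and A: "finite A"
  shows "(\<Sum>i<s. a i * (if loopless (N i) then int (card {S. nested (N i) S \<and> size S = j}) else 0)) = 0"
proof -
  define U where "U = {S. set_mset S \<subseteq> Pow A \<and> size S = j \<and> chain\<^sub>\<subseteq> (set_mset S)}"
  have finU: "finite U"
  proof (rule finite_subset)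
    show "U \<subseteq> mset ` {xs. set xs \<subseteq> Pow A \<and> length xs = j}"
    proof
      fix S assume S: "S \<in> U"
      obtain xs where xs: "mset xs = S" using ex_mset by blast
      moreover have "set xs \<subseteq> Pow A" "length xs = j"
        using S unfolding U_def xs[symmetric] by auto
      ultimately show "S \<in> mset ` {xs. set xs \<subseteq> Pow A \<and> length xs = j}" by blast
    qed
    show "finite (mset ` {xs. set xs \<subseteq> Pow A \<and> length xs = j})"
      using A by (intro finite_imageI finite_lists_length_eq) simp
  qed
  define P where "P S = {\<rho> \<in> PiE (set_mset S) (\<lambda>_. {..card A}). (\<forall>G\<in>#S. count S G < \<rho> G) \<and>
     (\<forall>F\<in>#S. \<forall>G\<in>#S. F \<subset> G \<longrightarrow> count S G + \<rho> F < \<rho> G)}" for S :: "nat set multiset"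
  have count: "(if loopless (N i) then int (card {S. nested (N i) S \<and> size S = j}) else 0) =
      (\<Sum>S\<in>U. \<Sum>\<rho>\<in>P S. of_bool (flag_type (N i) (set_mset S) \<rho>))" if i: "i < s" for i
  proof -
    interpret fin_matroid "N i" using N(1)[OF i] by unfold_locales
    have "S \<in> U" if "nested (N i) S" "size S = j" for S
      using that flat_subset N(2)[OF i] by (auto simp: U_def nested_def)
    then have "{S \<in> U. loopless (N i) \<and> nested (N i) S} = (if loopless (N i) then {S. nested (N i) S \<and> size S = j} else {})"
      by (auto simp: U_def)
    moreover have "(\<Sum>S\<in>U. of_bool (loopless (N i) \<and> nested (N i) S)) = int (card {S \<in> U. loopless (N i) \<and> nested (N i) S})"
      using finU by (simp add: Int_def)
    ultimately have "(if loopless (N i) then int (card {S. nested (N i) S \<and> size S = j}) else 0) =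
        (\<Sum>S\<in>U. of_bool (loopless (N i) \<and> nested (N i) S))" by simp
    also have "\<dots> = (\<Sum>S\<in>U. \<Sum>\<rho>\<in>P S. of_bool (flag_type (N i) (set_mset S) \<rho>))"
    proof (rule sum.cong[OF refl])
      fix S assume "S \<in> U"
      then show "of_bool (loopless (N i) \<and> nested (N i) S) = (\<Sum>\<rho>\<in>P S. of_bool (flag_type (N i) (set_mset S) \<rho>) :: int)"
        using nested_eq_sum_flag_type[OF N(1)[OF i], of S] N(2)[OF i] by (simp add: U_def P_def)
    qed
    finally show ?thesis .
  qed
  have "(\<Sum>i<s. a i * (if loopless (N i) then int (card {S. nested (N i) S \<and> size S = j}) else 0)) =
      (\<Sum>i<s. \<Sum>S\<in>U. \<Sum>\<rho>\<in>P S. a i * of_bool (flag_type (N i) (set_mset S) \<rho>))"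
    by (intro sum.cong refl) (simp only: lessThan_iff count sum_distrib_left)
  also have "\<dots> = (\<Sum>S\<in>U. \<Sum>i<s. \<Sum>\<rho>\<in>P S. a i * of_bool (flag_type (N i) (set_mset S) \<rho>))"
    by (rule sum.swap)
  also have "\<dots> = (\<Sum>S\<in>U. \<Sum>\<rho>\<in>P S. \<Sum>i<s. a i * of_bool (flag_type (N i) (set_mset S) \<rho>))"
    by (rule sum.cong[OF refl sum.swap])
  also have "\<dots> = 0"
  proof (rule sum.neutral, rule ballI, rule sum.neutral, rule ballI)
    fix S \<rho> assume "S \<in> U" "\<rho> \<in> P S"
    then show "(\<Sum>i<s. a i * of_bool (flag_type (N i) (set_mset S) \<rho>)) = 0"
      by (intro flag_type_valuative[OF N rel A]) (auto simp: U_def P_def)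
  qed
  finally show ?thesis .
qed

section \<open>Isomorphism invariance\<close>

locale iso_matroids =
  fixes M N :: matroid and \<phi> :: "nat \<Rightarrow> nat"
  assumes M: "is_matroid M" and N: "is_matroid N"
    and bij: "bij_betw \<phi> (ground M) (ground N)" and img: "(\<lambda>B. \<phi> ` B) ` bases M = bases N"
begin

lemma inj: "inj_on \<phi> (ground M)"
  using bij by (rule bij_betw_imp_inj_on)

lemma image_ground: "\<phi> ` ground M = ground N"
  using bij by (rule bij_betw_imp_surj_on)

lemma basis_sub: "B \<in> bases M \<Longrightarrow> B \<subseteq> ground M"
  using M by (simp add: is_matroid_def)

lemma rank_image: "X \<subseteq> ground M \<Longrightarrow> matroid_rank N (\<phi> ` X) = matroid_rank M X"
proof -
  assume X: "X \<subseteq> ground M"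
  have "card (\<phi> ` X \<inter> \<phi> ` B) = card (X \<inter> B)" if "B \<in> bases M" for B
  proof -
    have "\<phi> ` X \<inter> \<phi> ` B = \<phi> ` (X \<inter> B)"
      using inj_on_image_Int[OF inj X basis_sub[OF that]] by simp
    moreover have "inj_on \<phi> (X \<inter> B)" using inj X by (meson inf_le1 inj_on_subset subset_trans)
    ultimately show ?thesis by (simp add: card_image)
  qed
  then show ?thesis unfolding matroid_rank_def img[symmetric] image_image
    by (intro arg_cong[of _ _ Max] image_cong) auto
qed

lemma loopless_iff: "loopless N \<longleftrightarrow> loopless M"
proof -
  have "(\<exists>B\<in>bases M. \<phi> i \<in> \<phi> ` B) \<longleftrightarrow> (\<exists>B\<in>bases M. i \<in> B)" if "i \<in> ground M" for i
    by (intro bex_cong refl inj_on_image_mem_iff[OF inj that basis_sub])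
  then show ?thesis unfolding loopless_def image_ground[symmetric] img[symmetric] by simp
qed

lemma flat_image: "F \<subseteq> ground M \<Longrightarrow> \<phi> ` F \<in> flats N \<longleftrightarrow> F \<in> flats M"
proof -
  assume F: "F \<subseteq> ground M"
  have "ground N - \<phi> ` F = \<phi> ` (ground M - F)"
    unfolding image_ground[symmetric] using inj_on_image_set_diff[OF inj, of "ground M" F] F by simp
  moreover have "matroid_rank N (insert (\<phi> i) (\<phi> ` F)) = matroid_rank M (insert i F)" if "i \<in> ground M" for i
    using rank_image[of "insert i F"] F that by simp
  moreover have "\<phi> ` F \<subseteq> ground N" using F image_ground by blast
  ultimately show ?thesis using F rank_image[OF F] by (auto simp: flats_def)
qed

lemma image_subset_iff': "F \<subseteq> ground M \<Longrightarrow> G \<subseteq> ground M \<Longrightarrow> \<phi> ` F \<subseteq> \<phi> ` G \<longleftrightarrow> F \<subseteq> G"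
  using inj_on_image_mem_iff[OF inj] by blast

lemma inj_image: "inj_on (image \<phi>) (Pow (ground M))"
  by (rule inj_onI) (use image_subset_iff' in blast)

lemma count_image: "set_mset S \<subseteq> Pow (ground M) \<Longrightarrow> G \<in># S \<Longrightarrow> count (image_mset (image \<phi>) S) (\<phi> ` G) = count S G"
proof -
  assume S: "set_mset S \<subseteq> Pow (ground M)" and G: "G \<in># S"
  have "image \<phi> -` {\<phi> ` G} \<inter> set_mset S = {G}"
    using inj_onD[OF inj_image] S G by blast
  then show ?thesis by (simp add: count_image_mset)
qed

lemma nested_image:
  assumes S: "set_mset S \<subseteq> Pow (ground M)"
  shows "nested N (image_mset (image \<phi>) S) \<longleftrightarrow> nested M S"
proof -
  have sub: "F \<subseteq> ground M" if "F \<in># S" for F using S that by blast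
  have "\<phi> ` F \<subset> \<phi> ` G \<longleftrightarrow> F \<subset> G" if "F \<in># S" "G \<in># S" for F G
    unfolding less_le_not_le using image_subset_iff' sub that by simp
  then show ?thesis
    unfolding nested_def chain_subset_def
    using flat_image sub rank_image count_image[OF S] image_subset_iff'
    by (simp add: image_subset_iff subset_eq[of "set_mset S" "flats M"])
qed

lemma card_nested_eq: "card {S. nested M S \<and> size S = j} = card {S. nested N S \<and> size S = j}"
proof (rule bij_betw_same_card)
  define \<psi> where "\<psi> = inv_into (ground M) \<phi>"
  have M_flat: "set_mset S \<subseteq> Pow (ground M)" if "nested M S" for S
    using that by (auto simp: nested_def flats_def)
  have N_flat: "set_mset S \<subseteq> Pow (ground N)" if "nested N S" for S
    using that by (auto simp: nested_def flats_def)
  have \<psi>\<phi>: "\<psi> ` \<phi> ` F = F" if "F \<subseteq> ground M" for F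
    unfolding \<psi>_def by (rule inv_into_image_cancel[OF inj that])
  have \<phi>\<psi>: "\<phi> ` \<psi> ` F = F" if "F \<subseteq> ground N" for F
    unfolding \<psi>_def using that image_ground by (intro image_inv_into_cancel) auto
  have \<psi>_sub: "\<psi> ` F \<subseteq> ground M" if "F \<subseteq> ground N" for F
    unfolding \<psi>_def
  proof (rule image_subsetI)
    fix x assume "x \<in> F"
    then have "x \<in> \<phi> ` ground M" using that image_ground by auto
    then show "inv_into (ground M) \<phi> x \<in> ground M" by (rule inv_into_into)
  qed
  have image_preimage: "image_mset (image \<phi>) (image_mset (image \<psi>) T) = T" if "nested N T" for T
  proof -
    have "image_mset (\<lambda>F. \<phi> ` \<psi> ` F) T = image_mset id T"
    proof (rule image_mset_cong)
      fix F assume "F \<in># T"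
      then have "F \<subseteq> ground N" using N_flat[OF that] by blast
      then show "\<phi> ` \<psi> ` F = id F" by (simp only: \<phi>\<psi> id_apply)
    qed
    then show ?thesis by (simp add: image_mset.compositionality comp_def)
  qed
  have preimage_image: "image_mset (image \<psi>) (image_mset (image \<phi>) T) = T" if "nested M T" for T
  proof -
    have "image_mset (\<lambda>F. \<psi> ` \<phi> ` F) T = image_mset id T"
    proof (rule image_mset_cong)
      fix F assume "F \<in># T"
      then have "F \<subseteq> ground M" using M_flat[OF that] by blast
      then show "\<psi> ` \<phi> ` F = id F" by (simp only: \<psi>\<phi> id_apply)
    qed
    then show ?thesis by (simp add: image_mset.compositionality comp_def)
  qed
  have pull: "nested M (image_mset (image \<psi>) T)" if "nested N T" for T
  proof -
    have "set_mset (image_mset (image \<psi>) T) \<subseteq> Pow (ground M)"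
    proof
      fix G assume "G \<in># image_mset (image \<psi>) T"
      then obtain F where "F \<in># T" "G = \<psi> ` F" by auto
      then show "G \<in> Pow (ground M)" using N_flat[OF that] \<psi>_sub[of F] by blast
    qed
    from nested_image[OF this] image_preimage[OF that] that show ?thesis by simp
  qed
  show "bij_betw (image_mset (image \<phi>)) {S. nested M S \<and> size S = j} {S. nested N S \<and> size S = j}"
    by (rule bij_betw_byWitness[where f' = "image_mset (image \<psi>)"])
      (use preimage_image image_preimage pull nested_image M_flat in auto)
qed

lemma hilbert_poly_eq:
  assumes "loopless M"
  shows "hilbert_poly M = hilbert_poly N"
proof -
  interpret M: loopless_matroid M using M assms by unfold_locales
  interpret N: loopless_matroid N using N assms loopless_iff by unfold_locales auto
  show ?thesis
    by (rule poly_eqI) (simp add: M.coeff_hilbert_poly N.coeff_hilbert_poly M.nested_msets_def N.nested_msets_def card_nested_eq)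
qed

end

theorem theorem8p14:
  "valuative_invariant (\<lambda>M. if loopless M then hilbert_poly M else (0 :: int poly))"
  unfolding valuative_invariant_def
proof (intro conjI allI impI)
  show "valuation (\<lambda>M. if loopless M then hilbert_poly M else (0 :: int poly))"
    unfolding valuation_def
  proof (intro allI impI, elim conjE)
    fix A s N and a :: "nat \<Rightarrow> int"
    assume N: "\<forall>i<s. is_matroid (N i) \<and> ground (N i) = A"
      and rel: "\<forall>x\<in>coord_space A. (\<Sum>i<s. a i * indicator (base_polytope (N i)) x) = 0"
    show "(\<Sum>i<s. int_scale (a i) (if loopless (N i) then hilbert_poly (N i) else 0)) = 0"
    \<comment> \<open>An empty family does not force A to be finite, but its sum is trivially
      zero.\<close>
    proof (cases "s = 0")
      case False
      then have A: "finite A" using N by (auto simp: is_matroid_def)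
      have coeff: "Polynomial.coeff (if loopless (N i) then hilbert_poly (N i) else 0) j =
          (if loopless (N i) then int (card {S. nested (N i) S \<and> size S = j}) else 0)" if i: "i < s" for i j
      proof (cases "loopless (N i)")
        case True
        then interpret loopless_matroid "N i" using N i by unfold_locales auto
        show ?thesis using True by (simp add: coeff_hilbert_poly nested_msets_def)
      qed simp
      show ?thesis
      proof (rule poly_eqI)
        fix j
        have "Polynomial.coeff (\<Sum>i<s. int_scale (a i) (if loopless (N i) then hilbert_poly (N i) else 0)) j =
            (\<Sum>i<s. a i * Polynomial.coeff (if loopless (N i) then hilbert_poly (N i) else 0) j)"
          by (simp only: Polynomial.coeff_sum int_scale_eq_of_int_mult of_int_poly) (simp only: mult_pCons_left mult_zero_left pCons_0_0 add_0_right coeff_smult of_int_eq_id id_apply)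
        also have "\<dots> = (\<Sum>i<s. a i * (if loopless (N i) then int (card {S. nested (N i) S \<and> size S = j}) else 0))"
          by (rule sum.cong[OF refl]) (simp only: lessThan_iff coeff)
        also have "\<dots> = 0"
          using N rel by (intro card_nested_valuative[OF _ _ _ A]) auto
        finally show "Polynomial.coeff (\<Sum>i<s. int_scale (a i) (if loopless (N i) then hilbert_poly (N i) else 0)) j = Polynomial.coeff 0 j"
          by simp
      qed
    qed simp
  qed
next
  fix M N assume MN: "is_matroid M \<and> is_matroid N \<and> matroid_iso M N"
  then obtain \<phi> where "bij_betw \<phi> (ground M) (ground N)" "(\<lambda>B. \<phi> ` B) ` bases M = bases N"
    by (auto simp: matroid_iso_def)
  with MN interpret iso_matroids M N \<phi> by unfold_locales auto
  show "(if loopless M then hilbert_poly M else 0) = (if loopless N then hilbert_poly N else 0)"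
    using loopless_iff hilbert_poly_eq by simp
qed

end
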